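(* Let $G$ be a random graph $G(n,p)$ with $p = \Theta\left(\frac{\log n}{\sqrt{n}}\right)$. Then the Upcast algorithm solves the distributed Hamiltonian cycle problem on $G$ in $O(\sqrt{n}\log^2 n)$ rounds in the CONGEST model; both the success and the running-time bound hold with high probability.
   Context: $G(n,p)$: random graph on $n$ labelled vertices, each possible edge present independently with probability $p$. Logarithms are natural. "With high probability" means with probability at least $1 - 1/n^{c''}$ for some constant $c''>0$, over the random graph and the algorithm's random choices. CONGEST model: synchronous rounds; each node may send an $O(\log n)$-bit message over each incident edge per round; nodes have distinct identifiers and know their neighbours and $n$. Distributed Hamiltonian cycle problem: at the end, each node knows which two of its incident edges belong to the output, and the output edges form a Hamiltonian cycle of $G$. Upcast algorithm: (1) elect a leader $v$; (2) build a BFS tree $\mathcal{B}$ rooted at $v$; (3) every node other than $v$ samples $c'\log n$ of its incident edges independently and uniformly at random (for a sufficiently large constant $c'$) and sends them to $v$ along $\mathcal{B}$; (4) $v$ computes locally a Hamiltonian cycle of the sampled edges and downcasts it along $\mathcal{B}$. *)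

theory Defs
  imports "HOL-Probability.Probability" "HOL-Library.Landau_Symbols"
begin

section \<open>Graphs, Hamiltonian cycles and the random graph\<close>

text \<open>A graph is given by a finite vertex set \<open>V\<close> of naturals and a set \<open>E \<subseteq> all_edges V\<close>.
  The vertices double as the identifiers of the nodes.\<close>

definition all_edges :: "nat set \<Rightarrow> nat set set" where
  "all_edges V = {e. e \<subseteq> V \<and> card e = 2}"

definition neighbours :: "nat set set \<Rightarrow> nat \<Rightarrow> nat set" where
  "neighbours E u = {w. {u, w} \<in> E}"

definition cycle_edges :: "nat list \<Rightarrow> nat set set" where
  "cycle_edges xs = {{xs ! i, xs ! (Suc i mod length xs)} | i. i < length xs}"

definition ham_cycle :: "nat set \<Rightarrow> nat set set \<Rightarrow> nat list \<Rightarrow> bool" where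
  "ham_cycle V E xs \<longleftrightarrow>
     distinct xs \<and> set xs = V \<and> 3 \<le> length xs \<and> cycle_edges xs \<subseteq> E"

definition gnp :: "nat set \<Rightarrow> real \<Rightarrow> nat set set pmf" where
  "gnp V p = map_pmf (\<lambda>b. {e \<in> all_edges V. b e})
               (Pi_pmf (all_edges V) False (\<lambda>_. bernoulli_pmf p))"


section \<open>The CONGEST model\<close>

text \<open>What a node knows at the beginning: the number of nodes, its own identifier and the
  identifiers of its neighbours.\<close>

record view =
  net_size :: nat
  self :: nat
  nbrs :: "nat set"

definition view_of :: "nat set \<Rightarrow> nat set set \<Rightarrow> nat \<Rightarrow> view" where
  "view_of V E u = \<lparr>net_size = card V, self = u, nbrs = neighbours E u\<rparr>"

text \<open>Private randomness is drawn once, independently for every node, and handed to \<open>start\<close>;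
  afterwards a node is deterministic. In each round \<open>send s w\<close> is the message for the neighbour
  \<open>w\<close> and \<open>receive\<close> computes the next state from the messages that came in, indexed by their
  senders. A node with \<open>result s = Some y\<close> has halted with output \<open>y\<close>. The map \<open>encode\<close> gives
  the bit string by which a message is transmitted.\<close>

record ('r, 's, 'm, 'o) protocol =
  coins :: "view \<Rightarrow> 'r pmf"
  start :: "view \<Rightarrow> 'r \<Rightarrow> 's"
  send :: "view \<Rightarrow> 's \<Rightarrow> nat \<Rightarrow> 'm option"
  receive :: "view \<Rightarrow> 's \<Rightarrow> (nat \<Rightarrow> 'm option) \<Rightarrow> 's"
  result :: "'s \<Rightarrow> 'o option"
  encode :: "'m \<Rightarrow> bool list"

definition transmitted ::
  "('r, 's, 'm, 'o) protocol \<Rightarrow> nat set \<Rightarrow> nat set set \<Rightarrow> (nat \<Rightarrow> 's) \<Rightarrow> nat \<Rightarrow> nat \<Rightarrow> 'm option"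
where
  "transmitted A V E c u w =
     (if {u, w} \<in> E \<and> result A (c u) = None then send A (view_of V E u) (c u) w else None)"

fun config ::
  "('r, 's, 'm, 'o) protocol \<Rightarrow> nat set \<Rightarrow> nat set set \<Rightarrow> (nat \<Rightarrow> 'r) \<Rightarrow> nat \<Rightarrow> nat \<Rightarrow> 's"
where
  "config A V E \<omega> 0 u = start A (view_of V E u) (\<omega> u)"
| "config A V E \<omega> (Suc t) u =
     (let c = config A V E \<omega> t in
      if result A (c u) \<noteq> None then c u
      else receive A (view_of V E u) (c u) (\<lambda>w. transmitted A V E c w u))"

definition coin_space ::
  "('r, 's, 'm, 'o) protocol \<Rightarrow> nat set \<Rightarrow> nat set set \<Rightarrow> (nat \<Rightarrow> 'r) pmf" where
  "coin_space A V E = Pi_pmf V undefined (\<lambda>u. coins A (view_of V E u))"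

definition run_space ::
  "('r, 's, 'm, 'o) protocol \<Rightarrow> nat set \<Rightarrow> real \<Rightarrow> (nat set set \<times> (nat \<Rightarrow> 'r)) pmf" where
  "run_space A V p =
     do {E \<leftarrow> gnp V p; \<omega> \<leftarrow> coin_space A V E; return_pmf (E, \<omega>)}"

text \<open>Identifiers are below \<open>n ^ a\<close>, that is, they have \<open>O(log n)\<close> bits.\<close>

definition id_assignment :: "nat \<Rightarrow> nat \<Rightarrow> nat set \<Rightarrow> bool" where
  "id_assignment a n V \<longleftrightarrow> V \<subseteq> {..<n ^ a} \<and> card V = n"

text \<open>The bandwidth restriction holds on every graph and for all outcomes of the coins, not just
  with high probability.\<close>

definition congest :: "nat \<Rightarrow> real \<Rightarrow> ('r, 's, 'm, 'o) protocol \<Rightarrow> bool" where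
  "congest a B A \<longleftrightarrow> inj (encode A) \<and>
     (\<forall>n V E \<omega> t u w m. 2 \<le> n \<longrightarrow> id_assignment a n V \<longrightarrow> E \<subseteq> all_edges V \<longrightarrow>
        \<omega> \<in> set_pmf (coin_space A V E) \<longrightarrow>
        transmitted A V E (config A V E \<omega> t) u w = Some m \<longrightarrow>
        real (length (encode A m)) \<le> B * ln (real n))"

text \<open>After \<open>t\<close> rounds all nodes have halted, and their outputs are the pairs of edges by which
  one Hamiltonian cycle passes through them.\<close>

definition solves_ham ::
  "('r, 's, 'm, nat set set) protocol \<Rightarrow> nat set \<Rightarrow> nat set set \<Rightarrow> (nat \<Rightarrow> 'r) \<Rightarrow> nat \<Rightarrow> bool"
where
  "solves_ham A V E \<omega> t \<longleftrightarrow>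
     (\<exists>xs. ham_cycle V E xs \<and>
        (\<forall>u\<in>V. result A (config A V E \<omega> t u) = Some {e \<in> cycle_edges xs. u \<in> e}))"


section \<open>The Upcast algorithm\<close>

text \<open>The leader is the node with the smallest identifier. Every node starts as the root of its own
  tree; in each round it tells its neighbours the smallest identifier it has heard of (\<open>leader\<close>),
  and when it hears of a smaller one it joins that tree, its parent being a neighbour from which
  this identifier has just arrived. As rounds are synchronous, the tree of the node with the
  smallest identifier is a BFS tree. A node that joins a tree puts its sampled edges into its queue
  \<open>items\<close> and sends the queue, one edge per round and followed by what its children send, to its
  parent; an item \<open>(o, x)\<close> is the edge \<open>{o, x}\<close> sampled by the node \<open>o\<close>. Items belonging to
  the tree of another root are dropped.

  A root keeps the items it receives. It is the elected leader once it holds the samples of all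
  \<open>n - 1\<close> other nodes; this never happens at a node other than the one with the smallest
  identifier, since that one joins no tree and so sends no items. The leader then computes a
  Hamiltonian cycle and sends down an answer \<open>(o, x, y)\<close> for every other node \<open>o\<close>, where \<open>x\<close>
  and \<open>y\<close> are the neighbours of \<open>o\<close> on the cycle. Answers travel back along the path by which
  the items of \<open>o\<close> came up: \<open>route o\<close> is the child that delivered these items, as long as no
  answer for \<open>o\<close> has been seen, and \<open>down w\<close> is the queue of answers for the child \<open>w\<close>.\<close>

datatype msg =
  Msg (msg_leader: nat) (msg_item: "(nat \<times> nat) option") (msg_answer: "(nat \<times> nat \<times> nat) option")

record upcast_state =
  samples :: "nat list"
  leader :: nat
  parent :: "nat option"
  items :: "(nat \<times> nat) list"
  route :: "nat \<Rightarrow> nat option"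
  down :: "nat \<Rightarrow> (nat \<times> nat \<times> nat) list"
  known :: "nat set set option"

text \<open>Binary digits, least significant first, each preceded by a continuation bit.\<close>

fun encode_nat :: "nat \<Rightarrow> bool list" where
  "encode_nat x = (if x = 0 then [False] else True # odd x # encode_nat (x div 2))"

declare encode_nat.simps [simp del]

fun encode_msg :: "msg \<Rightarrow> bool list" where
  "encode_msg (Msg l i a) =
     encode_nat l @
     (case i of None \<Rightarrow> [False]
      | Some (u, x) \<Rightarrow> True # encode_nat u @ encode_nat x) @
     (case a of None \<Rightarrow> [False]
      | Some (u, x, y) \<Rightarrow> True # encode_nat u @ encode_nat x @ encode_nat y)"

definition sample_count :: "real \<Rightarrow> nat \<Rightarrow> nat" where
  "sample_count c n = nat \<lceil>c * ln (real n)\<rceil>"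

text \<open>Independent uniform samples from the incident edges, given by their other endpoints. All
  nodes hold samples, as the leader is not known in advance; the leader never uses its own.\<close>

definition upcast_coins :: "real \<Rightarrow> view \<Rightarrow> nat list pmf" where
  "upcast_coins c vw =
     (if nbrs vw = {} then return_pmf []
      else replicate_pmf (sample_count c (net_size vw)) (pmf_of_set (nbrs vw)))"

definition upcast_start :: "view \<Rightarrow> nat list \<Rightarrow> upcast_state" where
  "upcast_start vw r =
     \<lparr>samples = r, leader = self vw, parent = None, items = [], route = Map.empty,
      down = (\<lambda>_. []), known = None\<rparr>"

definition head :: "'a list \<Rightarrow> 'a option" where
  "head xs = (case xs of [] \<Rightarrow> None | x # _ \<Rightarrow> Some x)"

definition upcast_send :: "view \<Rightarrow> upcast_state \<Rightarrow> nat \<Rightarrow> msg option" where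
  "upcast_send vw s w =
     Some (Msg (leader s) (if parent s = Some w then head (items s) else None) (head (down s w)))"

definition inbox_list :: "view \<Rightarrow> (nat \<Rightarrow> msg option) \<Rightarrow> (nat \<times> msg) list" where
  "inbox_list vw inbox =
     map (\<lambda>w. (w, the (inbox w))) (filter (\<lambda>w. inbox w \<noteq> None) (sorted_list_of_set (nbrs vw)))"

text \<open>Either join a new tree, or remove from the queues what has been sent in this round.\<close>

definition update_tree :: "view \<Rightarrow> (nat \<times> msg) list \<Rightarrow> upcast_state \<Rightarrow> upcast_state" where
  "update_tree vw ms s =
     (let l = Min (insert (leader s) ((\<lambda>(w, m). msg_leader m) ` set ms)) in
      if l < leader s then
        s\<lparr>leader := l,
          parent := Some (fst (hd (filter (\<lambda>(w, m). msg_leader m = l) ms))),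
          items := map (\<lambda>x. (self vw, x)) (samples s),
          route := Map.empty, down := (\<lambda>_. [])\<rparr>
      else
        s\<lparr>items := (if parent s = None then items s else tl (items s)),
          down := (\<lambda>w. tl (down s w))\<rparr>)"

definition collect_items :: "(nat \<times> msg) list \<Rightarrow> upcast_state \<Rightarrow> upcast_state" where
  "collect_items ms s =
     (let new = filter (\<lambda>(w, m). msg_leader m = leader s \<and> msg_item m \<noteq> None) ms in
      s\<lparr>items := items s @ map (\<lambda>(w, m). the (msg_item m)) new,
        route := route s ++ map_of (map (\<lambda>(w, m). (fst (the (msg_item m)), w)) new)\<rparr>)"

definition take_answer :: "view \<Rightarrow> nat \<times> nat \<times> nat \<Rightarrow> upcast_state \<Rightarrow> upcast_state" where
  "take_answer vw a s =
     (case a of (u, x, y) \<Rightarrow>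
        if u = self vw then s\<lparr>known := Some {{u, x}, {u, y}}\<rparr>
        else case route s u of
            None \<Rightarrow> s
          | Some w \<Rightarrow> s\<lparr>down := (down s)(w := down s w @ [a]), route := (route s)(u := None)\<rparr>)"

definition answer_from_parent :: "view \<Rightarrow> (nat \<Rightarrow> msg option) \<Rightarrow> upcast_state \<Rightarrow> upcast_state" where
  "answer_from_parent vw inbox s =
     (case Option.bind (Option.bind (parent s) inbox) msg_answer of
        None \<Rightarrow> s
      | Some a \<Rightarrow> take_answer vw a s)"

definition cycle_answers :: "nat list \<Rightarrow> (nat \<times> nat \<times> nat) list" where
  "cycle_answers xs =
     map (\<lambda>i. (xs ! (Suc i mod length xs), xs ! i, xs ! (Suc (Suc i) mod length xs)))
       [0..<length xs]"

definition all_collected :: "real \<Rightarrow> view \<Rightarrow> upcast_state \<Rightarrow> bool" where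
  "all_collected c vw s \<longleftrightarrow>
     card (insert (self vw) (fst ` set (items s))) = net_size vw \<and>
     (\<forall>u \<in> fst ` set (items s).
        length (filter (\<lambda>i. fst i = u) (items s)) = sample_count c (net_size vw))"

text \<open>The local computation of the leader is done by an arbitrary solver.\<close>

definition ham_solver :: "(nat set \<Rightarrow> nat set set \<Rightarrow> nat list option) \<Rightarrow> bool" where
  "ham_solver solve \<longleftrightarrow>
     (\<forall>V E. case solve V E of
        None \<Rightarrow> \<not> (\<exists>xs. ham_cycle V E xs)
      | Some xs \<Rightarrow> ham_cycle V E xs)"

definition leader_computes ::
  "(nat set \<Rightarrow> nat set set \<Rightarrow> nat list option) \<Rightarrow> real \<Rightarrow> view \<Rightarrow> upcast_state \<Rightarrow> upcast_state"
where
  "leader_computes solve c vw s =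
     (if parent s = None \<and> known s = None \<and> all_collected c vw s then
        case solve (insert (self vw) (fst ` set (items s))) ((\<lambda>(u, x). {u, x}) ` set (items s)) of
          None \<Rightarrow> s
        | Some xs \<Rightarrow> fold (take_answer vw) (cycle_answers xs) s
      else s)"

definition upcast_receive ::
  "(nat set \<Rightarrow> nat set set \<Rightarrow> nat list option) \<Rightarrow> real \<Rightarrow> view \<Rightarrow> upcast_state \<Rightarrow>
   (nat \<Rightarrow> msg option) \<Rightarrow> upcast_state"
where
  "upcast_receive solve c vw s inbox =
     (let ms = inbox_list vw inbox in
      leader_computes solve c vw
        (answer_from_parent vw inbox (collect_items ms (update_tree vw ms s))))"

text \<open>A node halts when it knows its two edges and has passed on the answers for all nodes below
  it in the tree.\<close>

definition upcast_result :: "upcast_state \<Rightarrow> nat set set option" where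
  "upcast_result s =
     (if route s = Map.empty \<and> (\<forall>w. down s w = []) then known s else None)"

definition upcast ::
  "(nat set \<Rightarrow> nat set set \<Rightarrow> nat list option) \<Rightarrow> real \<Rightarrow>
   (nat list, upcast_state, msg, nat set set) protocol"
where
  "upcast solve c =
     \<lparr>coins = upcast_coins c, start = upcast_start, send = upcast_send,
      receive = upcast_receive solve c, result = upcast_result, encode = encode_msg\<rparr>"

end

theory Submission
  imports Defs
begin

text \<open>
  With high probability all degrees are \<open>O(n p)\<close> and every node has distance at most two from
  the node with the smallest identifier. On such a network the BFS tree has depth two, every
  queue holds at most \<open>O(n p log n) = O(\<surd>n log\<^sup>2 n)\<close> items, and the answers return equally fast.

  It remains to find a Hamiltonian cycle among the sampled edges. If a node drew a Poisson number of
  samples, each incident edge would be hit independently of the others; so, up to the event that the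
  Poisson number exceeds the number of actual samples, the sampled edges contain an
  independently thinned copy of \<open>G(n,p)\<close>, which is a random graph \<open>G(n, C log n / n)\<close>.
  Such a graph is Hamiltonian: a first part of its edges makes it an expander, in which by Posa's
  rotations quadratically many pairs are boosters as long as there is no Hamiltonian cycle, and the
  other edges, exposed in \<open>n\<close> rounds, hit a booster in every round.
\<close>

text \<open>A Poisson count removes the first obstacle, an owner for every edge the second. The
  coupling needs bounded degrees and is therefore made for each graph separately, but its failure
  term is averaged over all graphs, so no conditioning disturbs the law of the thinned graph. Depth
  two is possible because \<open>p^2 * n\<close> is of order \<open>(ln n)^2\<close>, so a missing
  common neighbour with the leader has smaller than polynomial probability. In the sprinkling, every
  round needs fresh edges since the boosters depend on those already present. The protocol side is
  deterministic. Its obstacle is that nobody tells the leader when the collection is complete. The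
  multiset of all queued items is conserved, so the leader's count of samples per origin succeeds
  exactly when all other queues are empty. By then every node is also in the routing tables on its
  path, so each answer finds its way back.\<close>

lemma finite_all_edges: "finite V \<Longrightarrow> finite (all_edges V)"
  unfolding all_edges_def by simp

section \<open>Rotations and boosters\<close>

definition is_path :: "nat set \<Rightarrow> nat set set \<Rightarrow> nat list \<Rightarrow> bool" where
  "is_path V H xs \<longleftrightarrow>
     xs \<noteq> [] \<and> distinct xs \<and> set xs \<subseteq> V \<and> successively (\<lambda>x y. {x, y} \<in> H) xs"

definition longest_path :: "nat set \<Rightarrow> nat set set \<Rightarrow> nat list \<Rightarrow> bool" where
  "longest_path V H xs \<longleftrightarrow> is_path V H xs \<and> (\<forall>ys. is_path V H ys \<longrightarrow> length ys \<le> length xs)"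

fun path_edges :: "nat list \<Rightarrow> nat set set" where
  "path_edges (x # y # zs) = insert {x, y} (path_edges (y # zs))"
| "path_edges _ = {}"

text \<open>A Posa rotation with the first vertex held fixed: the chord from \<open>u\<close> to the
  last vertex replaces the path edge from \<open>u\<close> to \<open>hd qs\<close>, which becomes
  the new last vertex.\<close>

inductive rotation :: "nat set set \<Rightarrow> nat list \<Rightarrow> nat list \<Rightarrow> bool" for H xs where
  rotation_refl: "rotation H xs xs"
| rotation_step: "rotation H xs (ps @ u # qs) \<Longrightarrow> qs \<noteq> [] \<Longrightarrow> {u, last qs} \<in> H \<Longrightarrow>
    rotation H xs (ps @ u # rev qs)"

definition endpoints :: "nat set set \<Rightarrow> nat list \<Rightarrow> nat set" where
  "endpoints H xs = {last ys | ys. rotation H xs ys}"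

definition outer_nbrs :: "nat set set \<Rightarrow> nat set \<Rightarrow> nat set" where
  "outer_nbrs H S = (\<Union>x\<in>S. neighbours H x) - S"

text \<open>The factor two is what Posa's lemma contradicts: the endpoints of a longest path have at
  most twice as many outer neighbours, so in an expander they must exceed a quarter of the
  vertices.\<close>

definition expander :: "nat set \<Rightarrow> nat set set \<Rightarrow> bool" where
  "expander V H \<longleftrightarrow> H \<subseteq> all_edges V \<and>
     (\<forall>S. S \<subseteq> V \<longrightarrow> S \<noteq> {} \<longrightarrow> 4 * card S \<le> card V \<longrightarrow> 2 * card S < card (outer_nbrs H S))"

lemma is_path_mono: "is_path V H xs \<Longrightarrow> H \<subseteq> H' \<Longrightarrow> is_path V H' xs"
  unfolding is_path_def by (auto intro: successively_mono)

lemma is_path_rev: "is_path V H xs \<Longrightarrow> is_path V H (rev xs)"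
  unfolding is_path_def by (simp add: insert_commute)

lemma length_path_le: "finite V \<Longrightarrow> is_path V H xs \<Longrightarrow> length xs \<le> card V"
  unfolding is_path_def by (metis card_mono distinct_card)

lemma longest_path_rev: "longest_path V H xs \<Longrightarrow> longest_path V H (rev xs)"
  unfolding longest_path_def by (simp add: is_path_rev)

lemma longest_path_exists:
  assumes "finite V" "is_path V H xs"
  obtains ys where "longest_path V H ys" "length xs \<le> length ys"
proof -
  have "\<exists>ys. is_path V H ys \<and> (\<forall>zs. is_path V H zs \<longrightarrow> length zs \<le> length ys)"
    using ex_has_greatest_nat[of "is_path V H" xs length "Suc (card V)"] assms length_path_le
    by (metis less_Suc_eq_le)
  then show ?thesis using that assms(2) unfolding longest_path_def by blast
qed

section \<open>Edges of a path and degrees along it\<close>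

lemma path_edges_append:
  "path_edges (xs @ y # ys) = path_edges (xs @ [y]) \<union> path_edges (y # ys)"
proof (induction xs)
  case (Cons x xs)
  then show ?case by (cases xs) auto
qed simp

lemma path_edges_snoc:
  "xs \<noteq> [] \<Longrightarrow> path_edges (xs @ [y]) = insert {last xs, y} (path_edges xs)"
proof (induction xs)
  case (Cons x xs)
  then show ?case by (cases xs) auto
qed simp

lemma path_edges_rev: "path_edges (rev xs) = path_edges xs"
proof (induction xs)
  case (Cons x xs)
  then show ?case
    by (cases xs) (auto simp: path_edges_snoc insert_commute last_rev simp del: rev.simps(2)
        simp: rev.simps(2)[of x])
qed simp

lemma path_edges_subset_set: "f \<in> path_edges xs \<Longrightarrow> f \<subseteq> set xs"
  by (induction xs rule: path_edges.induct) auto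

lemma finite_path_edges: "finite (path_edges xs)"
  by (induction xs rule: path_edges.induct) auto

lemma path_edges_at:
  assumes "distinct (ps @ u # qs)"
  shows "{f \<in> path_edges (ps @ u # qs). u \<in> f} =
     (if ps = [] then {} else {{last ps, u}}) \<union> (if qs = [] then {} else {{u, hd qs}})"
proof -
  have 1: "{f \<in> path_edges (ps @ [u]). u \<in> f} = (if ps = [] then {} else {{last ps, u}})"
    using assms path_edges_subset_set[of _ ps] by (auto simp: path_edges_snoc)
  have 2: "{f \<in> path_edges (u # qs). u \<in> f} = (if qs = [] then {} else {{u, hd qs}})"
    using assms path_edges_subset_set[of _ qs] by (cases qs) auto
  show ?thesis unfolding path_edges_append[of ps u qs] using 1 2 by blast
qed

text \<open>Away from the last vertex the count depends only on whether \<open>u\<close> comes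
  first, and rotations fix the first vertex. So a vertex that is never an endpoint has the same
  number of path edges before and after any rotations.\<close>

lemma card_path_edges_at:
  assumes "distinct ys" "u \<in> set ys" "u \<noteq> last ys"
  shows "card {f \<in> path_edges ys. u \<in> f} = (if u = hd ys then 1 else 2)"
proof -
  obtain ps qs where ys: "ys = ps @ u # qs" using assms(2) by (meson split_list)
  have qs: "qs \<noteq> []" using assms(3) ys by auto
  have "last ps \<noteq> hd qs" if "ps \<noteq> []"
    using assms(1) ys qs that by (metis disjoint_insert(2) distinct_append hd_in_set
        last_in_set list.simps(15) Int_iff empty_iff insert_iff)
  moreover have "u = hd ys \<longleftrightarrow> ps = []"
    using assms(1) ys by (cases ps) auto
  ultimately show ?thesis
    using path_edges_at[of ps u qs] assms(1) ys qs by (auto simp: doubleton_eq_iff)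
qed

lemma card_2_le: "card {x, y} \<le> 2"
  by (cases "x = y") auto

lemma card_path_nbrs_le:
  assumes "distinct ys" "z \<in> set ys"
  shows "finite {u. {u, z} \<in> path_edges ys} \<and> card {u. {u, z} \<in> path_edges ys} \<le> 2"
proof -
  obtain ps qs where ys: "ys = ps @ z # qs" using assms(2) by (meson split_list)
  have "{u. {u, z} \<in> path_edges ys} \<subseteq> {last ps, hd qs}"
  proof
    fix u assume "u \<in> {u. {u, z} \<in> path_edges ys}"
    then have "{u, z} \<in> {f \<in> path_edges (ps @ z # qs). z \<in> f}" using ys by auto
    also have "\<dots> \<subseteq> {{last ps, z}, {z, hd qs}}"
      unfolding path_edges_at[OF assms(1)[unfolded ys]] by simp
    finally show "u \<in> {last ps, hd qs}" by (auto simp: doubleton_eq_iff)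
  qed
  then show ?thesis
    using card_mono[of "{last ps, hd qs}"] card_2_le[of "last ps" "hd qs"]
    by (meson finite.emptyI finite_insert finite_subset le_trans)
qed

section \<open>Rotations and the number of endpoints\<close>

lemma rotation_path:
  assumes "rotation H xs ys" "is_path V H xs"
  shows "is_path V H ys \<and> set ys = set xs \<and> hd ys = hd xs \<and> length ys = length xs"
  using assms
proof (induction rule: rotation.induct)
  case (rotation_step ps u qs)
  then have IH: "is_path V H (ps @ u # qs)" "set (ps @ u # qs) = set xs"
    "hd (ps @ u # qs) = hd xs" "length (ps @ u # qs) = length xs" by auto
  have "successively (\<lambda>x y. {x, y} \<in> H) (ps @ u # rev qs)"
    using IH(1) rotation_step.hyps
    by (auto simp: is_path_def successively_append_iff successively_Cons insert_commute hd_rev)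
  moreover have "distinct (ps @ u # rev qs)" "set (ps @ u # rev qs) = set xs" "set xs \<subseteq> V"
    using IH(1,2) by (auto simp: is_path_def)
  moreover have "hd (ps @ u # rev qs) = hd xs" using IH(3) by (cases ps) auto
  ultimately show ?case using IH(4) by (simp add: is_path_def)
qed auto

lemma rotation_keeps_edges:
  assumes "rotation H xs ys" "f \<in> path_edges xs"
  shows "f \<in> path_edges ys \<or> f \<inter> endpoints H xs \<noteq> {}"
  using assms
proof (induction rule: rotation.induct)
  case (rotation_step ps u qs)
  have new: "rotation H xs (ps @ u # rev qs)"
    using rotation_step.hyps by (rule rotation.rotation_step)
  have "last (ps @ u # rev qs) = hd qs"
    using rotation_step.hyps(2) by (simp add: last_rev)
  then have "hd qs \<in> endpoints H xs"
    using new unfolding endpoints_def by (metis (mono_tags, lifting) mem_Collect_eq)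
  moreover have "path_edges (u # qs) = insert {u, hd qs} (path_edges qs)"
    using rotation_step.hyps(2) by (cases qs) auto
  moreover have "path_edges qs \<subseteq> path_edges (u # rev qs)"
    using rotation_step.hyps(2) path_edges_rev[of qs] by (cases "rev qs") auto
  ultimately show ?case
    using rotation_step.IH rotation_step.prems path_edges_append[of ps u qs]
      path_edges_append[of ps u "rev qs"] by auto
qed simp

lemma endpoints_subset:
  assumes "is_path V H xs"
  shows "endpoints H xs \<subseteq> set xs"
proof
  fix z assume "z \<in> endpoints H xs"
  then obtain ys where "rotation H xs ys" "z = last ys" unfolding endpoints_def by blast
  then show "z \<in> set xs" using rotation_path[of H xs ys V] assms unfolding is_path_def by auto
qed

lemma last_in_endpoints: "last xs \<in> endpoints H xs"
  unfolding endpoints_def using rotation_refl by blast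

text \<open>Posa's lemma: a path edge that a rotation destroys has the new endpoint at one end, hence a
  vertex outside the endpoint set keeps both its path edges unless one of them leads into it.\<close>

lemma outer_nbrs_endpoints:
  assumes lp: "longest_path V H xs" and HV: "H \<subseteq> all_edges V"
  shows "outer_nbrs H (endpoints H xs) \<subseteq> (\<Union>z\<in>endpoints H xs. {u. {u, z} \<in> path_edges xs})"
proof
  let ?R = "endpoints H xs"
  have px: "is_path V H xs" using lp unfolding longest_path_def by simp
  fix u assume "u \<in> outer_nbrs H ?R"
  then obtain z where z: "z \<in> ?R" "{z, u} \<in> H" and u: "u \<notin> ?R"
    unfolding outer_nbrs_def neighbours_def by auto
  obtain ys where ys: "rotation H xs ys" "z = last ys" using z(1) unfolding endpoints_def by blast
  have py: "is_path V H ys" "set ys = set xs" "hd ys = hd xs" "length ys = length xs"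
    using rotation_path[OF ys(1) px] by auto
  have uV: "u \<in> V" using z(2) HV unfolding all_edges_def by auto
  have uys: "u \<in> set ys"
  proof (rule ccontr)
    assume "u \<notin> set ys"
    then have "is_path V H (ys @ [u])"
      using py(1) uV z(2) ys(2) unfolding is_path_def by (auto simp: successively_append_iff)
    then show False using lp py(4) unfolding longest_path_def by fastforce
  qed
  then obtain ps qs where dec: "ys = ps @ u # qs" by (meson split_list)
  have uz: "u \<noteq> last ys" using u z(1) ys(2) by auto
  then have qs: "qs \<noteq> []" using dec by auto
  have "rotation H xs (ps @ u # rev qs)"
    using rotation_step[of H xs ps u qs] ys dec qs z(2) by (simp add: insert_commute)
  moreover have "last (ps @ u # rev qs) = hd qs" using qs by (simp add: last_rev)
  ultimately have h: "hd qs \<in> ?R"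
    unfolding endpoints_def by (metis (mono_tags, lifting) mem_Collect_eq)
  have dy: "distinct ys" and dx: "distinct xs" using py(1) px unfolding is_path_def by auto
  have hy: "{u, hd qs} \<in> {f \<in> path_edges ys. u \<in> f}"
    using path_edges_at[of ps u qs] dy dec qs by auto
  show "u \<in> (\<Union>z\<in>?R. {u. {u, z} \<in> path_edges xs})"
  proof (cases "\<exists>f\<in>path_edges xs. u \<in> f \<and> f \<notin> path_edges ys")
    case True
    then obtain f where f: "f \<in> path_edges xs" "u \<in> f" "f \<notin> path_edges ys" by blast
    then obtain r where r: "r \<in> f" "r \<in> ?R" using rotation_keeps_edges[OF ys(1) f(1)] by auto
    have "\<exists>a b. f = {a, b}" using f(1) by (induction xs rule: path_edges.induct) auto
    then have "f = {u, r}" using f(2) r u by auto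
    then show ?thesis using f(1) r(2) by auto
  next
    case False
    have "last xs \<noteq> u" using u last_in_endpoints by metis
    then have "card {f \<in> path_edges xs. u \<in> f} = card {f \<in> path_edges ys. u \<in> f}"
      using card_path_edges_at[OF dy uys uz] card_path_edges_at[OF dx] uys py by auto
    moreover have "{f \<in> path_edges xs. u \<in> f} \<subseteq> {f \<in> path_edges ys. u \<in> f}" using False by auto
    ultimately have "{f \<in> path_edges xs. u \<in> f} = {f \<in> path_edges ys. u \<in> f}"
      by (simp add: card_subset_eq finite_path_edges)
    then show ?thesis using hy h by auto
  qed
qed

text \<open>Each endpoint has at most two neighbours on the path, so the endpoint set has at most
  twice its size in outer neighbours. An expander forbids this for sets of at most a quarter of the
  vertices.\<close>

lemma card_endpoints:
  assumes lp: "longest_path V H xs" and ex: "expander V H" and "finite V"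
  shows "card V < 4 * card (endpoints H xs)"
proof (rule ccontr)
  let ?R = "endpoints H xs"
  assume "\<not> card V < 4 * card ?R"
  then have small: "4 * card ?R \<le> card V" by simp
  have px: "is_path V H xs" using lp unfolding longest_path_def by simp
  have RV: "?R \<subseteq> set xs" using endpoints_subset[OF px] .
  have finR: "finite ?R" using RV finite_subset by auto
  have HV: "H \<subseteq> all_edges V" using ex unfolding expander_def by simp
  have dx: "distinct xs" "set xs \<subseteq> V" using px unfolding is_path_def by auto
  have nb: "finite {u. {u, z} \<in> path_edges xs} \<and> card {u. {u, z} \<in> path_edges xs} \<le> 2"
    if "z \<in> ?R" for z using card_path_nbrs_le[OF dx(1)] that RV by auto
  have "card (outer_nbrs H ?R) \<le> card (\<Union>z\<in>?R. {u. {u, z} \<in> path_edges xs})"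
    using outer_nbrs_endpoints[OF lp HV] nb finR by (intro card_mono) auto
  also have "\<dots> \<le> (\<Sum>z\<in>?R. card {u. {u, z} \<in> path_edges xs})"
    by (rule card_UN_le[OF finR])
  also have "\<dots> \<le> (\<Sum>z\<in>?R. 2)" using nb by (intro sum_mono) auto
  finally have "card (outer_nbrs H ?R) \<le> 2 * card ?R" by simp
  moreover have "?R \<noteq> {}" using last_in_endpoints by fastforce
  moreover have "?R \<subseteq> V" using RV dx(2) by blast
  ultimately show False
    using ex[unfolded expander_def, THEN conjunct2, rule_format, of ?R] small by linarith
qed

section \<open>Connectivity of expanders and boosters\<close>

lemma expander_leaves:
  assumes ex: "expander V H" and fin: "finite V" and n: "12 \<le> card V"
    and W: "W \<subseteq> V" "W \<noteq> {}" "W \<noteq> V"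
  shows "\<exists>x\<in>W. \<exists>y\<in>V - W. {x, y} \<in> H"
proof -
  have HV: "H \<subseteq> all_edges V" using ex unfolding expander_def by simp
  have main: "\<exists>x\<in>K. \<exists>y\<in>V - K. {x, y} \<in> H"
    if K: "K \<subseteq> V" "K \<noteq> {}" "2 * card K \<le> card V" for K
  proof -
    have finK: "finite K" using K(1) fin finite_subset by auto
    \<comment> \<open>If all outer neighbours of \<open>S\<close> stayed in \<open>K\<close>, then
      \<open>3 * s < card K\<close>. This fails for \<open>s = card K\<close>, and also for
      \<open>s = card V div 4\<close>, since \<open>card K\<close> is at most half of
      \<open>card V\<close> and \<open>card V\<close> is at least 12.\<close>
    define s where "s = min (card K) (card V div 4)"
    obtain S where S: "S \<subseteq> K" "card S = s"
      by (rule obtain_subset_with_card_n[of s K]) (auto simp: s_def)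
    have "s \<noteq> 0" unfolding s_def using K(2) finK n by (auto simp: card_gt_0_iff)
    then have "S \<noteq> {}" using S by auto
    moreover have "S \<subseteq> V" "4 * card S \<le> card V" using S K(1) unfolding s_def by auto
    ultimately have big: "2 * card S < card (outer_nbrs H S)"
      using ex unfolding expander_def by blast
    have "\<not> outer_nbrs H S \<subseteq> K - S"
    proof
      assume a: "outer_nbrs H S \<subseteq> K - S"
      then have "card (outer_nbrs H S) \<le> card K - card S"
        using card_mono[OF _ a] finK S by (simp add: card_Diff_subset finite_subset)
      then show False using big S(2) K(3) n unfolding s_def by (auto simp: min_def split: if_splits)
    qed
    then obtain y x where y: "y \<notin> K" "x \<in> S" "{x, y} \<in> H"
      unfolding outer_nbrs_def neighbours_def by blast
    moreover have "y \<in> V" using y(3) HV unfolding all_edges_def by blast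
    ultimately show ?thesis using S(1) by blast
  qed
  have cardW: "card W + card (V - W) = card V"
    using W(1) fin by (simp add: card_Diff_subset finite_subset card_mono)
  show ?thesis
  proof (cases "2 * card W \<le> card V")
    case True then show ?thesis using main[of W] W by auto
  next
    case False
    then have "\<exists>x\<in>V - W. \<exists>y\<in>V - (V - W). {x, y} \<in> H" using main[of "V - W"] W cardW by auto
    then show ?thesis by (metis Diff_iff insert_commute)
  qed
qed

lemma ham_cycle_of_path:
  assumes "is_path V H xs" "{last xs, hd xs} \<in> H" "set xs = V" "3 \<le> length xs"
  shows "ham_cycle V H xs"
proof -
  have "{xs ! i, xs ! (Suc i mod length xs)} \<in> H" if "i < length xs" for i
  proof (cases "Suc i < length xs")
    case True
    then show ?thesis using assms(1) unfolding is_path_def successively_conv_nth by auto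
  next
    case False
    then have "i = length xs - 1" using that by simp
    then show ?thesis using assms by (simp add: hd_conv_nth last_conv_nth is_path_def)
  qed
  then show ?thesis using assms unfolding ham_cycle_def cycle_edges_def is_path_def by auto
qed

definition booster :: "nat set \<Rightarrow> nat set set \<Rightarrow> nat set \<Rightarrow> bool" where
  "booster V H e \<longleftrightarrow> (\<exists>xs. ham_cycle V (insert e H) xs) \<or>
     (\<exists>ys. is_path V (insert e H) ys \<and> (\<forall>xs. is_path V H xs \<longrightarrow> length xs < length ys))"

text \<open>Closing a longest path gives a cycle on its vertices. If the cycle misses a vertex, some
  edge of the expander leaves it, and opening the cycle where that edge starts gives a path with one
  more vertex.\<close>

lemma booster_closing_edge:
  assumes ex: "expander V H" and fin: "finite V" and n: "12 \<le> card V"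
    and lp: "longest_path V H xs" and len: "3 \<le> length xs"
  shows "booster V H {hd xs, last xs}"
proof -
  let ?H = "insert {hd xs, last xs} H"
  have px: "is_path V H xs" using lp unfolding longest_path_def by simp
  have px': "is_path V ?H xs" using px by (rule is_path_mono) auto
  show ?thesis
  proof (cases "set xs = V")
    case True
    then have "ham_cycle V ?H xs"
      using ham_cycle_of_path[OF px' _ True len] by (simp add: insert_commute)
    then show ?thesis unfolding booster_def by blast
  next
    case False
    moreover have "set xs \<subseteq> V" "set xs \<noteq> {}" using px unfolding is_path_def by auto
    ultimately obtain x y where xy: "x \<in> set xs" "y \<in> V" "y \<notin> set xs" "{x, y} \<in> H"
      using expander_leaves[OF ex fin n, of "set xs"] by auto
    obtain ps qs where dec: "xs = ps @ x # qs" using xy(1) by (meson split_list)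
    have "is_path V ?H (y # x # qs @ ps)"
      using px' xy dec unfolding is_path_def
      by (auto simp: successively_append_iff successively_Cons insert_commute split: if_splits)
    moreover have "\<forall>zs. is_path V H zs \<longrightarrow> length zs < length (y # x # qs @ ps)"
      using lp dec unfolding longest_path_def by (auto simp: less_Suc_eq_le)
    ultimately show ?thesis unfolding booster_def by blast
  qed
qed

text \<open>Single vertices already have more than two neighbours, so a path
  \<open>[a, x, b]\<close> exists. Length three makes the two ends of a longest path distinct and
  its closure a genuine cycle.\<close>

lemma expander_path_length:
  assumes ex: "expander V H" and fin: "finite V" and n: "12 \<le> card V"
    and lp: "longest_path V H xs"
  shows "3 \<le> length xs"
proof -
  have "V \<noteq> {}" using n by auto
  then obtain x where x: "x \<in> V" by blast
  have big: "2 < card (outer_nbrs H {x})"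
  proof -
    have "2 * card {x} < card (outer_nbrs H {x})"
      using ex[unfolded expander_def, THEN conjunct2, rule_format, of "{x}"] x n by simp
    then show ?thesis by simp
  qed
  then have "2 \<le> card (outer_nbrs H {x})" by simp
  then obtain T where "T \<subseteq> outer_nbrs H {x}" "card T = 2"
    by (rule obtain_subset_with_card_n)
  then obtain a b where ab: "a \<noteq> b" "a \<in> outer_nbrs H {x}" "b \<in> outer_nbrs H {x}"
    by (auto simp: card_2_iff)
  then have "is_path V H [a, x, b]"
    using ex x unfolding is_path_def outer_nbrs_def neighbours_def expander_def all_edges_def
    by (auto simp: insert_commute)
  then show ?thesis using lp unfolding longest_path_def by fastforce
qed

lemma card_ordered_pairs_le:
  fixes B :: "nat set set"
  assumes "finite B" "B \<subseteq> all_edges V"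
  shows "card {(z, w). {z, w} \<in> B} \<le> 2 * card B \<and> finite {(z, w). {z, w} \<in> B}"
proof -
  have sub: "{(z, w). {z, w} \<in> B} \<subseteq> (\<Union>e\<in>B. {(Min e, Max e), (Max e, Min e)})"
  proof clarify
    fix z w :: nat assume e: "{z, w} \<in> B"
    have "(z, w) \<in> {(Min {z, w}, Max {z, w}), (Max {z, w}, Min {z, w})}"
      by (cases "z \<le> w") (simp_all add: min_def max_def)
    then show "(z, w) \<in> (\<Union>e\<in>B. {(Min e, Max e), (Max e, Min e)})" using e by blast
  qed
  have "card (\<Union>e\<in>B. {(Min e, Max e), (Max e, Min e)}) \<le>
      (\<Sum>e\<in>B. card {(Min e, Max e), (Max e, Min e)})"
    by (rule card_UN_le[OF assms(1)])
  also have "\<dots> \<le> (\<Sum>e\<in>B. 2)" by (intro sum_mono card_2_le)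
  finally have "card (\<Union>e\<in>B. {(Min e, Max e), (Max e, Min e)}) \<le> 2 * card B" by simp
  moreover have fin: "finite (\<Union>e\<in>B. {(Min e, Max e), (Max e, Min e)})" using assms(1) by simp
  ultimately show ?thesis using card_mono[OF fin sub] finite_subset[OF sub fin] by linarith
qed

text \<open>Each of the more than \<open>n / 4\<close> endpoints \<open>z\<close> of a longest path
  starts a longest path of its own, the reversed one. Rotating that with \<open>z\<close> fixed
  reaches more than \<open>n / 4\<close> partners \<open>w\<close>, and every \<open>{z, w}\<close>
  closes a longest path. Passing to unordered pairs halves \<open>(n / 4)^2\<close>.\<close>

lemma card_boosters:
  assumes ex: "expander V H" and fin: "finite V" and n: "12 \<le> card V"
  shows "(real (card V))\<^sup>2 / 32 \<le> real (card {e \<in> all_edges V. booster V H e})"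
proof -
  let ?B = "{e \<in> all_edges V. booster V H e}"
  have "V \<noteq> {}" using n by auto
  then obtain x where "x \<in> V" by blast
  then have "is_path V H [x]" unfolding is_path_def by auto
  then obtain xs where lp: "longest_path V H xs" using longest_path_exists[OF fin] by blast
  define R where "R = endpoints H xs"
  have "\<exists>ys. longest_path V H ys \<and> hd ys = z" if zR: "z \<in> R" for z
  proof -
    obtain ys where ys: "rotation H xs ys" "z = last ys" using zR unfolding R_def endpoints_def by blast
    have "longest_path V H ys" using rotation_path[OF ys(1)] lp unfolding longest_path_def by auto
    then have "longest_path V H (rev ys)" by (rule longest_path_rev)
    then show ?thesis using ys(2) hd_rev by metis
  qed
  then obtain Y where Y: "\<And>z. z \<in> R \<Longrightarrow> longest_path V H (Y z) \<and> hd (Y z) = z" by metis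
  have bo: "{z, w} \<in> ?B" if z: "z \<in> R" and w: "w \<in> endpoints H (Y z)" for z w
  proof -
    obtain ys where ys: "rotation H (Y z) ys" "w = last ys" using w unfolding endpoints_def by blast
    have pY: "is_path V H (Y z)" using Y[OF z] unfolding longest_path_def by simp
    have rp: "is_path V H ys" "hd ys = z" "length ys = length (Y z)"
      using rotation_path[OF ys(1) pY] Y[OF z] by auto
    then have lpy: "longest_path V H ys" using Y[OF z] unfolding longest_path_def by auto
    have len: "3 \<le> length ys" using expander_path_length[OF ex fin n lpy] .
    then have "hd ys \<noteq> last ys" using rp(1) unfolding is_path_def
      by (cases ys) auto
    then have "{z, w} \<in> all_edges V"
      using rp ys(2) unfolding is_path_def all_edges_def by auto
    then show ?thesis using booster_closing_edge[OF ex fin n lpy len] rp(2) ys(2) by auto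
  qed
  have fin_end: "finite (endpoints H zs)" if "longest_path V H zs" for zs
    using that finite_subset[OF endpoints_subset[of V H zs]] unfolding longest_path_def by simp
  have finR: "finite R" unfolding R_def using fin_end[OF lp] .
  have finE: "finite (endpoints H (Y z))" if "z \<in> R" for z
    using fin_end Y[OF that] by simp
  have finB: "finite ?B" using finite_all_edges[OF fin] by auto
  have pairs: "card {(z, w). {z, w} \<in> ?B} \<le> 2 * card ?B \<and> finite {(z, w). {z, w} \<in> ?B}"
    by (rule card_ordered_pairs_le[OF finB, of V]) blast
  have "(SIGMA z:R. endpoints H (Y z)) \<subseteq> {(z, w). {z, w} \<in> ?B}" using bo by auto
  then have "card (SIGMA z:R. endpoints H (Y z)) \<le> card {(z, w). {z, w} \<in> ?B}"
    using pairs by (intro card_mono) simp_all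
  also have "\<dots> \<le> 2 * card ?B" using pairs by simp
  finally have "(\<Sum>z\<in>R. card (endpoints H (Y z))) \<le> 2 * card ?B"
    using finR finE by simp
  then have "real (\<Sum>z\<in>R. card (endpoints H (Y z))) \<le> 2 * real (card ?B)"
    by (metis of_nat_le_iff of_nat_mult of_nat_numeral)
  moreover have "real (card V) / 4 \<le> real (card (endpoints H (Y z)))" if "z \<in> R" for z
    using card_endpoints[OF _ ex fin, of "Y z"] Y[OF that] by simp
  then have "(\<Sum>z\<in>R. real (card V) / 4) \<le> (\<Sum>z\<in>R. real (card (endpoints H (Y z))))"
    by (rule sum_mono)
  ultimately have "real (card R) * (real (card V) / 4) \<le> 2 * real (card ?B)"
    by simp
  moreover have "real (card V) / 4 \<le> real (card R)"
    using card_endpoints[OF lp ex fin] unfolding R_def by (simp add: field_simps)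
  then have "real (card V) / 4 * (real (card V) / 4) \<le> real (card R) * (real (card V) / 4)"
    by (intro mult_right_mono) auto
  ultimately show ?thesis by (simp add: power2_eq_square)
qed

section \<open>Random subsets\<close>

definition random_subset :: "'a set \<Rightarrow> real \<Rightarrow> 'a set pmf" where
  "random_subset X q = map_pmf (\<lambda>b. {e \<in> X. b e}) (Pi_pmf X False (\<lambda>_. bernoulli_pmf q))"

lemma gnp_eq_random_subset: "gnp V p = random_subset (all_edges V) p"
  unfolding gnp_def random_subset_def ..

lemma set_random_subset: "set_pmf (random_subset X q) \<subseteq> Pow X"
  unfolding random_subset_def by auto

lemma measure_bind_pmf_eq_expectation:
  "measure_pmf.prob (bind_pmf M f) A = measure_pmf.expectation M (\<lambda>x. measure_pmf.prob (f x) A)"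
proof -
  have "ennreal (measure_pmf.prob (bind_pmf M f) A) = emeasure (measure_pmf (bind_pmf M f)) A"
    by (simp add: measure_pmf.emeasure_eq_measure)
  also have "\<dots> = (\<integral>\<^sup>+x. emeasure (measure_pmf (f x)) A \<partial>measure_pmf M)"
    by (rule emeasure_bind_pmf)
  also have "\<dots> = (\<integral>\<^sup>+x. ennreal (measure_pmf.prob (f x) A) \<partial>measure_pmf M)"
    by (simp add: measure_pmf.emeasure_eq_measure)
  also have "\<dots> = ennreal (measure_pmf.expectation M (\<lambda>x. measure_pmf.prob (f x) A))"
    by (intro nn_integral_eq_integral measure_pmf.integrable_const_bound[where B=1]) auto
  finally show ?thesis by (simp add: integral_nonneg_AE)
qed

lemma prod_if_one:
  "finite X \<Longrightarrow> (\<Prod>e\<in>X. if P e then a else 1) = (a :: real) ^ card {e \<in> X. P e}"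
  by (simp flip: prod.inter_filter)

text \<open>The probability generating function of a binomial count. It is evaluated at 2 for the
  degree tail, at \<open>1 - q\<close> for thinning and at \<open>1 - p\<close> for common
  neighbours.\<close>

lemma expectation_random_subset_power:
  assumes fin: "finite X" and q: "0 \<le> q" "q \<le> 1" and a: "0 \<le> a"
  shows "measure_pmf.expectation (random_subset X q) (\<lambda>Y. a ^ card (Y \<inter> F)) =
    (1 - q + q * a) ^ card (X \<inter> F)"
proof -
  have *: "a ^ card ({e \<in> X. b e} \<inter> F) = (\<Prod>e\<in>X. if e \<in> F \<and> b e then a else 1)" for b
  proof -
    have "{e \<in> X. e \<in> F \<and> b e} = {e \<in> X. b e} \<inter> F" by auto
    then show ?thesis using prod_if_one[OF fin, of "\<lambda>e. e \<in> F \<and> b e" a] by simp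
  qed
  have "measure_pmf.expectation (random_subset X q) (\<lambda>Y. a ^ card (Y \<inter> F)) =
    measure_pmf.expectation (Pi_pmf X False (\<lambda>_. bernoulli_pmf q))
      (\<lambda>b. \<Prod>e\<in>X. if e \<in> F \<and> b e then a else 1)"
    unfolding random_subset_def by (simp add: *)
  also have "\<dots> = (\<Prod>e\<in>X. measure_pmf.expectation (bernoulli_pmf q)
      (\<lambda>y. if e \<in> F \<and> y then a else 1))"
    using a by (intro expectation_prod_Pi_pmf[OF fin] integrable_measure_pmf_finite) auto
  also have "\<dots> = (\<Prod>e\<in>X. if e \<in> F then 1 - q + q * a else 1)"
    using q by (intro prod.cong) (auto simp: algebra_simps)
  also have "\<dots> = (1 - q + q * a) ^ card {e \<in> X. e \<in> F}"
    by (rule prod_if_one[OF fin])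
  also have "{e \<in> X. e \<in> F} = X \<inter> F" by auto
  finally show ?thesis by simp
qed

lemma prob_random_subset_subset:
  assumes fin: "finite X" and q: "0 \<le> q" "q \<le> 1"
  shows "measure_pmf.prob (random_subset X q) {Y. Y \<subseteq> S} = (1 - q) ^ card (X - S)"
proof -
  have "measure_pmf.prob (random_subset X q) {Y. Y \<subseteq> S} =
    measure_pmf.prob (Pi_pmf X False (\<lambda>_. bernoulli_pmf q)) (Pi X (\<lambda>e. {y. y \<longrightarrow> e \<in> S}))"
    unfolding random_subset_def measure_map_pmf by (rule arg_cong2[of _ _ _ _ "measure_pmf.prob"]) auto
  also have "\<dots> = (\<Prod>e\<in>X. measure_pmf.prob (bernoulli_pmf q) {y. y \<longrightarrow> e \<in> S})"
    by (rule measure_Pi_pmf_Pi[OF fin])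
  also have "\<dots> = (\<Prod>e\<in>X. if e \<notin> S then 1 - q else 1)"
  proof (intro prod.cong refl)
    fix e
    have "{y. y \<longrightarrow> e \<in> S} = (if e \<in> S then UNIV else {False})" by auto
    then show "measure_pmf.prob (bernoulli_pmf q) {y. y \<longrightarrow> e \<in> S} = (if e \<notin> S then 1 - q else 1)"
      using q by (simp add: measure_pmf_single)
  qed
  also have "\<dots> = (1 - q) ^ card {e \<in> X. e \<notin> S}"
    by (rule prod_if_one[OF fin])
  also have "{e \<in> X. e \<notin> S} = X - S" by auto
  finally show ?thesis by simp
qed

lemma prob_random_subset_disjoint:
  assumes "finite X" "0 \<le> q" "q \<le> 1" "B \<subseteq> X"
  shows "measure_pmf.prob (random_subset X q) {Y. Y \<inter> B = {}} = (1 - q) ^ card B"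
proof -
  have "{Y. Y \<inter> B = {}} = {Y. Y \<subseteq> - B}" by auto
  moreover have "X - - B = B" using assms(4) by auto
  ultimately show ?thesis using prob_random_subset_subset[OF assms(1-3), of "- B"] by simp
qed

text \<open>Moebius inversion on the subset lattice: the down-set probabilities determine the point
  masses by induction over strict subsets. Every identity between laws of random sets below is
  checked on down-sets only, where independence turns into a product.\<close>

lemma pmf_eqI_subset_probs:
  fixes M N :: "'a set pmf"
  assumes fin: "finite X" and MX: "set_pmf M \<subseteq> Pow X" and NX: "set_pmf N \<subseteq> Pow X"
    and eq: "\<And>S. S \<subseteq> X \<Longrightarrow> measure_pmf.prob M {Y. Y \<subseteq> S} = measure_pmf.prob N {Y. Y \<subseteq> S}"
  shows "M = N"
proof (rule pmf_eqI)
  have sum: "measure_pmf.prob P {Y. Y \<subseteq> S} = pmf P S + (\<Sum>T\<in>Pow S - {S}. pmf P T)"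
    if "finite S" for P and S :: "'a set"
  proof -
    have "measure_pmf.prob P {Y. Y \<subseteq> S} = (\<Sum>T\<in>Pow S. pmf P T)"
      using that by (simp add: Pow_def[symmetric] measure_measure_pmf_finite)
    then show ?thesis using that by (simp add: sum.remove[of "Pow S" S])
  qed
  fix S
  show "pmf M S = pmf N S"
  proof (cases "S \<subseteq> X")
    case True
    then have "finite S" using fin finite_subset by auto
    then show ?thesis using True
    proof (induction S rule: finite_psubset_induct)
      case (psubset S)
      have "(\<Sum>T\<in>Pow S - {S}. pmf M T) = (\<Sum>T\<in>Pow S - {S}. pmf N T)"
        using psubset by (intro sum.cong) auto
      then show ?case using sum[OF psubset.hyps, of M] sum[OF psubset.hyps, of N] eq[OF psubset.prems]
        by simp
    qed
  next
    case False
    then have "S \<notin> set_pmf M" "S \<notin> set_pmf N" using MX NX by auto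
    then show ?thesis by (simp add: set_pmf_iff)
  qed
qed

lemma random_subset_eqI:
  assumes "finite X" "0 \<le> q" "q \<le> 1" "set_pmf M \<subseteq> Pow X"
    and "\<And>S. S \<subseteq> X \<Longrightarrow> measure_pmf.prob M {Y. Y \<subseteq> S} = (1 - q) ^ card (X - S)"
  shows "M = random_subset X q"
  using assms set_random_subset[of X q]
  by (intro pmf_eqI_subset_probs[of X]) (auto simp: prob_random_subset_subset)

lemma union_pair_random_subset:
  assumes "finite A" "finite B" "0 \<le> p" "p \<le> 1" "0 \<le> q" "q \<le> 1"
  shows "measure_pmf.prob (map_pmf (\<lambda>(Y, Z). Y \<union> Z) (pair_pmf (random_subset A p) (random_subset B q)))
     {Y. Y \<subseteq> S} = (1 - p) ^ card (A - S) * (1 - q) ^ card (B - S)"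
proof -
  \<comment> \<open>Restricting to subsets of \<open>X\<close> makes the events finite, hence
    countable, as the product rule for pairs requires.\<close>
  have *: "measure_pmf.prob (random_subset X r) {Y. Y \<subseteq> X \<and> Y \<subseteq> S} =
      measure_pmf.prob (random_subset X r) {Y. Y \<subseteq> S}" for X r
    using set_random_subset[of X r] by (intro measure_prob_cong_0) (auto simp: set_pmf_iff)
  let ?P = "pair_pmf (random_subset A p) (random_subset B q)"
  have "measure_pmf.prob (map_pmf (\<lambda>(Y, Z). Y \<union> Z) ?P) {Y. Y \<subseteq> S} =
      measure_pmf.prob ?P ({Y. Y \<subseteq> A \<and> Y \<subseteq> S} \<times> {Y. Y \<subseteq> B \<and> Y \<subseteq> S})"
    unfolding measure_map_pmf using set_random_subset[of A p] set_random_subset[of B q]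
    by (intro measure_prob_cong_0) (auto simp: set_pmf_iff pmf_pair)
  also have "\<dots> = measure_pmf.prob (random_subset A p) {Y. Y \<subseteq> A \<and> Y \<subseteq> S} *
      measure_pmf.prob (random_subset B q) {Y. Y \<subseteq> B \<and> Y \<subseteq> S}"
    using assms by (intro measure_pmf_prob_product countable_finite) auto
  finally show ?thesis using assms by (simp add: * prob_random_subset_subset)
qed

lemma union_random_subset:
  assumes "finite X" "0 \<le> p" "p \<le> 1" "0 \<le> q" "q \<le> 1"
  shows "map_pmf (\<lambda>(Y, Z). Y \<union> Z) (pair_pmf (random_subset X p) (random_subset X q)) =
    random_subset X (1 - (1 - p) * (1 - q))"
proof (rule random_subset_eqI)
  have "(1 - p) * (1 - q) \<le> 1 * 1" using assms by (intro mult_mono) auto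
  then show "0 \<le> 1 - (1 - p) * (1 - q)" by simp
  show "1 - (1 - p) * (1 - q) \<le> 1" using assms by simp
qed (use assms set_random_subset in \<open>auto simp: union_pair_random_subset power_mult_distrib simp del: measure_map_pmf\<close>)

text \<open>Lets the elements of \<open>F\<close> be exposed before the others; this separates the
  two edges of a path through a common neighbour.\<close>

lemma split_random_subset:
  assumes "finite X" "F \<subseteq> X" "0 \<le> p" "p \<le> 1"
  shows "map_pmf (\<lambda>(Y, Z). Y \<union> Z) (pair_pmf (random_subset F p) (random_subset (X - F) p)) =
    random_subset X p"
proof (rule random_subset_eqI)
  fix S
  have "X - S = (F - S) \<union> (X - F - S)" using assms(2) by auto
  then have "card (X - S) = card (F - S) + card (X - F - S)"
    using assms(1,2) by (subst card_Un_disjoint[symmetric]) (auto intro: finite_subset)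
  then show "measure_pmf.prob (map_pmf (\<lambda>(Y, Z). Y \<union> Z)
      (pair_pmf (random_subset F p) (random_subset (X - F) p))) {Y. Y \<subseteq> S} = (1 - p) ^ card (X - S)"
    using assms finite_subset[OF assms(2,1)] by (simp add: union_pair_random_subset power_add del: measure_map_pmf)
  show "set_pmf (map_pmf (\<lambda>(Y, Z). Y \<union> Z)
      (pair_pmf (random_subset F p) (random_subset (X - F) p))) \<subseteq> Pow X"
    using set_random_subset[of F p] set_random_subset[of "X - F" p] assms(2) by fastforce
qed (use assms in auto)

text \<open>An element outside \<open>S\<close> does no harm if it is absent at first or removed by
  the thinning, with total probability \<open>1 - p + p * (1 - q) = 1 - p * q\<close>. The
  generating function multiplies these factors.\<close>

lemma thin_random_subset:
  assumes "finite X" "0 \<le> p" "p \<le> 1" "0 \<le> q" "q \<le> 1"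
  shows "bind_pmf (random_subset X p) (\<lambda>Y. random_subset Y q) = random_subset X (p * q)"
proof (rule random_subset_eqI)
  show "0 \<le> p * q" "p * q \<le> 1" using assms by (auto simp: mult_le_one)
  show "set_pmf (bind_pmf (random_subset X p) (\<lambda>Y. random_subset Y q)) \<subseteq> Pow X"
    using set_random_subset[of X p] set_random_subset by fastforce
  fix S
  have "measure_pmf.prob (bind_pmf (random_subset X p) (\<lambda>Y. random_subset Y q)) {Y. Y \<subseteq> S} =
    measure_pmf.expectation (random_subset X p) (\<lambda>Y. measure_pmf.prob (random_subset Y q) {Y. Y \<subseteq> S})"
    by (rule measure_bind_pmf_eq_expectation)
  also have "\<dots> = measure_pmf.expectation (random_subset X p) (\<lambda>Y. (1 - q) ^ card (Y \<inter> - S))"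
  proof (intro integral_cong_AE AE_pmfI)
    fix Y assume "Y \<in> set_pmf (random_subset X p)"
    then have "finite Y" using set_random_subset[of X p] assms(1) finite_subset by blast
    then show "measure_pmf.prob (random_subset Y q) {Y. Y \<subseteq> S} = (1 - q) ^ card (Y \<inter> - S)"
      using assms prob_random_subset_subset[of Y q S] by (simp add: Diff_eq)
  qed auto
  also have "\<dots> = (1 - p + p * (1 - q)) ^ card (X \<inter> - S)"
    using assms by (intro expectation_random_subset_power) auto
  finally show "measure_pmf.prob (bind_pmf (random_subset X p) (\<lambda>Y. random_subset Y q)) {Y. Y \<subseteq> S} =
      (1 - p * q) ^ card (X - S)"
    by (simp add: Diff_eq algebra_simps)
qed (use assms in auto)

text \<open>A Chernoff bound with base two: Markov's inequality for
  \<open>2 ^ card (Y \<inter> F)\<close>, whose mean is \<open>(1 + p) ^ card F\<close>.\<close>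

lemma prob_card_random_subset_ge:
  assumes "finite X" "0 \<le> p" "p \<le> 1" "F \<subseteq> X"
  shows "measure_pmf.prob (random_subset X p) {Y. d \<le> card (Y \<inter> F)} \<le> exp (p * card F) / 2 ^ d"
proof -
  let ?M = "random_subset X p"
  have fin: "finite (set_pmf ?M)"
    using set_random_subset[of X p] assms(1) finite_subset by blast
  have "measure_pmf.prob ?M {Y. d \<le> card (Y \<inter> F)} \<le>
      measure_pmf.prob ?M {Y \<in> space (measure_pmf ?M). 2 ^ d \<le> (2 :: real) ^ card (Y \<inter> F)}"
    by (intro measure_pmf.finite_measure_mono) auto
  also have "\<dots> \<le> measure_pmf.expectation ?M (\<lambda>Y. 2 ^ card (Y \<inter> F)) / 2 ^ d"
    by (intro integral_Markov_inequality_measure[where A="{}"] integrable_measure_pmf_finite fin) auto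
  also have "measure_pmf.expectation ?M (\<lambda>Y. 2 ^ card (Y \<inter> F)) = (1 + p) ^ card F"
    using assms expectation_random_subset_power[of X p 2 F] by (simp add: Int_absorb1 add.commute)
  also have "(1 + p) ^ card F \<le> exp p ^ card F"
    using assms by (intro power_mono exp_ge_add_one_self) auto
  also have "exp p ^ card F = exp (p * card F)" by (simp add: exp_of_nat_mult[symmetric] mult.commute)
  finally show ?thesis by (simp add: divide_right_mono)
qed

section \<open>Poissonisation of the samples\<close>

text \<open>The generating function of the Poisson law. At \<open>r = card S / card N\<close> it
  makes the bins independent, and at \<open>r = 8\<close> it bounds the upper tail.\<close>

lemma expectation_poisson_power:
  fixes r :: real
  assumes rate: "0 < rate" and r: "0 \<le> r"
  shows "measure_pmf.expectation (poisson_pmf rate) (\<lambda>m. r ^ m) = exp (rate * (r - 1))"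
    and "integrable (measure_pmf (poisson_pmf rate)) (\<lambda>m. r ^ m)"
proof -
  have eq: "pmf (poisson_pmf rate) m * r ^ m = exp (- rate) * ((rate * r) ^ m /\<^sub>R fact m)" for m
    using rate by (simp add: power_mult_distrib field_simps)
  have s: "(\<lambda>m. exp (- rate) * ((rate * r) ^ m /\<^sub>R fact m)) sums (exp (- rate) * exp (rate * r))"
    by (intro sums_mult exp_converges)
  have abs: "Infinite_Set_Sum.abs_summable_on (\<lambda>m. pmf (poisson_pmf rate) m * r ^ m) UNIV"
    unfolding abs_summable_on_nat_iff' using sums_summable[OF s] r by (simp only: eq[symmetric]) simp
  then show "integrable (measure_pmf (poisson_pmf rate)) (\<lambda>m. r ^ m)"
    unfolding measure_pmf_eq_density abs_summable_on_def
    by (subst integrable_density) auto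
  show "measure_pmf.expectation (poisson_pmf rate) (\<lambda>m. r ^ m) = exp (rate * (r - 1))"
    unfolding pmf_expectation_eq_infsetsum infsetsum_nat'[OF abs]
    unfolding eq sums_unique[OF s, symmetric] by (simp add: exp_add[symmetric] algebra_simps)
qed

lemma prob_poisson_ge:
  assumes "0 < rate"
  shows "measure_pmf.prob (poisson_pmf rate) {m. k \<le> m} \<le> exp (7 * rate) / 8 ^ k"
proof -
  let ?M = "poisson_pmf rate"
  have "measure_pmf.prob ?M {m. k \<le> m} \<le>
      measure_pmf.prob ?M {m \<in> space (measure_pmf ?M). 8 ^ k \<le> (8 :: real) ^ m}"
    by (intro measure_pmf.finite_measure_mono) auto
  also have "\<dots> \<le> measure_pmf.expectation ?M (\<lambda>m. 8 ^ m) / 8 ^ k"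
    using assms by (intro integral_Markov_inequality_measure[where A="{}"] expectation_poisson_power) auto
  finally show ?thesis using expectation_poisson_power(1)[OF assms, of 8] by (simp add: mult.commute)
qed

lemma prob_replicate_pmf_subset:
  assumes "finite S"
  shows "measure_pmf.prob (replicate_pmf m P) {xs. set xs \<subseteq> S} = measure_pmf.prob P S ^ m"
proof (induction m)
  case 0
  then show ?case by simp
next
  case (Suc m)
  have "replicate_pmf (Suc m) P = map_pmf (\<lambda>(x, xs). x # xs) (pair_pmf P (replicate_pmf m P))"
    by (simp add: pair_pmf_def map_bind_pmf)
  then have "measure_pmf.prob (replicate_pmf (Suc m) P) {xs. set xs \<subseteq> S} =
      measure_pmf.prob (pair_pmf P (replicate_pmf m P)) (S \<times> {xs. set xs \<subseteq> S})"
    by (simp del: replicate_pmf.simps) (rule arg_cong[where f="measure_pmf.prob _"], auto)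
  also have "\<dots> = measure_pmf.prob P S * measure_pmf.prob (replicate_pmf m P) {xs. set xs \<subseteq> S}"
    using assms countable_lists[of S]
    by (intro measure_pmf_prob_product) (auto simp: countable_finite lists_eq_set)
  finally show ?case using Suc by simp
qed

text \<open>Throwing a Poisson number of balls makes the bins independent.\<close>

lemma poissonised_samples:
  fixes \<theta> :: real
  assumes fin: "finite N" "N \<noteq> {}" and \<theta>: "0 < \<theta>"
  shows "bind_pmf (poisson_pmf (\<theta> * card N)) (\<lambda>m. map_pmf set (replicate_pmf m (pmf_of_set N))) =
    random_subset N (1 - exp (- \<theta>))"
proof (rule random_subset_eqI)
  have pos: "0 < \<theta> * card N" using fin \<theta> by (simp add: card_gt_0_iff)
  show "set_pmf (bind_pmf (poisson_pmf (\<theta> * card N))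
      (\<lambda>m. map_pmf set (replicate_pmf m (pmf_of_set N)))) \<subseteq> Pow N"
    using fin by (auto simp: set_replicate_pmf)
  fix S assume S: "S \<subseteq> N"
  have finS: "finite S" using S fin finite_subset by auto
  have vim: "set -` {Y. Y \<subseteq> S} = {xs. set xs \<subseteq> S}" by auto
  have "N \<inter> S = S" using S by auto
  then have unif: "measure_pmf.prob (pmf_of_set N) S = card S / card N"
    using fin by (simp add: measure_pmf_of_set)
  have c: "card (N - S) = card N - card S" "card S \<le> card N"
    using S fin finS by (auto simp: card_Diff_subset card_mono)
  have "measure_pmf.prob (bind_pmf (poisson_pmf (\<theta> * card N))
      (\<lambda>m. map_pmf set (replicate_pmf m (pmf_of_set N)))) {Y. Y \<subseteq> S} =
    measure_pmf.expectation (poisson_pmf (\<theta> * card N)) (\<lambda>m. (card S / card N) ^ m)"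
    unfolding measure_bind_pmf_eq_expectation measure_map_pmf vim
      prob_replicate_pmf_subset[OF finS] unif ..
  also have "\<dots> = exp (\<theta> * card N * (card S / card N - 1))"
    by (rule expectation_poisson_power[OF pos]) simp
  also have "\<theta> * card N * (card S / card N - 1) = real (card (N - S)) * (- \<theta>)"
    using c fin by (simp add: field_simps of_nat_diff)
  finally show "measure_pmf.prob (bind_pmf (poisson_pmf (\<theta> * card N))
      (\<lambda>m. map_pmf set (replicate_pmf m (pmf_of_set N)))) {Y. Y \<subseteq> S} =
      (1 - (1 - exp (- \<theta>))) ^ card (N - S)"
    by (simp only: exp_of_nat_mult) simp
qed (use assms in auto)

lemma map_take_replicate_pmf:
  assumes "k \<le> n"
  shows "map_pmf (take k) (replicate_pmf n P) = replicate_pmf k P"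
proof -
  have "map_pmf (take k) (replicate_pmf (k + (n - k)) P) =
      replicate_pmf k P \<bind> (\<lambda>xs. replicate_pmf (n - k) P \<bind> (\<lambda>ys. return_pmf (take k (xs @ ys))))"
    unfolding replicate_pmf_distrib by (simp add: map_bind_pmf)
  also have "\<dots> = replicate_pmf k P \<bind> (\<lambda>xs. replicate_pmf (n - k) P \<bind> (\<lambda>ys. return_pmf xs))"
    by (intro bind_pmf_cong refl) (auto simp: set_replicate_pmf)
  finally show ?thesis using assms by (simp add: bind_return_pmf')
qed

text \<open>This is where base 8 and mean \<open>k / 8\<close> fit together: the numerator is at
  most \<open>exp k\<close>, and \<open>8 > (exp 1)^2\<close> makes the denominator at least
  \<open>exp (2 * k)\<close>.\<close>

lemma exp_tail_bound: "rate \<le> real k / 8 \<Longrightarrow> exp (7 * rate) / 8 ^ k \<le> exp (- real k)"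
proof -
  assume "rate \<le> real k / 8"
  then have "exp (7 * rate) \<le> exp (real k)" by simp
  moreover have "exp 2 \<le> (8 :: real)"
  proof -
    have "exp 2 = exp 1 * exp (1 :: real)" by (simp flip: exp_add)
    also have "\<dots> \<le> (272/100) * (272/100)" using e_less_272 by (intro mult_mono) auto
    finally show ?thesis by simp
  qed
  then have "exp 2 ^ k \<le> (8 :: real) ^ k" by (intro power_mono) auto
  then have "exp (real k * 2) \<le> 8 ^ k" by (simp add: exp_of_nat_mult)
  ultimately have "exp (7 * rate) * exp (real k) \<le> exp (real k) * exp (real k)"
    "exp (real k) * exp (real k) \<le> 8 ^ k"
    by (auto simp flip: exp_add simp: mult.commute)
  then have "exp (7 * rate) * exp (real k) \<le> 8 ^ k" by (rule order_trans)
  then show ?thesis by (simp add: exp_minus field_simps)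
qed

definition uniform_samples :: "nat \<Rightarrow> 'a set \<Rightarrow> 'a list pmf" where
  "uniform_samples k N = (if N = {} then return_pmf [] else replicate_pmf k (pmf_of_set N))"

lemma random_subset_empty: "random_subset {} q = return_pmf {}"
  unfolding random_subset_def by simp

text \<open>With \<open>m\<close> Poisson, draw \<open>max m k\<close> samples. The first
  \<open>k\<close> are the actual ones and the first \<open>m\<close> the Poissonised ones, so the
  inclusion can fail only if \<open>m\<close> exceeds \<open>k\<close>, which is unlikely as the
  mean of \<open>m\<close> is at most \<open>k / 8\<close>.\<close>

lemma samples_coupling:
  fixes N :: "'a set" and \<theta> :: real
  assumes fin: "finite N" and \<theta>: "0 < \<theta>" and le: "\<theta> * card N \<le> real k / 8"
  shows "\<exists>J. map_pmf fst J = uniform_samples k N \<and> map_pmf snd J = random_subset N (1 - exp (- \<theta>)) \<and>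
    measure_pmf.prob J {(r, B). \<not> B \<subseteq> set r} \<le> exp (- real k)"
proof (cases "N = {}")
  case True
  then show ?thesis
    by (intro exI[of _ "return_pmf ([], {})"]) (auto simp: uniform_samples_def random_subset_empty)
next
  case False
  have pos: "0 < \<theta> * card N" using fin \<theta> False by (simp add: card_gt_0_iff)
  let ?P = "poisson_pmf (\<theta> * card N)" and ?U = "pmf_of_set N"
  define D where "D = bind_pmf ?P (\<lambda>m. map_pmf (Pair m) (replicate_pmf (max m k) ?U))"
  define J where "J = map_pmf (\<lambda>(m, xs). (take k xs, set (take m xs))) D"
  have "map_pmf fst J = bind_pmf ?P (\<lambda>m. map_pmf (take k) (replicate_pmf (max m k) ?U))"
    unfolding J_def D_def by (simp add: map_bind_pmf pmf.map_comp o_def)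
  also have "\<dots> = uniform_samples k N"
    using False by (simp add: map_take_replicate_pmf uniform_samples_def)
  finally have 1: "map_pmf fst J = uniform_samples k N" .
  have "map_pmf snd J = bind_pmf ?P (\<lambda>m. map_pmf set (map_pmf (take m) (replicate_pmf (max m k) ?U)))"
    unfolding J_def D_def by (simp add: map_bind_pmf pmf.map_comp o_def)
  also have "\<dots> = random_subset N (1 - exp (- \<theta>))"
    using poissonised_samples[OF fin False \<theta>] by (simp add: map_take_replicate_pmf)
  finally have 2: "map_pmf snd J = random_subset N (1 - exp (- \<theta>))" .
  have "measure_pmf.prob J {(r, B). \<not> B \<subseteq> set r} \<le> measure_pmf.prob D {x. k \<le> fst x}"
    unfolding J_def measure_map_pmf
  proof (intro measure_pmf.finite_measure_mono subsetI)
    fix x :: "nat \<times> 'a list"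
    assume "x \<in> (\<lambda>(m, xs). (take k xs, set (take m xs))) -` {(r, B). \<not> B \<subseteq> set r}"
    then show "x \<in> {x. k \<le> fst x}"
      using set_take_subset_set_take[of "fst x" k "snd x"]
      by (cases "k \<le> fst x") (auto simp: case_prod_beta)
  qed simp
  also have "\<dots> = measure_pmf.prob (map_pmf fst D) {m. k \<le> m}"
    by (simp add: measure_map_pmf vimage_def)
  also have "map_pmf fst D = ?P"
    unfolding D_def by (simp add: map_bind_pmf pmf.map_comp o_def bind_return_pmf')
  also have "measure_pmf.prob ?P {m. k \<le> m} \<le> exp (7 * (\<theta> * card N)) / 8 ^ k"
    by (rule prob_poisson_ge[OF pos])
  also have "\<dots> \<le> exp (- real k)" by (rule exp_tail_bound[OF le])
  finally show ?thesis using 1 2 by blast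
qed

text \<open>The couplings of the single nodes are run independently. Outside \<open>card V\<close>
  bad events the thinned sets lie inside the sampled ones at every node, so a property that passes
  to larger samples carries over.\<close>

lemma samples_dominate:
  fixes N :: "'a \<Rightarrow> 'b set" and \<theta> :: real
  assumes V: "finite V" and fin: "\<And>u. u \<in> V \<Longrightarrow> finite (N u)" and \<theta>: "0 < \<theta>"
    and le: "\<And>u. u \<in> V \<Longrightarrow> \<theta> * card (N u) \<le> real k / 8"
    and mono: "\<And>r B. \<lbrakk>\<And>u. u \<in> V \<Longrightarrow> B u \<subseteq> set (r u); B \<in> Y\<rbrakk> \<Longrightarrow> r \<in> X"
  shows "measure_pmf.prob (Pi_pmf V undefined (\<lambda>u. uniform_samples k (N u))) (- X) \<le>
    measure_pmf.prob (Pi_pmf V {} (\<lambda>u. random_subset (N u) (1 - exp (- \<theta>)))) (- Y) +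
    card V * exp (- real k)"
proof -
  have "\<forall>u\<in>V. \<exists>J. map_pmf fst J = uniform_samples k (N u) \<and>
      map_pmf snd J = random_subset (N u) (1 - exp (- \<theta>)) \<and>
      measure_pmf.prob J {(r, B). \<not> B \<subseteq> set r} \<le> exp (- real k)"
    using samples_coupling[OF fin \<theta> le] by blast
  then obtain J where J: "\<And>u. u \<in> V \<Longrightarrow> map_pmf fst (J u) = uniform_samples k (N u)"
      "\<And>u. u \<in> V \<Longrightarrow> map_pmf snd (J u) = random_subset (N u) (1 - exp (- \<theta>))"
      "\<And>u. u \<in> V \<Longrightarrow> measure_pmf.prob (J u) {(r, B). \<not> B \<subseteq> set r} \<le> exp (- real k)"
    by metis
  define P where "P = Pi_pmf V (undefined, {}) J"
  have 1: "Pi_pmf V undefined (\<lambda>u. uniform_samples k (N u)) = map_pmf ((\<circ>) fst) P"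
    unfolding P_def by (subst Pi_pmf_map[symmetric]) (auto intro: Pi_pmf_cong simp: J V)
  have 2: "Pi_pmf V {} (\<lambda>u. random_subset (N u) (1 - exp (- \<theta>))) = map_pmf ((\<circ>) snd) P"
    unfolding P_def by (subst Pi_pmf_map[symmetric]) (auto intro: Pi_pmf_cong simp: J V)
  let ?bad = "\<lambda>u. {f. \<not> snd (f u) \<subseteq> set (fst (f u))}"
  have "measure_pmf.prob (map_pmf ((\<circ>) fst) P) (- X) \<le>
      measure_pmf.prob P (((\<circ>) snd -` (- Y)) \<union> (\<Union>u\<in>V. ?bad u))"
    unfolding measure_map_pmf
  proof (intro measure_pmf.finite_measure_mono subsetI)
    fix f :: "'a \<Rightarrow> 'b list \<times> 'b set" assume "f \<in> (\<circ>) fst -` (- X)"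
    then have "fst \<circ> f \<notin> X" by simp
    then show "f \<in> ((\<circ>) snd -` (- Y)) \<union> (\<Union>u\<in>V. ?bad u)"
      using mono[of "snd \<circ> f" "fst \<circ> f"] by auto
  qed simp
  also have "\<dots> \<le> measure_pmf.prob P ((\<circ>) snd -` (- Y)) + measure_pmf.prob P (\<Union>u\<in>V. ?bad u)"
    by (rule measure_Un_le) auto
  also have "measure_pmf.prob P (\<Union>u\<in>V. ?bad u) \<le> (\<Sum>u\<in>V. measure_pmf.prob P (?bad u))"
    using V by (intro measure_UNION_le) auto
  also have "\<dots> \<le> (\<Sum>u\<in>V. exp (- real k))"
  proof (rule sum_mono)
    fix u assume u: "u \<in> V"
    have "measure_pmf.prob P (?bad u) = measure_pmf.prob (map_pmf (\<lambda>f. f u) P) {(r, B). \<not> B \<subseteq> set r}"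
      unfolding measure_map_pmf by (simp add: vimage_def case_prod_beta)
    also have "map_pmf (\<lambda>f. f u) P = J u" unfolding P_def using V u by (simp add: Pi_pmf_component)
    finally show "measure_pmf.prob P (?bad u) \<le> exp (- real k)" using J(3)[OF u] by simp
  qed
  finally show ?thesis unfolding 1 2 measure_map_pmf by (simp add: vimage_def o_def)
qed

section \<open>Hamiltonian cycles in the random graph\<close>

lemma all_edgesE:
  assumes "e \<in> all_edges V"
  obtains x u where "e = {u, x}" "x < u" "x \<in> V" "u \<in> V"
proof -
  obtain a b where ab: "e = {a, b}" "a \<noteq> b" "a \<in> V" "b \<in> V"
    using assms unfolding all_edges_def by (auto simp: card_2_iff)
  then show ?thesis using that[of b a] that[of a b] by (cases "a < b") (auto simp: insert_commute)
qed

lemma pair_in_all_edges: "{u, x} \<in> all_edges V \<longleftrightarrow> u \<in> V \<and> x \<in> V \<and> u \<noteq> x"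
  unfolding all_edges_def by (auto simp: card_insert_if)

lemma finite_neighbours:
  assumes "E \<subseteq> all_edges V" "finite V"
  shows "finite (neighbours E u)" and "neighbours E u \<subseteq> V - {u}"
proof -
  show "neighbours E u \<subseteq> V - {u}"
    using assms(1) pair_in_all_edges[of u _ V] unfolding neighbours_def by auto
  then show "finite (neighbours E u)" using assms(2) finite_subset by blast
qed

text \<open>Each edge is decided by a single entry, its smaller endpoint in the set of its larger
  one. Distinct edges are thus decided by independent choices, although both endpoints draw from
  their incident edges.\<close>

lemma owned_edges_random_subset:
  assumes V: "finite V" and E: "E \<subseteq> all_edges V" and q: "0 \<le> q" "q \<le> 1"
  shows "map_pmf (\<lambda>B. {e \<in> E. Min e \<in> B (Max e)})
      (Pi_pmf V {} (\<lambda>u. random_subset (neighbours E u) q)) = random_subset E q"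
proof (rule random_subset_eqI)
  show finE: "finite E" using finite_subset[OF E finite_all_edges[OF V]] .
  fix S assume S: "S \<subseteq> E"
  \<comment> \<open>The edges missing from \<open>S\<close>, listed at their owner \<open>u\<close>.
    The result lies inside \<open>S\<close> iff every \<open>B u\<close> avoids \<open>F u\<close>,
    and these events are independent.\<close>
  define F where "F u = {x. x < u \<and> {u, x} \<in> E - S}" for u
  have Fsub: "F u \<subseteq> neighbours E u" for u unfolding F_def neighbours_def by auto
  have finF: "finite (F u)" for u using finite_subset[OF Fsub finite_neighbours(1)[OF E V]] .
  have ev: "(\<lambda>B. {e \<in> E. Min e \<in> B (Max e)}) -` {Y. Y \<subseteq> S} = Pi V (\<lambda>u. {Y. Y \<subseteq> - F u})"
  proof (intro set_eqI iffI)
    fix B assume B: "B \<in> (\<lambda>B. {e \<in> E. Min e \<in> B (Max e)}) -` {Y. Y \<subseteq> S}"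
    show "B \<in> Pi V (\<lambda>u. {Y. Y \<subseteq> - F u})"
    proof (rule Pi_I, clarify)
      fix u x assume x: "x \<in> B u" "x \<in> F u"
      then have "{u, x} \<in> E" "x < u" "{u, x} \<notin> S" unfolding F_def by auto
      moreover have "Min {u, x} = x" "Max {u, x} = u" using \<open>x < u\<close> by auto
      ultimately show False using B x(1) by auto
    qed
  next
    fix B assume B: "B \<in> Pi V (\<lambda>u. {Y. Y \<subseteq> - F u})"
    have "e \<in> S" if e: "e \<in> E" "Min e \<in> B (Max e)" for e
    proof -
      obtain u x where ux: "e = {u, x}" "x < u" "x \<in> V" "u \<in> V" using all_edgesE e(1) E by blast
      then have "Min e = x" "Max e = u" by auto
      then have "x \<notin> F u" using B e(2) ux(4) by (auto simp: Pi_def)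
      then show "e \<in> S" using e(1) ux unfolding F_def by auto
    qed
    then show "B \<in> (\<lambda>B. {e \<in> E. Min e \<in> B (Max e)}) -` {Y. Y \<subseteq> S}" by auto
  qed
  have bij: "bij_betw (\<lambda>(u, x). {u, x}) (SIGMA u:V. F u) (E - S)"
  proof (rule bij_betwI')
    fix a b assume "a \<in> (SIGMA u:V. F u)" "b \<in> (SIGMA u:V. F u)"
    then show "((case a of (u, x) \<Rightarrow> {u, x}) = (case b of (u, x) \<Rightarrow> {u, x})) = (a = b)"
      unfolding F_def by (auto simp: doubleton_eq_iff)
  next
    fix a assume "a \<in> (SIGMA u:V. F u)"
    then show "(case a of (u, x) \<Rightarrow> {u, x}) \<in> E - S" unfolding F_def by auto
  next
    fix e assume e: "e \<in> E - S"
    then obtain u x where "e = {u, x}" "x < u" "x \<in> V" "u \<in> V" using all_edgesE E by blast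
    then show "\<exists>a\<in>(SIGMA u:V. F u). e = (case a of (u, x) \<Rightarrow> {u, x})"
      using e unfolding F_def by (intro bexI[of _ "(u, x)"]) auto
  qed
  have "measure_pmf.prob (map_pmf (\<lambda>B. {e \<in> E. Min e \<in> B (Max e)})
      (Pi_pmf V {} (\<lambda>u. random_subset (neighbours E u) q))) {Y. Y \<subseteq> S} =
      (\<Prod>u\<in>V. measure_pmf.prob (random_subset (neighbours E u) q) {Y. Y \<subseteq> - F u})"
    unfolding measure_map_pmf ev by (rule measure_Pi_pmf_Pi[OF V])
  also have "\<dots> = (\<Prod>u\<in>V. (1 - q) ^ card (F u))"
  proof (intro prod.cong refl)
    fix u
    have "neighbours E u - - F u = F u" using Fsub[of u] by auto
    then show "measure_pmf.prob (random_subset (neighbours E u) q) {Y. Y \<subseteq> - F u} = (1 - q) ^ card (F u)"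
      using prob_random_subset_subset[OF finite_neighbours(1)[OF E V] q, of u "- F u"] by simp
  qed
  also have "\<dots> = (1 - q) ^ (\<Sum>u\<in>V. card (F u))" by (simp add: power_sum)
  also have "(\<Sum>u\<in>V. card (F u)) = card (E - S)"
    using bij_betw_same_card[OF bij] V finF by simp
  finally show "measure_pmf.prob (map_pmf (\<lambda>B. {e \<in> E. Min e \<in> B (Max e)})
      (Pi_pmf V {} (\<lambda>u. random_subset (neighbours E u) q))) {Y. Y \<subseteq> S} = (1 - q) ^ card (E - S)" .
qed (use q in auto)

section \<open>Exposing a random graph in two stages\<close>

lemma prob_bind_pmf_le:
  assumes "\<And>x. x \<in> set_pmf M \<Longrightarrow> x \<notin> A \<Longrightarrow> measure_pmf.prob (f x) C \<le> \<delta>" "0 \<le> \<delta>"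
  shows "measure_pmf.prob (bind_pmf M f) C \<le> measure_pmf.prob M A + \<delta>"
proof -
  have "measure_pmf.prob (bind_pmf M f) C = measure_pmf.expectation M (\<lambda>x. measure_pmf.prob (f x) C)"
    by (rule measure_bind_pmf_eq_expectation)
  also have "\<dots> \<le> measure_pmf.expectation M (\<lambda>x. indicator A x + \<delta>)"
  proof (rule integral_mono_AE)
    show "integrable (measure_pmf M) (\<lambda>x. measure_pmf.prob (f x) C)"
      by (rule measure_pmf.integrable_const_bound[where B=1]) auto
    show "integrable (measure_pmf M) (\<lambda>x. indicator A x + \<delta>)"
      by (rule measure_pmf.integrable_const_bound[where B="1 + \<delta>"])
        (use assms(2) in \<open>auto simp: indicator_def\<close>)
    show "AE x in measure_pmf M. measure_pmf.prob (f x) C \<le> indicator A x + \<delta>"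
    proof (rule AE_pmfI)
      fix x assume "x \<in> set_pmf M"
      then show "measure_pmf.prob (f x) C \<le> indicator A x + \<delta>"
        using assms measure_pmf.prob_le_1[of "f x" C]
        by (cases "x \<in> A") (auto intro: order_trans)
    qed
  qed
  also have "\<dots> = measure_pmf.prob M A + \<delta>"
    by (subst Bochner_Integration.integral_add)
      (auto intro: measure_pmf.integrable_const_bound[where B=1])
  finally show ?thesis .
qed

text \<open>The sprinkling step: either the first exposure already fails, or a fresh independent
  exposure fails to improve a fixed first one.\<close>

lemma prob_union_gnp_le:
  assumes V: "finite V" and p: "0 \<le> p" "p \<le> 1" and q: "0 \<le> q" "q \<le> 1" and "0 \<le> \<delta>"
    and step: "\<And>H. H \<subseteq> all_edges V \<Longrightarrow> H \<notin> A \<Longrightarrow> measure_pmf.prob (gnp V q) {Y. H \<union> Y \<in> C} \<le> \<delta>"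
  shows "measure_pmf.prob (gnp V (1 - (1 - p) * (1 - q))) C \<le> measure_pmf.prob (gnp V p) A + \<delta>"
proof -
  have "gnp V (1 - (1 - p) * (1 - q)) = map_pmf (\<lambda>(Y, Z). Y \<union> Z) (pair_pmf (gnp V p) (gnp V q))"
    unfolding gnp_eq_random_subset
    using union_random_subset[OF finite_all_edges[OF V] p q] by simp
  also have "\<dots> = bind_pmf (gnp V p) (\<lambda>H. map_pmf ((\<union>) H) (gnp V q))"
    by (simp add: pair_pmf_def map_pmf_def bind_assoc_pmf bind_return_pmf)
  finally have eq: "gnp V (1 - (1 - p) * (1 - q)) =
      bind_pmf (gnp V p) (\<lambda>H. map_pmf ((\<union>) H) (gnp V q))" .
  show ?thesis unfolding eq
  proof (rule prob_bind_pmf_le)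
    fix H assume H: "H \<in> set_pmf (gnp V p)" "H \<notin> A"
    then have "H \<subseteq> all_edges V"
      using set_random_subset[of "all_edges V" p] unfolding gnp_eq_random_subset by auto
    then show "measure_pmf.prob (map_pmf ((\<union>) H) (gnp V q)) C \<le> \<delta>"
      using step H(2) by (simp add: vimage_def)
  qed fact
qed

lemma prob_gnp_antimono:
  assumes V: "finite V" and p: "0 \<le> p" "p \<le> p'" "p' \<le> 1"
    and C: "\<And>H Y. H \<subseteq> all_edges V \<Longrightarrow> H \<union> Y \<in> C \<Longrightarrow> H \<in> C"
  shows "measure_pmf.prob (gnp V p') C \<le> measure_pmf.prob (gnp V p) C"
proof (cases "p = 1")
  case False
  \<comment> \<open>The density solving \<open>(1 - p) * (1 - q) = 1 - p'\<close>, so that the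
    larger graph arises from the smaller by adding edges. For \<open>p = 1\<close> also
    \<open>p' = 1\<close>.\<close>
  define q where "q = (p' - p) / (1 - p)"
  have q: "0 \<le> q" "q \<le> 1" unfolding q_def using p False by (auto simp: field_simps)
  have eq: "1 - (1 - p) * (1 - q) = p'" unfolding q_def using p False by (simp add: field_simps)
  have "measure_pmf.prob (gnp V (1 - (1 - p) * (1 - q))) C \<le> measure_pmf.prob (gnp V p) C + 0"
  proof (rule prob_union_gnp_le[OF V])
    fix H assume "H \<subseteq> all_edges V" "H \<notin> C"
    then have "{Y. H \<union> Y \<in> C} = {}" using C by blast
    then show "measure_pmf.prob (gnp V q) {Y. H \<union> Y \<in> C} \<le> 0" by simp
  qed (use p q in auto)
  then show ?thesis unfolding eq by simp
qed (use p in auto)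

lemma one_minus_power_le_exp:
  assumes "0 \<le> p" "p \<le> 1"
  shows "(1 - p) ^ m \<le> exp (- (p * real m))"
proof -
  have "(1 - p) ^ m \<le> exp (- p) ^ m"
    using assms exp_ge_add_one_self[of "- p"] by (intro power_mono) auto
  also have "\<dots> = exp (- (p * real m))" by (simp add: exp_of_nat_mult[symmetric] mult.commute)
  finally show ?thesis .
qed

lemma card_subsets_le:
  assumes "finite V"
  shows "card {S. S \<subseteq> V \<and> card S = s} \<le> card V ^ s"
proof (cases "s \<le> card V")
  case True
  then show ?thesis using n_subsets[OF assms, of s] binomial_le_pow[OF True] by simp
next
  case False
  then have "{S. S \<subseteq> V \<and> card S = s} = {}" using card_mono[OF assms] by auto
  then show ?thesis by (simp only: card.empty)
qed

section \<open>Expansion of a sparse random graph\<close>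

definition cut_edges :: "nat set \<Rightarrow> nat set \<Rightarrow> nat set set" where
  "cut_edges A B = (\<lambda>(x, y). {x, y}) ` (A \<times> B)"

lemma card_cut_edges:
  assumes "A \<inter> B = {}"
  shows "card (cut_edges A B) = card A * card B"
proof -
  have "inj_on (\<lambda>(x, y). {x, y}) (A \<times> B)"
    using assms by (auto simp: inj_on_def doubleton_eq_iff)
  then show ?thesis unfolding cut_edges_def by (simp add: card_image card_cartesian_product)
qed

text \<open>The few outer neighbours of a bad set are padded to exactly twice its size. The union
  bound then runs over pairs of sets of prescribed sizes with no edges from \<open>S\<close> to the
  remaining vertices.\<close>

lemma not_expander_cut:
  assumes V: "finite V" and H: "H \<subseteq> all_edges V" and ne: "\<not> expander V H"
  shows "\<exists>S T. S \<subseteq> V \<and> S \<noteq> {} \<and> 4 * card S \<le> card V \<and> T \<subseteq> V - S \<and> card T = 2 * card S \<and>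
    H \<inter> cut_edges S (V - S - T) = {}"
proof -
  obtain S where S: "S \<subseteq> V" "S \<noteq> {}" "4 * card S \<le> card V" "card (outer_nbrs H S) \<le> 2 * card S"
    using ne H unfolding expander_def by (auto simp: not_less)
  have sub: "outer_nbrs H S \<subseteq> V - S"
    using finite_neighbours(2)[OF H V] unfolding outer_nbrs_def by blast
  have finS: "finite S" using S(1) V finite_subset by auto
  have "2 * card S \<le> card (V - S)" using S finS V by (simp add: card_Diff_subset)
  then obtain T where T: "outer_nbrs H S \<subseteq> T" "T \<subseteq> V - S" "card T = 2 * card S"
    using exists_subset_between[OF S(4) _ sub] V by auto
  have "H \<inter> cut_edges S (V - S - T) = {}"
  proof (rule ccontr)
    assume "H \<inter> cut_edges S (V - S - T) \<noteq> {}"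
    then obtain x y where "{x, y} \<in> H" "x \<in> S" "y \<in> V" "y \<notin> S" "y \<notin> T"
      unfolding cut_edges_def by auto
    then show False using T(1) unfolding outer_nbrs_def neighbours_def by auto
  qed
  then show ?thesis using S T by blast
qed

text \<open>For \<open>card S = s\<close> there are at most \<open>n ^ (3 * s)\<close> pairs, and
  each leaves a cut of \<open>s * (n - 3 * s)\<close> possible edges, at least
  \<open>s * n / 4\<close>. Density \<open>24 * ln n / n\<close> empties such a cut with probability
  at most \<open>1 / n ^ (6 * s)\<close>. This leaves at most \<open>1 / n ^ 3\<close> for each of
  at most \<open>n\<close> sizes.\<close>

lemma prob_not_expander:
  assumes V: "finite V" and n: "n = card V" "12 \<le> n" and p: "p = 24 * ln (real n) / real n" "p \<le> 1"
  shows "measure_pmf.prob (gnp V p) {H. \<not> expander V H} \<le> 1 / real n ^ 2"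
proof -
  let ?M = "gnp V p"
  have p0: "0 \<le> p" using p n by simp
  define R where "R s = {(S, T). S \<subseteq> V \<and> card S = s \<and> T \<subseteq> V - S \<and> card T = 2 * s}" for s
  define I where "I = {s. 1 \<le> s \<and> 4 * s \<le> n}"
  have finI: "finite I" unfolding I_def by (rule finite_subset[of _ "{..n}"]) auto
  have cardI: "card I \<le> n"
  proof -
    have "I \<subseteq> {1..n}" unfolding I_def by auto
    then show ?thesis using card_mono[of "{1..n}" I] by simp
  qed
  have Rsub: "R s \<subseteq> {S. S \<subseteq> V \<and> card S = s} \<times> {T. T \<subseteq> V \<and> card T = 2 * s}" for s
    unfolding R_def by auto
  have fins: "finite ({S. S \<subseteq> V \<and> card S = s} \<times> {T. T \<subseteq> V \<and> card T = 2 * s})" for s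
    using V by auto
  have finR: "finite (R s)" for s using finite_subset[OF Rsub fins] .
  have cardR: "card (R s) \<le> n ^ (3 * s)" for s
  proof -
    have "card (R s) \<le> card {S. S \<subseteq> V \<and> card S = s} * card {T. T \<subseteq> V \<and> card T = 2 * s}"
      using card_mono[OF fins Rsub] by (simp add: card_cartesian_product)
    also have "\<dots> \<le> n ^ s * n ^ (2 * s)"
      unfolding n by (intro mult_le_mono card_subsets_le[OF V])
    finally show ?thesis by (simp flip: power_add)
  qed
  have one: "measure_pmf.prob ?M {H. H \<inter> cut_edges S (V - S - T) = {}} \<le> 1 / real n ^ (6 * s)"
    if s: "s \<in> I" and ST: "(S, T) \<in> R s" for s S T
  proof -
    have ST': "S \<subseteq> V" "T \<subseteq> V" "S \<inter> T = {}" "card S = s" "card T = 2 * s"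
      using ST unfolding R_def by auto
    have fST: "finite S" "finite T" using ST' V finite_subset by auto
    have "card (V - S - T) = n - 3 * s"
    proof -
      have "card (V - (S \<union> T)) = n - card (S \<union> T)"
        unfolding n(1) by (rule card_Diff_subset) (use ST' fST in auto)
      moreover have "card (S \<union> T) = 3 * s" using ST' fST by (simp add: card_Un_disjoint)
      moreover have "V - S - T = V - (S \<union> T)" by auto
      ultimately show ?thesis by simp
    qed
    then have cc: "card (cut_edges S (V - S - T)) = s * (n - 3 * s)"
      using card_cut_edges[of S "V - S - T"] ST' by auto
    have sub: "cut_edges S (V - S - T) \<subseteq> all_edges V"
      using ST' unfolding cut_edges_def by (auto simp: pair_in_all_edges)
    have "real n / 4 \<le> real (n - 3 * s)" using s unfolding I_def by (auto simp: of_nat_diff)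
    then have "p * (real s * (real n / 4)) \<le> p * (real s * real (n - 3 * s))"
      using p0 by (intro mult_left_mono) auto
    moreover have "p * (real s * (real n / 4)) = real (6 * s) * ln (real n)"
      using p(1) n by (simp add: field_simps)
    ultimately have "real (6 * s) * ln (real n) \<le> p * (real s * real (n - 3 * s))" by argo
    then have le: "- (p * real (s * (n - 3 * s))) \<le> - (real (6 * s) * ln (real n))"
      by (simp only: of_nat_mult neg_le_iff_le)
    have "measure_pmf.prob ?M {H. H \<inter> cut_edges S (V - S - T) = {}} = (1 - p) ^ (s * (n - 3 * s))"
      unfolding gnp_eq_random_subset
      using prob_random_subset_disjoint[OF finite_all_edges[OF V] p0 p(2) sub] cc by simp
    also have "\<dots> \<le> exp (- (p * real (s * (n - 3 * s))))" by (rule one_minus_power_le_exp[OF p0 p(2)])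
    also have "\<dots> \<le> exp (- (real (6 * s) * ln (real n)))" using le by simp
    also have "\<dots> = 1 / real n ^ (6 * s)"
      using n by (simp add: exp_minus exp_of_nat_mult inverse_eq_divide del: of_nat_mult)
    finally show ?thesis .
  qed
  have "measure_pmf.prob ?M {H. \<not> expander V H} =
      measure_pmf.prob ?M {H. \<not> expander V H \<and> H \<subseteq> all_edges V}"
    using set_random_subset[of "all_edges V" p] unfolding gnp_eq_random_subset
    by (intro measure_prob_cong_0) (auto simp: set_pmf_iff)
  also have "\<dots> \<le> measure_pmf.prob ?M
      (\<Union>s\<in>I. \<Union>(S, T)\<in>R s. {H. H \<inter> cut_edges S (V - S - T) = {}})"
  proof (intro measure_pmf.finite_measure_mono subsetI)
    fix H assume "H \<in> {H. \<not> expander V H \<and> H \<subseteq> all_edges V}"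
    then have "H \<subseteq> all_edges V" "\<not> expander V H" by auto
    from not_expander_cut[OF V this] obtain S T
      where ST: "S \<subseteq> V" "S \<noteq> {}" "4 * card S \<le> card V" "T \<subseteq> V - S"
        "card T = 2 * card S" "H \<inter> cut_edges S (V - S - T) = {}"
      by (elim exE conjE)
    have "finite S" using ST(1) V by (rule finite_subset)
    then have "card S \<noteq> 0" using ST(2) by simp
    then have "card S \<in> I" "(S, T) \<in> R (card S)" using ST n unfolding I_def R_def by auto
    then show "H \<in> (\<Union>s\<in>I. \<Union>(S, T)\<in>R s. {H. H \<inter> cut_edges S (V - S - T) = {}})"
      using ST(6) by blast
  qed simp
  also have "\<dots> \<le> (\<Sum>s\<in>I. measure_pmf.prob ?M (\<Union>(S, T)\<in>R s. {H. H \<inter> cut_edges S (V - S - T) = {}}))"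
    by (rule measure_UNION_le[OF finI]) auto
  also have "\<dots> \<le> (\<Sum>s\<in>I. 1 / real n ^ 3)"
  proof (rule sum_mono)
    fix s assume s: "s \<in> I"
    have n1: "1 \<le> real n" using n by simp
    have "measure_pmf.prob ?M (\<Union>(S, T)\<in>R s. {H. H \<inter> cut_edges S (V - S - T) = {}}) \<le>
        (\<Sum>x\<in>R s. measure_pmf.prob ?M (case x of (S, T) \<Rightarrow> {H. H \<inter> cut_edges S (V - S - T) = {}}))"
      by (rule measure_UNION_le[OF finR]) auto
    also have "\<dots> \<le> (\<Sum>x\<in>R s. 1 / real n ^ (6 * s))"
      using one[OF s] by (intro sum_mono) auto
    also have "\<dots> = real (card (R s)) / real n ^ (6 * s)" by simp
    also have "\<dots> \<le> real n ^ (3 * s) / real n ^ (6 * s)"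
      using cardR[of s] by (intro divide_right_mono) (simp_all flip: of_nat_power)
    also have "\<dots> = 1 / real n ^ (3 * s)"
      using n by (simp add: field_simps flip: power_add)
    also have "\<dots> \<le> 1 / real n ^ 3"
      using s n1 unfolding I_def by (intro divide_left_mono power_increasing) auto
    finally show "measure_pmf.prob ?M (\<Union>(S, T)\<in>R s. {H. H \<inter> cut_edges S (V - S - T) = {}}) \<le> 1 / real n ^ 3" .
  qed
  also have "\<dots> = real (card I) / real n ^ 3" by simp
  also have "\<dots> \<le> real n / real n ^ 3" using cardI by (intro divide_right_mono) auto
  also have "\<dots> = 1 / real n ^ 2" using n by (simp add: field_simps power3_eq_cube power2_eq_square)
  finally show ?thesis .
qed

section \<open>Sprinkling the boosters\<close>

lemma ham_cycle_mono: "ham_cycle V H xs \<Longrightarrow> H \<subseteq> H' \<Longrightarrow> ham_cycle V H' xs"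
  unfolding ham_cycle_def by auto

lemma expander_mono:
  assumes "expander V H" "H \<subseteq> H'" "H' \<subseteq> all_edges V" "finite V"
  shows "expander V H'"
  unfolding expander_def
proof (intro conjI allI impI)
  fix S assume S: "S \<subseteq> V" "S \<noteq> {}" "4 * card S \<le> card V"
  have "outer_nbrs H S \<subseteq> outer_nbrs H' S"
    using assms(2) unfolding outer_nbrs_def neighbours_def by auto
  moreover have "outer_nbrs H' S \<subseteq> V"
    using finite_neighbours(2)[OF assms(3,4)] unfolding outer_nbrs_def by blast
  then have "finite (outer_nbrs H' S)" using assms(4) finite_subset by auto
  ultimately have "card (outer_nbrs H S) \<le> card (outer_nbrs H' S)" by (simp add: card_mono)
  moreover have "2 * card S < card (outer_nbrs H S)" using assms(1) S unfolding expander_def by blast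
  ultimately show "2 * card S < card (outer_nbrs H' S)" by linarith
qed fact

text \<open>The invariant after \<open>i\<close> successful rounds. Expansion survives the addition
  of edges, and at \<open>i = card V\<close> the second alternative is impossible, since no path has
  more than \<open>card V\<close> vertices.\<close>

definition sprinkled :: "nat set \<Rightarrow> nat \<Rightarrow> nat set set \<Rightarrow> bool" where
  "sprinkled V i H \<longleftrightarrow> expander V H \<and>
     ((\<exists>xs. ham_cycle V H xs) \<or> (\<exists>xs. is_path V H xs \<and> i < length xs))"

text \<open>The boosters are determined by \<open>H\<close>, which is fixed before \<open>Y\<close>
  is drawn. At least \<open>n^2 / 32\<close> of them, each chosen with probability
  \<open>96 * ln n / n^2\<close>, are all missed with probability at most
  \<open>exp (- 3 * ln n)\<close>.\<close>

lemma prob_not_sprinkled_step: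
  assumes V: "finite V" and n: "n = card V" "12 \<le> n" and q: "q = 96 * ln (real n) / real n ^ 2" "q \<le> 1"
    and H: "sprinkled V i H"
  shows "measure_pmf.prob (gnp V q) {Y. \<not> sprinkled V (Suc i) (H \<union> Y)} \<le> 1 / real n ^ 3"
proof -
  let ?B = "{e \<in> all_edges V. booster V H e}"
  have q0: "0 \<le> q" using q n by simp
  have ex: "expander V H" and HE: "H \<subseteq> all_edges V"
    using H unfolding sprinkled_def expander_def by auto
  have "sprinkled V (Suc i) (H \<union> Y)" if Y: "Y \<subseteq> all_edges V" "Y \<inter> ?B \<noteq> {}" for Y
  proof -
    obtain e where e: "e \<in> Y" "booster V H e" using Y(2) by auto
    have sub: "insert e H \<subseteq> H \<union> Y" using e(1) by auto
    have ex': "expander V (H \<union> Y)" using expander_mono[OF ex _ _ V, of "H \<union> Y"] HE Y(1) by auto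
    consider (ham) xs where "ham_cycle V H xs" | (path) xs where "is_path V H xs" "i < length xs"
      using H unfolding sprinkled_def by blast
    then show ?thesis
    proof cases
      case ham
      then show ?thesis using ex' ham_cycle_mono[of V H _ "H \<union> Y"] unfolding sprinkled_def by blast
    next
      case path
      from e(2) consider (h) ys where "ham_cycle V (insert e H) ys"
        | (l) ys where "is_path V (insert e H) ys" "length xs < length ys"
        unfolding booster_def using path(1) by blast
      then show ?thesis
      proof cases
        case h
        then show ?thesis using ex' ham_cycle_mono[OF _ sub] unfolding sprinkled_def by blast
      next
        case l
        then have "Suc i < length ys" using path(2) by simp
        then show ?thesis using ex' is_path_mono[OF l(1) sub] unfolding sprinkled_def by blast
      qed
    qed
  qed
  then have "measure_pmf.prob (gnp V q) {Y. \<not> sprinkled V (Suc i) (H \<union> Y)} \<le>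
      measure_pmf.prob (gnp V q) ({Y. Y \<inter> ?B = {}} \<union> - Pow (all_edges V))"
    by (intro measure_pmf.finite_measure_mono) auto
  also have "\<dots> = measure_pmf.prob (gnp V q) {Y. Y \<inter> ?B = {}}"
    using set_random_subset[of "all_edges V" q] unfolding gnp_eq_random_subset
    by (intro measure_prob_cong_0) (auto simp: set_pmf_iff)
  also have "\<dots> = (1 - q) ^ card ?B"
    unfolding gnp_eq_random_subset
    by (rule prob_random_subset_disjoint[OF finite_all_edges[OF V] q0 q(2)]) auto
  also have "\<dots> \<le> exp (- (q * real (card ?B)))" by (rule one_minus_power_le_exp[OF q0 q(2)])
  also have "\<dots> \<le> exp (- (real 3 * ln (real n)))"
  proof -
    have "q * (real n ^ 2 / 32) \<le> q * real (card ?B)"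
      using card_boosters[OF ex V] n q0 by (intro mult_left_mono) auto
    moreover have "q * (real n ^ 2 / 32) = real 3 * ln (real n)" using q(1) n by (simp add: field_simps)
    ultimately show ?thesis by simp
  qed
  also have "\<dots> = 1 / real n ^ 3"
    unfolding exp_minus exp_of_nat_mult using n by (simp add: inverse_eq_divide)
  finally show ?thesis .
qed

text \<open>The constant is \<open>120 = 24 + 96\<close>: density \<open>24 * ln n / n\<close> for
  the expander, and \<open>n\<close> sprinkling rounds of density \<open>96 * ln n / n^2\<close>
  each. The failures are \<open>1 / n^2\<close> for expansion and \<open>1 / n^3\<close> per
  round.\<close>

lemma gnp_hamiltonian:
  assumes V: "finite V" and n: "n = card V" "12 \<le> n" and p: "120 * ln (real n) / real n \<le> p" "p \<le> 1"
  shows "measure_pmf.prob (gnp V p) {H. \<not> (\<exists>xs. ham_cycle V H xs)} \<le> 2 / real n ^ 2"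
proof -
  define p1 where "p1 = 24 * ln (real n) / real n"
  define q where "q = 96 * ln (real n) / real n ^ 2"
  have L: "0 < ln (real n)" using n by simp
  have "p1 \<le> 120 * ln (real n) / real n" unfolding p1_def using L by (intro divide_right_mono) auto
  then have p1: "0 \<le> p1" "p1 \<le> 1" using L p unfolding p1_def by auto
  have nq: "p1 + real n * q = 120 * ln (real n) / real n"
    unfolding p1_def q_def using n by (simp add: field_simps power2_eq_square)
  have q0: "0 \<le> q" using L unfolding q_def by simp
  have nq1: "real n * q \<le> 1" using nq p p1 by linarith
  have "q \<le> real n * q" using n q0 by (simp add: mult_le_cancel_right1)
  then have q1: "q \<le> 1" using nq1 by linarith
  define r where "r i = 1 - (1 - p1) * (1 - q) ^ i" for i :: nat
  have r: "0 \<le> r i" "r i \<le> 1" for i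
  proof -
    have "(1 - p1) * (1 - q) ^ i \<le> 1 * 1"
      using p1 q0 q1 by (intro mult_mono power_le_one) auto
    then show "0 \<le> r i" unfolding r_def by simp
    show "r i \<le> 1" unfolding r_def using p1 q1 by simp
  qed
  have ind: "measure_pmf.prob (gnp V (r i)) {H. \<not> sprinkled V i H} \<le> 1 / real n ^ 2 + real i / real n ^ 3" for i
  proof (induction i)
    case 0
    have "V \<noteq> {}" using n by auto
    then obtain x where "x \<in> V" by blast
    \<comment> \<open>A single vertex is a path of length one, so before any sprinkling the path
      alternative holds for free and only expansion is at stake.\<close>
    then have "is_path V H [x]" for H unfolding is_path_def by simp
    then have "sprinkled V 0 H = expander V H" for H unfolding sprinkled_def by blast
    then show ?case using prob_not_expander[OF V n p1_def p1(2)] unfolding r_def by simp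
  next
    case (Suc i)
    have "r (Suc i) = 1 - (1 - r i) * (1 - q)" unfolding r_def by simp
    moreover have "measure_pmf.prob (gnp V (1 - (1 - r i) * (1 - q))) {H. \<not> sprinkled V (Suc i) H} \<le>
        measure_pmf.prob (gnp V (r i)) {H. \<not> sprinkled V i H} + 1 / real n ^ 3"
      using prob_not_sprinkled_step[OF V n q_def q1, of i]
      by (intro prob_union_gnp_le[OF V r q0 q1]) auto
    ultimately show ?case using Suc by (simp add: add_divide_distrib)
  qed
  \<comment> \<open>Bernoulli's inequality bounds the density \<open>r n\<close> of the union by the
    sum \<open>p1 + n * q\<close>, which is at most \<open>p\<close>.\<close>
  have "1 - real n * q \<le> (1 - q) ^ n"
    using Bernoulli_inequality[of "- q" n] q1 by simp
  then have "(1 - p1) * (1 - real n * q) \<le> (1 - p1) * (1 - q) ^ n"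
    using p1 by (intro mult_left_mono) auto
  moreover have "1 - p1 - real n * q \<le> (1 - p1) * (1 - real n * q)"
    using p1 q0 by (simp add: algebra_simps)
  ultimately have rn: "r n \<le> p" unfolding r_def using nq p(1) by linarith
  have ham: "\<exists>xs. ham_cycle V H xs" if "sprinkled V n H" for H
    using that length_path_le[OF V, of H] n unfolding sprinkled_def by (meson not_less)
  have "measure_pmf.prob (gnp V p) {H. \<not> (\<exists>xs. ham_cycle V H xs)} \<le>
      measure_pmf.prob (gnp V (r n)) {H. \<not> (\<exists>xs. ham_cycle V H xs)}"
    using ham_cycle_mono by (intro prob_gnp_antimono[OF V _ rn] r p) blast+
  also have "\<dots> \<le> measure_pmf.prob (gnp V (r n)) {H. \<not> sprinkled V n H}"
    using ham by (intro measure_pmf.finite_measure_mono) auto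
  also have "\<dots> \<le> 1 / real n ^ 2 + real n / real n ^ 3" by (rule ind)
  also have "\<dots> = 2 / real n ^ 2" using n by (simp add: field_simps power3_eq_cube power2_eq_square)
  finally show ?thesis .
qed

section \<open>The network and its samples are good with high probability\<close>

lemma card_neighbours_eq:
  assumes "E \<subseteq> all_edges V"
  shows "card (neighbours E u) = card (E \<inter> {e \<in> all_edges V. u \<in> e})"
proof -
  have "E \<inter> {e \<in> all_edges V. u \<in> e} = (\<lambda>x. {u, x}) ` neighbours E u"
  proof (intro set_eqI iffI)
    fix e assume e: "e \<in> E \<inter> {e \<in> all_edges V. u \<in> e}"
    then obtain a b where "e = {a, b}" "a < b \<or> b < a" by (auto elim: all_edgesE)
    then show "e \<in> (\<lambda>x. {u, x}) ` neighbours E u"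
      using e unfolding neighbours_def by (auto simp: insert_commute)
  qed (use assms in \<open>auto simp: neighbours_def\<close>)
  moreover have "inj_on (\<lambda>x. {u, x}) (neighbours E u)" by (auto simp: inj_on_def doubleton_eq_iff)
  ultimately show ?thesis by (simp add: card_image)
qed

lemma card_star_le:
  assumes "finite V"
  shows "card {e \<in> all_edges V. u \<in> e} \<le> card V"
proof -
  have "{e \<in> all_edges V. u \<in> e} = all_edges V \<inter> {e \<in> all_edges V. u \<in> e}" by auto
  then have "card {e \<in> all_edges V. u \<in> e} = card (neighbours (all_edges V) u)"
    using card_neighbours_eq[of "all_edges V" V u] by simp
  also have "\<dots> \<le> card V"
    using finite_neighbours(2)[of "all_edges V" V u] assms by (intro card_mono) auto
  finally show ?thesis .
qed

text \<open>The mean degree is at most \<open>n * p\<close>, and the base-two tail bound at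
  \<open>4 * n * p\<close> gives \<open>exp (n * p) / 2 ^ d\<close> with \<open>2 ^ d\<close> at
  least \<open>exp (2 * n * p)\<close>. The factor four is what beats the numerator.\<close>

lemma prob_large_degree:
  fixes p :: real
  assumes V: "finite V" and p: "0 \<le> p" "p \<le> 1"
  shows "measure_pmf.prob (gnp V p) {E. \<exists>u\<in>V. 4 * real (card V) * p < card (neighbours E u)} \<le>
    card V * exp (- (card V * p))"
proof -
  let ?M = "gnp V p" and ?n = "real (card V)"
  define d where "d = nat \<lceil>4 * ?n * p\<rceil>"
  have d: "4 * ?n * p \<le> real d" unfolding d_def using p by linarith
  have one: "measure_pmf.prob ?M {Y. d \<le> card (Y \<inter> {e \<in> all_edges V. u \<in> e})} \<le> exp (- (?n * p))" for u
  proof -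
    have "measure_pmf.prob ?M {Y. d \<le> card (Y \<inter> {e \<in> all_edges V. u \<in> e})} \<le>
        exp (p * card {e \<in> all_edges V. u \<in> e}) / 2 ^ d"
      unfolding gnp_eq_random_subset
      using prob_card_random_subset_ge[OF finite_all_edges[OF V] p, of "{e \<in> all_edges V. u \<in> e}" d] by auto
    also have "\<dots> \<le> exp (p * ?n) / exp (2 * (?n * p))"
    proof (rule frac_le)
      have "2 * (?n * p) \<le> real d * (1 / 2)" using d by simp
      also have "\<dots> \<le> real d * ln 2" using ln2_ge_two_thirds by (intro mult_left_mono) auto
      finally have "exp (2 * (?n * p)) \<le> exp (real d * ln 2)" by simp
      then show "exp (2 * (?n * p)) \<le> 2 ^ d" by (simp add: exp_of_nat_mult)
      show "exp (p * real (card {e \<in> all_edges V. u \<in> e})) \<le> exp (p * ?n)"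
        using card_star_le[OF V, of u] p by (simp add: mult_left_mono)
    qed auto
    also have "\<dots> = exp (- (?n * p))" by (simp add: mult.commute flip: exp_diff)
    finally show ?thesis .
  qed
  have "measure_pmf.prob ?M {E. \<exists>u\<in>V. 4 * ?n * p < card (neighbours E u)} \<le>
      measure_pmf.prob ?M ((\<Union>u\<in>V. {Y. d \<le> card (Y \<inter> {e \<in> all_edges V. u \<in> e})}) \<union> - Pow (all_edges V))"
  proof (intro measure_pmf.finite_measure_mono subsetI)
    fix E assume "E \<in> {E. \<exists>u\<in>V. 4 * ?n * p < card (neighbours E u)}"
    then obtain u where u: "u \<in> V" "4 * ?n * p < card (neighbours E u)" by auto
    then have "d \<le> card (neighbours E u)" unfolding d_def by linarith
    then show "E \<in> (\<Union>u\<in>V. {Y. d \<le> card (Y \<inter> {e \<in> all_edges V. u \<in> e})}) \<union> - Pow (all_edges V)"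
      using u(1) card_neighbours_eq[of E V u] by auto
  qed simp
  also have "\<dots> = measure_pmf.prob ?M (\<Union>u\<in>V. {Y. d \<le> card (Y \<inter> {e \<in> all_edges V. u \<in> e})})"
    using set_random_subset[of "all_edges V" p] unfolding gnp_eq_random_subset
    by (intro measure_prob_cong_0) (auto simp: set_pmf_iff)
  also have "\<dots> \<le> (\<Sum>u\<in>V. measure_pmf.prob ?M {Y. d \<le> card (Y \<inter> {e \<in> all_edges V. u \<in> e})})"
    by (rule measure_UNION_le[OF V]) auto
  also have "\<dots> \<le> (\<Sum>u\<in>V. exp (- (?n * p)))" by (intro sum_mono one)
  finally show ?thesis by simp
qed

text \<open>The \<open>n - 2\<close> possible paths of length two are edge-disjoint. With the edges
  at \<open>w\<close> exposed first, \<open>v\<close> has to miss every vertex found adjacent to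
  \<open>w\<close>; averaging \<open>(1 - p)\<close> to the number of these gives
  \<open>(1 - p^2) ^ (n - 2)\<close>.\<close>

lemma prob_no_common_neighbour:
  fixes p :: real
  assumes V: "finite V" and vw: "v \<in> V" "w \<in> V" "v \<noteq> w" and p: "0 \<le> p" "p \<le> 1"
  shows "measure_pmf.prob (gnp V p) {E. \<forall>x. \<not> ({v, x} \<in> E \<and> {x, w} \<in> E)} \<le>
    exp (- (p\<^sup>2 * real (card V - 2)))"
proof -
  let ?X = "all_edges V" and ?C = "{E. \<forall>x. \<not> ({v, x} \<in> E \<and> {x, w} \<in> E)}"
  define W where "W = V - {v, w}"
  define F where "F = (\<lambda>x. {w, x}) ` W"
  have injw: "inj_on (\<lambda>x. {z, x}) W" for z by (auto simp: inj_on_def doubleton_eq_iff)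
  have FX: "F \<subseteq> ?X" unfolding F_def W_def using vw by (auto simp: pair_in_all_edges)
  have finX: "finite ?X" using finite_all_edges[OF V] .
  have finF: "finite F" using FX finX finite_subset by auto
  have cardF: "card F = card V - 2"
    unfolding F_def using injw vw V by (simp add: card_image W_def card_Diff_subset)
  have gnp: "gnp V p = bind_pmf (random_subset F p) (\<lambda>A. map_pmf ((\<union>) A) (random_subset (?X - F) p))"
    unfolding gnp_eq_random_subset split_random_subset[OF finX FX p, symmetric]
    by (simp add: pair_pmf_def map_pmf_def bind_assoc_pmf bind_return_pmf)
  have bound: "measure_pmf.prob (map_pmf ((\<union>) A) (random_subset (?X - F) p)) ?C \<le> (1 - p) ^ card (A \<inter> F)"
    for A
  proof -
    define G where "G = (\<lambda>x. {v, x}) ` {x \<in> W. {w, x} \<in> A}"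
    have "A \<inter> F = (\<lambda>x. {w, x}) ` {x \<in> W. {w, x} \<in> A}" unfolding F_def by auto
    then have "card (A \<inter> F) = card {x \<in> W. {w, x} \<in> A}"
      using injw[of w] by (metis (no_types, lifting) card_image inj_on_subset mem_Collect_eq subsetI)
    moreover have "card G = card {x \<in> W. {w, x} \<in> A}"
      unfolding G_def using injw[of v] by (metis (no_types, lifting) card_image inj_on_subset mem_Collect_eq subsetI)
    ultimately have cG: "card (A \<inter> F) = card G" by simp
    have GX: "G \<subseteq> ?X - F"
      unfolding G_def F_def W_def using vw by (auto simp: pair_in_all_edges doubleton_eq_iff)
    have "(\<union>) A -` ?C \<subseteq> {B. B \<inter> G = {}}"
      unfolding G_def by (auto simp: insert_commute)
    then have "measure_pmf.prob (map_pmf ((\<union>) A) (random_subset (?X - F) p)) ?C \<le>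
        measure_pmf.prob (random_subset (?X - F) p) {B. B \<inter> G = {}}"
      unfolding measure_map_pmf by (intro measure_pmf.finite_measure_mono) auto
    also have "\<dots> = (1 - p) ^ card G"
      using prob_random_subset_disjoint[OF _ p GX] finX by simp
    finally show ?thesis using cG by simp
  qed
  have "measure_pmf.prob (gnp V p) ?C = measure_pmf.expectation (random_subset F p)
      (\<lambda>A. measure_pmf.prob (map_pmf ((\<union>) A) (random_subset (?X - F) p)) ?C)"
    unfolding gnp by (rule measure_bind_pmf_eq_expectation)
  also have "\<dots> \<le> measure_pmf.expectation (random_subset F p) (\<lambda>A. (1 - p) ^ card (A \<inter> F))"
  proof (rule integral_mono)
    show "integrable (measure_pmf (random_subset F p))
        (\<lambda>A. measure_pmf.prob (map_pmf ((\<union>) A) (random_subset (?X - F) p)) ?C)"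
      by (rule measure_pmf.integrable_const_bound[where B=1]) auto
    show "integrable (measure_pmf (random_subset F p)) (\<lambda>A. (1 - p) ^ card (A \<inter> F))"
      by (rule measure_pmf.integrable_const_bound[where B=1]) (use p in \<open>auto simp: power_le_one\<close>)
  qed (rule bound)
  also have "\<dots> = (1 - p + p * (1 - p)) ^ card (F \<inter> F)"
    using p by (intro expectation_random_subset_power[OF finF]) auto
  also have "1 - p + p * (1 - p) = 1 - p\<^sup>2" by (simp add: power2_eq_square algebra_simps)
  also have "(1 - p\<^sup>2) ^ card (F \<inter> F) \<le> exp (- (p\<^sup>2 * real (card (F \<inter> F))))"
    using p by (intro one_minus_power_le_exp) (auto simp: power_le_one)
  finally show ?thesis using cardF by simp
qed

text \<open>A common neighbour is demanded even from vertices adjacent to \<open>v\<close>, which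
  gives the union bound one form of event for all \<open>w\<close>.\<close>

lemma prob_large_eccentricity:
  fixes p :: real
  assumes V: "finite V" and v: "v \<in> V" and p: "0 \<le> p" "p \<le> 1"
  shows "measure_pmf.prob (gnp V p) {E. \<exists>w\<in>V - {v}. \<forall>x. \<not> ({v, x} \<in> E \<and> {x, w} \<in> E)} \<le>
    card V * exp (- (p\<^sup>2 * real (card V - 2)))"
proof -
  have "measure_pmf.prob (gnp V p) {E. \<exists>w\<in>V - {v}. \<forall>x. \<not> ({v, x} \<in> E \<and> {x, w} \<in> E)} =
      measure_pmf.prob (gnp V p) (\<Union>w\<in>V - {v}. {E. \<forall>x. \<not> ({v, x} \<in> E \<and> {x, w} \<in> E)})"
    by (rule arg_cong[where f="measure_pmf.prob _"]) auto
  also have "\<dots> \<le> (\<Sum>w\<in>V - {v}. measure_pmf.prob (gnp V p) {E. \<forall>x. \<not> ({v, x} \<in> E \<and> {x, w} \<in> E)})"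
    using V by (intro measure_UNION_le) auto
  also have "\<dots> \<le> (\<Sum>w\<in>V - {v}. exp (- (p\<^sup>2 * real (card V - 2))))"
    using prob_no_common_neighbour[OF V v _ _ p] by (intro sum_mono) auto
  also have "\<dots> \<le> (\<Sum>w\<in>V. exp (- (p\<^sup>2 * real (card V - 2))))"
    using V by (intro sum_mono2) auto
  finally show ?thesis by simp
qed

section \<open>Hamiltonicity of the sampled edges\<close>

definition sampled_edges :: "nat set \<Rightarrow> (nat \<Rightarrow> nat list) \<Rightarrow> nat set set" where
  "sampled_edges V \<omega> = {{u, x} | u x. u \<in> V - {Min V} \<and> x \<in> set (\<omega> u)}"

lemma coin_space_upcast:
  "coin_space (upcast solve c) V E =
     Pi_pmf V undefined (\<lambda>u. uniform_samples (sample_count c (card V)) (neighbours E u))"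
  unfolding coin_space_def upcast_def upcast_coins_def uniform_samples_def view_of_def
  by (simp cong: if_cong)

text \<open>An edge is credited to its larger endpoint only, so the unused samples of the leader
  \<open>Min V\<close> are not missed and the credited samples form a thinned copy of the graph.\<close>

lemma prob_sampled_not_hamiltonian:
  fixes \<theta> p :: real
  assumes V: "finite V" and n: "n = card V" "12 \<le> n" and p: "0 \<le> p" "p \<le> 1" and \<theta>: "0 < \<theta>"
    and deg: "\<theta> * (4 * real n * p) \<le> real (sample_count c n) / 8"
    and dense: "120 * ln (real n) / real n \<le> p * (1 - exp (- \<theta>))"
  shows "measure_pmf.prob (run_space (upcast solve c) V p)
      {(E, \<omega>). (\<forall>u\<in>V. real (card (neighbours E u)) \<le> 4 * real n * p) \<and> \<not> (\<exists>xs. ham_cycle V (sampled_edges V \<omega>) xs)} \<le>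
    2 / real n ^ 2 + n * exp (- real (sample_count c n))"
proof -
  let ?k = "sample_count c n" and ?q = "1 - exp (- \<theta>)"
  let ?A = "{(E, \<omega>). (\<forall>u\<in>V. real (card (neighbours E u)) \<le> 4 * real n * p) \<and>
    \<not> (\<exists>xs. ham_cycle V (sampled_edges V \<omega>) xs)}"
  let ?non = "{H. \<not> (\<exists>xs. ham_cycle V H xs)}"
  let ?run = "\<lambda>E. map_pmf (Pair E) (coin_space (upcast solve c) V E)"
  have q: "0 \<le> ?q" "?q \<le> 1" using \<theta> by auto
  \<comment> \<open>The coupling needs the degrees of \<open>E\<close>, so it is applied to one
    graph at a time. The Hamiltonicity term is kept on the right even for graphs of large degree;
    averaging it over all \<open>E\<close> therefore yields the unconditioned random graph of
    density \<open>p * ?q\<close>.\<close>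
  have one: "measure_pmf.prob (?run E) ?A \<le> measure_pmf.prob (random_subset E ?q) ?non + n * exp (- real ?k)"
    if E: "E \<subseteq> all_edges V" for E
  proof (cases "\<forall>u\<in>V. real (card (neighbours E u)) \<le> 4 * real n * p")
    case False
    then have "Pair E -` ?A = {}" by auto
    then show ?thesis by simp
  next
    case True
    let ?Y = "{B. \<exists>xs. ham_cycle V {e \<in> E. Min e \<in> B (Max e)} xs}"
    let ?X = "{\<omega>. \<exists>xs. ham_cycle V (sampled_edges V \<omega>) xs}"
    have coins: "coin_space (upcast solve c) V E =
        Pi_pmf V undefined (\<lambda>u. uniform_samples ?k (neighbours E u))"
      unfolding coin_space_upcast n(1) ..
    have "Pair E -` ?A \<subseteq> - ?X" by auto
    then have "measure_pmf.prob (?run E) ?A \<le> measure_pmf.prob (coin_space (upcast solve c) V E) (- ?X)"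
      unfolding measure_map_pmf by (intro measure_pmf.finite_measure_mono) auto
    also have "\<dots> \<le> measure_pmf.prob (Pi_pmf V {} (\<lambda>u. random_subset (neighbours E u) ?q)) (- ?Y) +
        card V * exp (- real ?k)"
      unfolding coins
    proof (rule samples_dominate[OF V finite_neighbours(1)[OF E V] \<theta>])
      fix u assume "u \<in> V"
      then have "\<theta> * card (neighbours E u) \<le> \<theta> * (4 * real n * p)"
        using True \<theta> by (intro mult_left_mono) auto
      then show "\<theta> * card (neighbours E u) \<le> real ?k / 8" using deg by linarith
    next
      fix r :: "nat \<Rightarrow> nat list" and B
      assume B: "\<And>u. u \<in> V \<Longrightarrow> B u \<subseteq> set (r u)" "B \<in> ?Y"
      have "{e \<in> E. Min e \<in> B (Max e)} \<subseteq> sampled_edges V r"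
      proof
        fix e assume e: "e \<in> {e \<in> E. Min e \<in> B (Max e)}"
        then have "e \<in> all_edges V" using E by blast
        then obtain u x where ux: "e = {u, x}" "x < u" "x \<in> V" "u \<in> V" by (rule all_edgesE)
        then have "Min e = x" "Max e = u" by auto
        then have "x \<in> set (r u)" using e B(1) ux(4) by auto
        moreover have "u \<noteq> Min V" using ux V by (metis Min_le not_le)
        ultimately show "e \<in> sampled_edges V r" using ux unfolding sampled_edges_def by blast
      qed
      then show "r \<in> ?X" using B(2) ham_cycle_mono by blast
    qed
    also have "measure_pmf.prob (Pi_pmf V {} (\<lambda>u. random_subset (neighbours E u) ?q)) (- ?Y) =
        measure_pmf.prob (random_subset E ?q) ?non"
      unfolding owned_edges_random_subset[OF V E q, symmetric] measure_map_pmf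
      by (rule arg_cong[where f="measure_pmf.prob _"]) auto
    finally show ?thesis using n(1) by simp
  qed
  have "run_space (upcast solve c) V p = bind_pmf (gnp V p) ?run"
    unfolding run_space_def map_pmf_def ..
  then have "measure_pmf.prob (run_space (upcast solve c) V p) ?A =
      measure_pmf.expectation (gnp V p) (\<lambda>E. measure_pmf.prob (?run E) ?A)"
    using measure_bind_pmf_eq_expectation[of "gnp V p" ?run] by simp
  also have "\<dots> \<le> measure_pmf.expectation (gnp V p)
      (\<lambda>E. measure_pmf.prob (random_subset E ?q) ?non + n * exp (- real ?k))"
  proof (rule integral_mono_AE)
    show "integrable (measure_pmf (gnp V p)) (\<lambda>E. measure_pmf.prob (?run E) ?A)"
      by (rule measure_pmf.integrable_const_bound[where B=1]) auto
    show "integrable (measure_pmf (gnp V p))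
        (\<lambda>E. measure_pmf.prob (random_subset E ?q) ?non + n * exp (- real ?k))"
      by (rule Bochner_Integration.integrable_add, rule measure_pmf.integrable_const_bound[where B=1])
        auto
    show "AE E in measure_pmf (gnp V p). measure_pmf.prob (?run E) ?A \<le>
        measure_pmf.prob (random_subset E ?q) ?non + n * exp (- real ?k)"
    proof (rule AE_pmfI)
      fix E assume "E \<in> set_pmf (gnp V p)"
      then have "E \<subseteq> all_edges V"
        using set_random_subset[of "all_edges V" p] unfolding gnp_eq_random_subset by auto
      then show "measure_pmf.prob (?run E) ?A \<le>
          measure_pmf.prob (random_subset E ?q) ?non + n * exp (- real ?k)" by (rule one)
    qed
  qed
  also have "\<dots> = measure_pmf.expectation (gnp V p) (\<lambda>E. measure_pmf.prob (random_subset E ?q) ?non) +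
      n * exp (- real ?k)"
    by (subst Bochner_Integration.integral_add)
      (auto intro!: measure_pmf.integrable_const_bound[where B=1])
  also have "measure_pmf.expectation (gnp V p) (\<lambda>E. measure_pmf.prob (random_subset E ?q) ?non) =
      measure_pmf.prob (gnp V (p * ?q)) ?non"
    unfolding gnp_eq_random_subset measure_bind_pmf_eq_expectation[symmetric]
      thin_random_subset[OF finite_all_edges[OF V] p q] ..
  also have "\<dots> \<le> 2 / real n ^ 2"
    using p q by (intro gnp_hamiltonian[OF V n dense] mult_le_one) auto
  finally show ?thesis by simp
qed

text \<open>The interface between probability and protocol: on such a run the protocol is analysed
  deterministically. \<open>k\<close> is the number of samples per node and \<open>d\<close> the
  degree bound.\<close>

definition good_run :: "nat \<Rightarrow> nat set \<Rightarrow> real \<Rightarrow> nat set set \<Rightarrow> (nat \<Rightarrow> nat list) \<Rightarrow> bool" where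
  "good_run k V d E \<omega> \<longleftrightarrow> E \<subseteq> all_edges V \<and> (\<forall>u\<in>V. real (card (neighbours E u)) \<le> d) \<and>
     (\<forall>w\<in>V - {Min V}. \<exists>x. {Min V, x} \<in> E \<and> {x, w} \<in> E) \<and>
     (\<forall>u\<in>V. length (\<omega> u) = k \<and> set (\<omega> u) \<subseteq> neighbours E u) \<and>
     (\<exists>xs. ham_cycle V (sampled_edges V \<omega>) xs)"

lemma prob_good_run:
  fixes \<theta> p :: real
  assumes V: "finite V" and n: "n = card V" "12 \<le> n" and p: "0 \<le> p" "p \<le> 1" and \<theta>: "0 < \<theta>"
    and deg: "\<theta> * (4 * real n * p) \<le> real (sample_count c n) / 8"
    and dense: "120 * ln (real n) / real n \<le> p * (1 - exp (- \<theta>))"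
  shows "measure_pmf.prob (run_space (upcast solve c) V p)
      {(E, \<omega>). \<not> good_run (sample_count c n) V (4 * real n * p) E \<omega>} \<le>
    real n * exp (- (real n * p)) + n * exp (- (p\<^sup>2 * (real n - 2))) + 2 / real n ^ 2 + n * exp (- real (sample_count c n))"
proof -
  let ?R = "run_space (upcast solve c) V p"
  define D where "D = {E. \<exists>u\<in>V. 4 * real (card V) * p < card (neighbours E u)}"
  define X where "X = {E. \<exists>w\<in>V - {Min V}. \<forall>x. \<not> ({Min V, x} \<in> E \<and> {x, w} \<in> E)}"
  define A where "A = {(E, \<omega>). (\<forall>u\<in>V. real (card (neighbours E u)) \<le> 4 * real n * p) \<and>
    \<not> (\<exists>xs. ham_cycle V (sampled_edges V \<omega>) xs)}"
  \<comment> \<open>A null set; outside it the outcomes lie in the support, which supplies the facts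
    about \<open>E\<close> and the samples that hold surely.\<close>
  define Z where "Z = {x. x \<notin> set_pmf ?R}"
  have Vne: "V \<noteq> {}" using n by auto
  have fst: "map_pmf fst ?R = gnp V p"
    unfolding run_space_def by (simp add: map_bind_pmf bind_return_pmf')
  have "{(E, \<omega>). \<not> good_run (sample_count c n) V (4 * real n * p) E \<omega>} \<subseteq> fst -` D \<union> fst -` X \<union> A \<union> Z"
  proof
    fix z assume "z \<in> {(E, \<omega>). \<not> good_run (sample_count c n) V (4 * real n * p) E \<omega>}"
    then obtain E \<omega> where z: "z = (E, \<omega>)" and bad: "\<not> good_run (sample_count c n) V (4 * real n * p) E \<omega>"
      by auto
    show "z \<in> fst -` D \<union> fst -` X \<union> A \<union> Z"
    proof (rule ccontr)
      assume "z \<notin> fst -` D \<union> fst -` X \<union> A \<union> Z"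
      then have nA: "(E, \<omega>) \<notin> Z" "(E, \<omega>) \<notin> A" "E \<notin> X" and nD: "E \<notin> D" using z by auto
      have sup: "E \<in> set_pmf (gnp V p)" "\<omega> \<in> set_pmf (coin_space (upcast solve c) V E)"
        using nA(1) unfolding Z_def run_space_def by auto
      have E: "E \<subseteq> all_edges V"
        using sup(1) set_random_subset[of "all_edges V" p] unfolding gnp_eq_random_subset by auto
      have deg: "\<forall>u\<in>V. real (card (neighbours E u)) \<le> 4 * real n * p"
        using nD n(1) unfolding D_def by (auto simp: not_less)
      have ecc: "\<forall>w\<in>V - {Min V}. \<exists>x. {Min V, x} \<in> E \<and> {x, w} \<in> E" using nA(3) unfolding X_def by auto
      have ham: "\<exists>xs. ham_cycle V (sampled_edges V \<omega>) xs" using nA(2) deg unfolding A_def by auto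
      have "length (\<omega> u) = sample_count c n \<and> set (\<omega> u) \<subseteq> neighbours E u" if u: "u \<in> V" for u
      proof -
        \<comment> \<open>An isolated node would hold the empty list instead of \<open>k\<close>
          samples.\<close>
        have "neighbours E u \<noteq> {}"
        proof (cases "u = Min V")
          case False
          then obtain x where "{x, u} \<in> E" using ecc u by blast
          then have "x \<in> neighbours E u" by (simp add: neighbours_def insert_commute)
          then show ?thesis by blast
        next
          case True
          have "V - {Min V} \<noteq> {}"
          proof
            assume "V - {Min V} = {}"
            then have "V \<subseteq> {Min V}" by auto
            then have "card V \<le> 1" by (metis card_mono finite.emptyI finite_insert is_singletonI is_singleton_altdef)
            then show False using n by simp
          qed
          then show ?thesis using ecc True unfolding neighbours_def by fastforce
        qed
        moreover have "\<omega> u \<in> set_pmf (uniform_samples (sample_count c n) (neighbours E u))"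
          using sup(2) u unfolding coin_space_upcast set_Pi_pmf[OF V] n(1) by (auto simp: PiE_dflt_def)
        ultimately show ?thesis
          using finite_neighbours(1)[OF E V, of u]
          by (auto simp: uniform_samples_def set_replicate_pmf)
      qed
      then show False using bad E deg ecc ham unfolding good_run_def by blast
    qed
  qed
  then have "measure_pmf.prob ?R {(E, \<omega>). \<not> good_run (sample_count c n) V (4 * real n * p) E \<omega>} \<le>
      measure_pmf.prob ?R (fst -` D \<union> fst -` X \<union> A \<union> Z)"
    by (intro measure_pmf.finite_measure_mono) auto
  also have "\<dots> = measure_pmf.prob ?R (fst -` D \<union> fst -` X \<union> A)"
    by (intro measure_prob_cong_0) (auto simp: Z_def set_pmf_iff)
  also have "\<dots> \<le> measure_pmf.prob ?R (fst -` D) + measure_pmf.prob ?R (fst -` X) + measure_pmf.prob ?R A"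
    by (intro order_trans[OF measure_Un_le] add_right_mono) auto
  also have "measure_pmf.prob ?R (fst -` D) \<le> real n * exp (- (real n * p))"
    using prob_large_degree[OF V p] unfolding measure_map_pmf[symmetric] fst D_def n(1) .
  also have "measure_pmf.prob ?R (fst -` X) \<le> n * exp (- (p\<^sup>2 * (real n - 2)))"
    using prob_large_eccentricity[OF V Min_in[OF V Vne] p] n
    unfolding measure_map_pmf[symmetric] fst X_def n(1) by (simp add: of_nat_diff)
  also have "measure_pmf.prob ?R A \<le> 2 / real n ^ 2 + n * exp (- real (sample_count c n))"
    unfolding A_def by (rule prob_sampled_not_hamiltonian[OF V n p \<theta> deg dense])
  finally show ?thesis by simp
qed

section \<open>The Upcast protocol on a good run\<close>

declare config.simps [simp del]

lemma self_view_of [simp]: "self (view_of V E u) = u"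
  and nbrs_view_of [simp]: "nbrs (view_of V E u) = neighbours E u"
  and net_size_view_of [simp]: "net_size (view_of V E u) = card V"
  by (simp_all add: view_of_def)

lemma head_eq_None_iff [simp]: "head xs = None \<longleftrightarrow> xs = []"
  by (cases xs) (auto simp: head_def)

lemma head_Nil [simp]: "head [] = None"
  and head_Cons [simp]: "head (x # xs) = Some x"
  by (simp_all add: head_def)

lemma the_head [simp]: "xs \<noteq> [] \<Longrightarrow> the (head xs) = hd xs"
  by (cases xs) (auto simp: head_def)

text \<open>The origin of an item determines the neighbour delivering it, so new routing entries
  cannot clash and their order is irrelevant.\<close>

lemma map_of_inverse:
  "(\<And>w. w \<in> set ws \<Longrightarrow> g (f w) = w) \<Longrightarrow>
   map_of (map (\<lambda>w. (f w, w)) ws) = (\<lambda>o'. if o' \<in> f ` set ws then Some (g o') else None)"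
  by (induction ws) (auto simp: fun_eq_iff)

lemma set_tl_subset: "set (tl xs) \<subseteq> set xs"
  by (cases xs) auto

lemma mset_map_distinct: "distinct xs \<Longrightarrow> mset (map f xs) = (\<Sum>x\<in>set xs. {#f x#})"
  by (induction xs) auto

section \<open>One round in terms of the configuration\<close>

definition message :: "(nat \<Rightarrow> upcast_state) \<Rightarrow> nat \<Rightarrow> nat \<Rightarrow> msg" where
  "message c w u = Msg (leader (c w)) (if parent (c w) = Some u then head (items (c w)) else None)
     (head (down (c w) u))"

definition active :: "(nat \<Rightarrow> upcast_state) \<Rightarrow> nat \<Rightarrow> bool" where
  "active c w \<longleftrightarrow> upcast_result (c w) = None"

definition senders :: "nat set set \<Rightarrow> (nat \<Rightarrow> upcast_state) \<Rightarrow> nat \<Rightarrow> nat \<Rightarrow> nat list" where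
  "senders E c l u = filter (\<lambda>w. active c w \<and> leader (c w) = l \<and> parent (c w) = Some u \<and> items (c w) \<noteq> [])
     (sorted_list_of_set (neighbours E u))"

definition inbox_of :: "nat set set \<Rightarrow> (nat \<Rightarrow> upcast_state) \<Rightarrow> nat \<Rightarrow> (nat \<times> msg) list" where
  "inbox_of E c u = map (\<lambda>w. (w, message c w u)) (filter (active c) (sorted_list_of_set (neighbours E u)))"

definition gather :: "nat set set \<Rightarrow> (nat \<Rightarrow> upcast_state) \<Rightarrow> nat \<Rightarrow> upcast_state \<Rightarrow> upcast_state" where
  "gather E c u s = s\<lparr>items := items s @ map (\<lambda>w. hd (items (c w))) (senders E c (leader s) u),
     route := route s ++ map_of (map (\<lambda>w. (fst (hd (items (c w))), w)) (senders E c (leader s) u))\<rparr>"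

definition obtain_answer :: "nat set set \<Rightarrow> nat set \<Rightarrow> (nat \<Rightarrow> upcast_state) \<Rightarrow> nat \<Rightarrow> upcast_state \<Rightarrow> upcast_state"
where
  "obtain_answer E V c u s =
     (case parent s of None \<Rightarrow> s
      | Some x \<Rightarrow> if {x, u} \<in> E \<and> active c x \<and> down (c x) u \<noteq> []
                 then take_answer (view_of V E u) (hd (down (c x) u)) s else s)"

lemma transmitted_upcast:
  "transmitted (upcast solve cc) V E c w u = (if {w, u} \<in> E \<and> active c w then Some (message c w u) else None)"
  unfolding transmitted_def upcast_def upcast_send_def message_def active_def by simp

lemma inbox_list_upcast:
  assumes "finite (neighbours E u)"
  shows "inbox_list (view_of V E u) (\<lambda>w. transmitted (upcast solve cc) V E c w u) = inbox_of E c u"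
proof -
  have E: "{w, u} \<in> E" if "w \<in> neighbours E u" for w
    using that unfolding neighbours_def by (simp add: insert_commute)
  have "filter (\<lambda>w. transmitted (upcast solve cc) V E c w u \<noteq> None) (sorted_list_of_set (neighbours E u)) =
      filter (active c) (sorted_list_of_set (neighbours E u))"
    using E assms by (intro filter_cong) (auto simp: transmitted_upcast)
  then show ?thesis
    unfolding inbox_list_def inbox_of_def nbrs_view_of using E assms
    by (auto simp: transmitted_upcast)
qed

lemma collect_items_upcast: "collect_items (inbox_of E c u) s = gather E c u s"
proof -
  have "filter (\<lambda>(w, m). msg_leader m = leader s \<and> msg_item m \<noteq> None) (inbox_of E c u) =
      map (\<lambda>w. (w, message c w u)) (senders E c (leader s) u)"
    unfolding inbox_of_def senders_def filter_map filter_filter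
    by (intro arg_cong[where f="map _"] filter_cong) (auto simp: message_def head_def split: list.splits)
  moreover have "map (\<lambda>(w, m). the (msg_item m)) (map (\<lambda>w. (w, message c w u)) (senders E c l u)) =
      map (\<lambda>w. hd (items (c w))) (senders E c l u)" for l
    by (auto simp: senders_def message_def)
  moreover have "map (\<lambda>(w, m). (fst (the (msg_item m)), w)) (map (\<lambda>w. (w, message c w u)) (senders E c l u)) =
      map (\<lambda>w. (fst (hd (items (c w))), w)) (senders E c l u)" for l
    by (auto simp: senders_def message_def)
  ultimately show ?thesis
    unfolding collect_items_def gather_def Let_def by (simp only:)
qed

lemma answer_from_parent_upcast:
  "answer_from_parent (view_of V E u) (\<lambda>w. transmitted (upcast solve cc) V E c w u) s = obtain_answer E V c u s"
  unfolding answer_from_parent_def obtain_answer_def transmitted_upcast message_def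
  by (auto simp: head_def split: option.split list.split)

text \<open>Replaces message passing by direct access to the neighbours' states. The round-by-round
  analysis argues about configurations only, through this equation.\<close>

lemma upcast_receive_eq:
  assumes "finite (neighbours E u)"
  shows "upcast_receive solve cc (view_of V E u) s (\<lambda>w. transmitted (upcast solve cc) V E c w u) =
    leader_computes solve cc (view_of V E u) (obtain_answer E V c u (gather E c u
      (update_tree (view_of V E u) (inbox_of E c u) s)))"
  unfolding upcast_receive_def Let_def inbox_list_upcast[OF assms] collect_items_upcast
    answer_from_parent_upcast ..

lemma leader_computes_child: "parent s \<noteq> None \<Longrightarrow> leader_computes solve cc vw s = s"
  and leader_computes_known: "known s \<noteq> None \<Longrightarrow> leader_computes solve cc vw s = s"
  by (auto simp: leader_computes_def)

lemma take_answer_fields [simp]: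
  "leader (take_answer vw a s) = leader s" "parent (take_answer vw a s) = parent s"
  "items (take_answer vw a s) = items s" "samples (take_answer vw a s) = samples s"
  by (auto simp: take_answer_def split: prod.split option.split)

lemma obtain_answer_fields [simp]:
  "leader (obtain_answer E V c u s) = leader s" "parent (obtain_answer E V c u s) = parent s"
  "items (obtain_answer E V c u s) = items s" "samples (obtain_answer E V c u s) = samples s"
  by (auto simp: obtain_answer_def split: option.split)

lemma gather_fields [simp]:
  "leader (gather E c u s) = leader s" "parent (gather E c u s) = parent s"
  "down (gather E c u s) = down s" "known (gather E c u s) = known s"
  "samples (gather E c u s) = samples s"
  by (simp_all add: gather_def)

lemma gather_no_senders: "senders E c (leader s) u = [] \<Longrightarrow> gather E c u s = s"
  by (simp add: gather_def)

lemma msg_leaders_inbox_of: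
  "finite (neighbours E u) \<Longrightarrow>
   (\<lambda>(w, m). msg_leader m) ` set (inbox_of E c u) = (\<lambda>w. leader (c w)) ` {w \<in> neighbours E u. active c w}"
  by (auto simp: inbox_of_def message_def image_iff)

lemma update_tree_stay:
  assumes "finite (neighbours E u)" "\<And>w. w \<in> neighbours E u \<Longrightarrow> leader s \<le> leader (c w)"
  shows "update_tree vw (inbox_of E c u) s =
    s\<lparr>items := (if parent s = None then items s else tl (items s)), down := (\<lambda>w. tl (down s w))\<rparr>"
proof -
  have "\<not> Min (insert (leader s) ((\<lambda>w. leader (c w)) ` {w \<in> neighbours E u. active c w})) < leader s"
    using assms by (auto simp: Min_less_iff not_less)
  then show ?thesis
    unfolding update_tree_def Let_def msg_leaders_inbox_of[OF assms(1)] by simp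
qed

text \<open>The inbox is sorted by sender, so among several neighbours announcing the new leader the
  smallest becomes the parent. This makes the tree a function of the graph.\<close>

lemma update_tree_join:
  assumes fin: "finite (neighbours E u)" and l: "l < leader s"
    and low: "\<And>w. w \<in> neighbours E u \<Longrightarrow> l \<le> leader (c w)"
    and ex: "\<exists>w\<in>neighbours E u. leader (c w) = l" and act: "\<And>w. w \<in> neighbours E u \<Longrightarrow> active c w"
  shows "update_tree vw (inbox_of E c u) s =
    s\<lparr>leader := l, parent := Some (Min {w \<in> neighbours E u. leader (c w) = l}),
      items := map (\<lambda>x. (self vw, x)) (samples s), route := Map.empty, down := (\<lambda>_. [])\<rparr>"
proof -
  have Min: "Min (insert (leader s) ((\<lambda>w. leader (c w)) ` {w \<in> neighbours E u. active c w})) = l"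
    using assms by (intro Min_eqI) (auto intro: less_imp_le)
  let ?ws = "sorted_list_of_set (neighbours E u)"
  let ?L = "{w \<in> neighbours E u. leader (c w) = l}"
  have "filter (\<lambda>(w, m). msg_leader m = l) (inbox_of E c u) =
      map (\<lambda>w. (w, message c w u)) (filter (\<lambda>w. leader (c w) = l) ?ws)"
    unfolding inbox_of_def filter_map filter_filter using act fin
    by (intro arg_cong[where f="map _"] filter_cong) (auto simp: message_def)
  moreover have "filter (\<lambda>w. leader (c w) = l) ?ws = sorted_list_of_set ?L"
    using fin by (intro sorted_distinct_set_unique) (auto intro: sorted_filter[where f=id, simplified])
  moreover have "?L \<noteq> {}" using ex by auto
  then have "sorted_list_of_set ?L \<noteq> []" "hd (sorted_list_of_set ?L) = Min ?L"
    using fin sorted_list_of_set_nonempty[of ?L] by auto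
  ultimately have "fst (hd (filter (\<lambda>(w, m). msg_leader m = l) (inbox_of E c u))) = Min ?L"
    by (simp add: hd_map)
  then show ?thesis
    unfolding update_tree_def Let_def msg_leaders_inbox_of[OF fin] Min using l by simp
qed

lemma active_if_unknown: "known (c w) = None \<Longrightarrow> active c w"
  by (simp add: active_def upcast_result_def)

lemma length_eq_sum_filter:
  assumes "finite A" "f ` set xs \<subseteq> A"
  shows "length xs = (\<Sum>y\<in>A. length (filter (\<lambda>i. f i = y) xs))"
  using assms(2)
proof (induction xs)
  case (Cons x xs)
  have "(\<Sum>y\<in>A. length (filter (\<lambda>i. f i = y) (x # xs))) =
      (\<Sum>y\<in>A. (if y = f x then 1 else 0) + length (filter (\<lambda>i. f i = y) xs))"
    by (intro sum.cong) auto
  also have "\<dots> = 1 + (\<Sum>y\<in>A. length (filter (\<lambda>i. f i = y) xs))"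
    using Cons.prems assms(1) by (simp add: sum.distrib)
  finally show ?case using Cons by simp
qed simp

section \<open>The answers read off a cycle\<close>

lemma map_fst_cycle_answers: "map fst (cycle_answers xs) = rotate1 xs"
  by (rule nth_equalityI) (auto simp: cycle_answers_def nth_rotate1)

text \<open>Edge \<open>l\<close> joins positions \<open>l\<close> and \<open>l + 1\<close> modulo
  the length. Answer \<open>i\<close> concerns the node at position \<open>i + 1\<close>, which lies
  on edges \<open>i\<close> and \<open>i + 1\<close> only; centring the answer there avoids a
  predecessor modulo the length.\<close>

lemma cycle_answer_edges:
  assumes d: "distinct xs" and n: "3 \<le> length xs" and a: "(u, x, y) \<in> set (cycle_answers xs)"
  shows "{{u, x}, {u, y}} = {e \<in> cycle_edges xs. u \<in> e}"
proof -
  let ?n = "length xs"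
  obtain i where i: "i < ?n" "u = xs ! (Suc i mod ?n)" "x = xs ! i" "y = xs ! (Suc (Suc i) mod ?n)"
    using a unfolding cycle_answers_def by auto
  define j where "j = Suc i mod ?n"
  have "0 < ?n" using n by linarith
  then have j: "j < ?n" "Suc (Suc i) mod ?n = Suc j mod ?n"
    unfolding j_def by (simp_all add: mod_Suc_eq)
  have inj: "xs ! a = xs ! b \<longleftrightarrow> a = b" if "a < ?n" "b < ?n" for a b
    using d that nth_eq_iff_index_eq by blast
  have suc: "Suc l mod ?n = Suc i mod ?n \<longleftrightarrow> l = i" if "l < ?n" for l
    using that i(1) by (auto simp: mod_Suc split: if_splits)
  have "{e \<in> cycle_edges xs. u \<in> e} = {{xs ! l, xs ! (Suc l mod ?n)} | l. l < ?n \<and> (l = j \<or> l = i)}"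
  proof -
    have "u \<in> {xs ! l, xs ! (Suc l mod ?n)} \<longleftrightarrow> l = j \<or> l = i" if l: "l < ?n" for l
    proof -
      have "u = xs ! l \<longleftrightarrow> l = j" using inj[OF j(1) l] i(2) unfolding j_def by auto
      moreover have "Suc l mod ?n < ?n" using \<open>0 < ?n\<close> by (rule mod_less_divisor)
      then have "u = xs ! (Suc l mod ?n) \<longleftrightarrow> l = i" using inj[OF j(1)] suc[OF l] i(2) unfolding j_def by metis
      ultimately show ?thesis by simp
    qed
    then show ?thesis unfolding cycle_edges_def by blast
  qed
  also have "\<dots> = {{xs ! j, xs ! (Suc j mod ?n)}, {xs ! i, xs ! (Suc i mod ?n)}}"
    using i(1) j(1) by blast
  also have "\<dots> = {{u, x}, {u, y}}"
    using i j unfolding j_def by (auto simp: insert_commute)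
  finally show ?thesis by simp
qed

section \<open>The two-level tree of a good run\<close>

locale good_upcast_run =
  fixes V :: "nat set" and E :: "nat set set" and \<omega> :: "nat \<Rightarrow> nat list" and D k :: nat
    and solve :: "nat set \<Rightarrow> nat set set \<Rightarrow> nat list option" and cc :: real
  assumes finV: "finite V" and E: "E \<subseteq> all_edges V" and card3: "3 \<le> card V"
    and deg: "\<And>u. u \<in> V \<Longrightarrow> card (neighbours E u) \<le> D"
    and ecc: "\<And>w. w \<in> V \<Longrightarrow> w \<noteq> Min V \<Longrightarrow> \<exists>x. {Min V, x} \<in> E \<and> {x, w} \<in> E"
    and len: "\<And>u. u \<in> V \<Longrightarrow> length (\<omega> u) = k"
    and nbr_samples: "\<And>u. u \<in> V \<Longrightarrow> set (\<omega> u) \<subseteq> neighbours E u" and k: "k = sample_count cc (card V)" "0 < k"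
    and solve: "ham_solver solve" and ham: "\<exists>xs. ham_cycle V (sampled_edges V \<omega>) xs"
begin

abbreviation "v \<equiv> Min V"
abbreviation "N \<equiv> neighbours E"
abbreviation "vw \<equiv> view_of V E"
abbreviation "cfg \<equiv> config (upcast solve cc) V E \<omega>"

definition L1 :: "nat set" where "L1 = N v"
definition L2 :: "nat set" where "L2 = V - {v} - L1"
text \<open>The minimum reproduces the protocol's choice among several neighbours announcing the
  leader.\<close>

definition par :: "nat \<Rightarrow> nat" where "par w = (if w \<in> L1 then v else Min (N w \<inter> L1))"
text \<open>The child of the root in whose subtree \<open>w\<close> lies. It is both the root's
  routing entry for \<open>w\<close> and the index of the root's queue holding the answer for
  \<open>w\<close>.\<close>

definition via :: "nat \<Rightarrow> nat" where "via w = (if w \<in> L1 then w else par w)"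
definition children :: "nat \<Rightarrow> nat set" where "children x = {w \<in> L2. par w = x}"
definition own :: "nat \<Rightarrow> (nat \<times> nat) list" where "own u = map (Pair u) (\<omega> u)"

text \<open>A round as a map on arbitrary configurations, so that the invariants below need not
  mention the time.\<close>

definition step :: "(nat \<Rightarrow> upcast_state) \<Rightarrow> nat \<Rightarrow> upcast_state" where
  "step c u = (if active c u then leader_computes solve cc (vw u) (obtain_answer E V c u (gather E c u
      (update_tree (vw u) (inbox_of E c u) (c u)))) else c u)"

lemma finN: "finite (N u)" and N_sub: "N u \<subseteq> V - {u}"
  using finite_neighbours[OF E finV] by auto

lemma cfg_Suc: "cfg (Suc t) = step (cfg t)"
proof
  fix u
  have res: "result (upcast solve cc) = upcast_result" and rec: "receive (upcast solve cc) = upcast_receive solve cc"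
    by (simp_all add: upcast_def)
  show "cfg (Suc t) u = step (cfg t) u"
    unfolding config.simps Let_def res rec step_def active_def using upcast_receive_eq[OF finN, of solve cc V u "cfg t u" "cfg t"]
    by simp
qed

lemma vV: "v \<in> V" and v_le: "u \<in> V \<Longrightarrow> v \<le> u"
proof -
  have "V \<noteq> {}" using card3 by auto
  then show "v \<in> V" using finV by (rule Min_in[OF _ , rotated])
  show "u \<in> V \<Longrightarrow> v \<le> u" using finV by simp
qed

lemma N_sym: "w \<in> N u \<longleftrightarrow> u \<in> N w"
  unfolding neighbours_def by (simp add: insert_commute)

lemma L1_sub: "L1 \<subseteq> V" "v \<notin> L1" and L2_sub: "L2 \<subseteq> V" "v \<notin> L2" "L1 \<inter> L2 = {}"
  using N_sub[of v] unfolding L1_def L2_def by auto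

lemma V_cases: "u \<in> V \<Longrightarrow> u = v \<or> u \<in> L1 \<or> u \<in> L2"
  unfolding L2_def by auto

lemma finL1: "finite L1" and finL2: "finite L2"
  using finite_subset[OF L1_sub(1) finV] finite_subset[OF L2_sub(1) finV] by auto

lemma par_L2: assumes "w \<in> L2" shows "par w \<in> N w" "par w \<in> L1"
proof -
  have "w \<in> V" "w \<noteq> v" "w \<notin> L1" using assms L2_sub L2_def by auto
  then obtain x where "{v, x} \<in> E" "{x, w} \<in> E" using ecc by blast
  then have "x \<in> N w \<inter> L1" unfolding L1_def neighbours_def by (auto simp: insert_commute)
  then have "Min (N w \<inter> L1) \<in> N w \<inter> L1" using finN by (intro Min_in) auto
  then show "par w \<in> N w" "par w \<in> L1" using \<open>w \<notin> L1\<close> unfolding par_def by auto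
qed

lemma par_L1: "w \<in> L1 \<Longrightarrow> par w = v" by (simp add: par_def)

lemma card_children: "x \<in> V \<Longrightarrow> card (children x) \<le> D" and fin_children: "finite (children x)"
proof -
  have "children x \<subseteq> N x" unfolding children_def using par_L2 N_sym by auto
  then show "x \<in> V \<Longrightarrow> card (children x) \<le> D" "finite (children x)"
    using card_mono[OF finN] deg[of x] finite_subset[OF _ finN] by (auto intro: order_trans)
qed

section \<open>The first round\<close>

lemma cfg_0: "cfg 0 u = \<lparr>samples = \<omega> u, leader = u, parent = None, items = [], route = Map.empty,
    down = (\<lambda>_. []), known = None\<rparr>"
  by (simp add: config.simps upcast_def upcast_start_def)

lemma all_collected_Nil: "items s = [] \<Longrightarrow> \<not> all_collected cc (vw u) s"
  using card3 by (simp add: all_collected_def)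

lemma leader_computes_Nil: "items s = [] \<Longrightarrow> leader_computes solve cc (vw u) s = s"
  using all_collected_Nil by (simp add: leader_computes_def)

text \<open>In the first round only the neighbours' own identifiers are heard. Neighbours of
  \<open>v\<close> thus join the final tree at once, while nodes at distance two may enter temporary
  trees, whose items carry another leader and never reach the tree of \<open>v\<close>.\<close>

lemma cfg_1:
  assumes u: "u \<in> V"
  shows "cfg (Suc 0) u = (if \<exists>w\<in>N u. w < u
    then \<lparr>samples = \<omega> u, leader = Min (N u), parent = Some (Min (N u)), items = own u, route = Map.empty,
      down = (\<lambda>_. []), known = None\<rparr>
    else cfg 0 u)"
proof -
  have act: "active (cfg 0) w" for w by (rule active_if_unknown) (simp add: cfg_0)
  have nos: "senders E (cfg 0) l u = []" for l by (simp add: senders_def cfg_0)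
  have ans: "obtain_answer E V (cfg 0) u s = s" for s
    by (simp add: obtain_answer_def cfg_0 split: option.split)
  have "cfg (Suc 0) u = leader_computes solve cc (vw u) (update_tree (vw u) (inbox_of E (cfg 0) u) (cfg 0 u))"
    using cfg_Suc[of 0] by (simp add: step_def act gather_no_senders nos ans)
  also have "\<dots> = (if \<exists>w\<in>N u. w < u
    then \<lparr>samples = \<omega> u, leader = Min (N u), parent = Some (Min (N u)), items = own u, route = Map.empty,
      down = (\<lambda>_. []), known = None\<rparr>
    else cfg 0 u)"
  proof (cases "\<exists>w\<in>N u. w < u")
    case True
    then obtain w where "w \<in> N u" "w < u" by blast
    then have ne: "N u \<noteq> {}" and lt: "Min (N u) < u" using Min_le[OF finN, of w u] by auto
    have "{w \<in> N u. w = Min (N u)} = {Min (N u)}" using Min_in[OF finN ne] by auto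
    then have "update_tree (vw u) (inbox_of E (cfg 0) u) (cfg 0 u) =
      \<lparr>samples = \<omega> u, leader = Min (N u), parent = Some (Min (N u)), items = own u, route = Map.empty,
      down = (\<lambda>_. []), known = None\<rparr>"
      using update_tree_join[OF finN, of "Min (N u)" "cfg 0 u" u "cfg 0" "vw u"] lt Min_in[OF finN ne] finN act
      by (simp add: cfg_0 own_def)
    then show ?thesis using True by (simp add: leader_computes_child)
  next
    case False
    then have "update_tree (vw u) (inbox_of E (cfg 0) u) (cfg 0 u) = cfg 0 u"
      using update_tree_stay[OF finN, of u "cfg 0 u" "cfg 0"] by (simp add: cfg_0 not_less)
    then show ?thesis using False leader_computes_Nil[of "cfg 0 u"] by (simp add: cfg_0)
  qed
  finally show ?thesis .
qed

lemma cfg_1_v: "cfg (Suc 0) v = cfg 0 v"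
  using cfg_1[OF vV] N_sub[of v] v_le by (auto simp: not_less[symmetric])

lemma cfg_1_L1:
  assumes "x \<in> L1"
  shows "cfg (Suc 0) x = \<lparr>samples = \<omega> x, leader = v, parent = Some v, items = own x, route = Map.empty,
      down = (\<lambda>_. []), known = None\<rparr>"
proof -
  have x: "x \<in> V" "x \<noteq> v" using assms L1_sub by auto
  have vx: "v \<in> N x" using assms N_sym unfolding L1_def by blast
  have "Min (N x) = v" using vx N_sub[of x] v_le finN by (intro Min_eqI) auto
  moreover have "v < x" using x v_le[of x] by simp
  ultimately show ?thesis using cfg_1[OF x(1)] vx by auto
qed

lemma cfg_1_L2:
  assumes "w \<in> L2"
  shows "samples (cfg (Suc 0) w) = \<omega> w" "v < leader (cfg (Suc 0) w)" "down (cfg (Suc 0) w) = (\<lambda>_. [])" "known (cfg (Suc 0) w) = None"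
proof -
  have w: "w \<in> V" "w \<noteq> v" "w \<notin> L1" using assms L2_sub L2_def by auto
  have "v < w" using w v_le[of w] by simp
  moreover have "v < Min (N w)" if "N w \<noteq> {}"
  proof -
    have "Min (N w) \<in> N w" using Min_in[OF finN that] .
    moreover have "v \<notin> N w" using w(3) N_sym unfolding L1_def by blast
    ultimately show ?thesis using N_sub[of w] v_le[of "Min (N w)"] by (metis DiffE le_neq_implies_less subsetD)
  qed
  ultimately show "samples (cfg (Suc 0) w) = \<omega> w" "v < leader (cfg (Suc 0) w)" "down (cfg (Suc 0) w) = (\<lambda>_. [])"
    "known (cfg (Suc 0) w) = None"
    using cfg_1[OF w(1)] by (auto simp: cfg_0)
qed

text \<open>A child appears in the routing table of its parent once its first item has arrived.\<close>

definition upcasting :: "(nat \<Rightarrow> upcast_state) \<Rightarrow> bool" where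
  "upcasting c \<longleftrightarrow>
     (\<forall>u\<in>V. leader (c u) = v \<and> known (c u) = None \<and> down (c u) = (\<lambda>_. [])) \<and>
     parent (c v) = None \<and> (\<forall>u\<in>V - {v}. parent (c u) = Some (par u)) \<and>
     (\<forall>w\<in>L2. route (c w) = Map.empty \<and> fst ` set (items (c w)) \<subseteq> {w} \<and> length (items (c w)) \<le> k) \<and>
     (\<forall>x\<in>L1. fst ` set (items (c x)) \<subseteq> insert x (children x) \<and>
        route (c x) = (\<lambda>o'. if o' \<in> children x \<and> length (items (c o')) < k then Some o' else None)) \<and>
     fst ` set (items (c v)) \<subseteq> V - {v} \<and>
     route (c v) = (\<lambda>o'. if o' \<in> fst ` set (items (c v)) then Some (via o') else None) \<and>
     (\<Sum>u\<in>V. mset (items (c u))) = (\<Sum>u\<in>V - {v}. mset (own u))"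

text \<open>The state before the local computation of a root. The invariant of the upcast phase is kept
  by \<open>pre\<close>, and \<open>step\<close> differs from \<open>pre\<close> only when the leader computes the cycle.\<close>

definition pre :: "(nat \<Rightarrow> upcast_state) \<Rightarrow> nat \<Rightarrow> upcast_state" where
  "pre c u = obtain_answer E V c u (gather E c u (update_tree (vw u) (inbox_of E c u) (c u)))"

lemma step_active: "active c u \<Longrightarrow> step c u = leader_computes solve cc (vw u) (pre c u)"
  by (simp add: step_def pre_def)

section \<open>The second round\<close>

lemma own_ne: "u \<in> V \<Longrightarrow> own u \<noteq> []"
  using len[of u] k by (auto simp: own_def)

lemma length_own: "u \<in> V \<Longrightarrow> length (own u) = k"
  using len[of u] by (simp add: own_def)

lemma fst_own: "fst ` set (own u) \<subseteq> {u}"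
  by (auto simp: own_def)

lemma sum_V: "(\<Sum>u\<in>V. f u) = f v + (\<Sum>u\<in>L1. f u) + (\<Sum>u\<in>L2. (f u :: 'a :: comm_monoid_add))"
proof -
  note fin = finL1 finL2
  have "V = insert v (L1 \<union> L2)" using V_cases L1_sub L2_sub vV by blast
  then have "(\<Sum>u\<in>V. f u) = (\<Sum>u\<in>insert v (L1 \<union> L2). f u)" by simp
  also have "\<dots> = f v + (\<Sum>u\<in>L1 \<union> L2. f u)" using fin L1_sub L2_sub by simp
  also have "(\<Sum>u\<in>L1 \<union> L2. f u) = (\<Sum>u\<in>L1. f u) + (\<Sum>u\<in>L2. f u)"
    using fin L2_sub by (intro sum.union_disjoint) auto
  finally show ?thesis by (simp add: add.assoc)
qed

lemma sum_V': "(\<Sum>u\<in>V - {v}. f u) = (\<Sum>u\<in>L1. f u) + (\<Sum>u\<in>L2. (f u :: 'a :: comm_monoid_add))"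
proof -
  note fin = finL1 finL2
  have "V - {v} = L1 \<union> L2" using V_cases L1_sub L2_sub by blast
  then show ?thesis using fin L2_sub by (simp add: sum.union_disjoint)
qed

lemma active_1: "u \<in> V \<Longrightarrow> active (cfg (Suc 0)) u"
  using V_cases[of u] cfg_1_v cfg_1_L1 cfg_1_L2 cfg_0 by (intro active_if_unknown) auto

lemma v_le_leader_1: "u \<in> V \<Longrightarrow> v \<le> leader (cfg (Suc 0) u)"
  using V_cases[of u] cfg_1_v cfg_1_L1[of u] cfg_1_L2(2)[of u] cfg_0[of v] by auto

lemma leader_1_eq: "u \<in> V \<Longrightarrow> leader (cfg (Suc 0) u) = v \<longleftrightarrow> u \<in> insert v L1"
  using V_cases[of u] L2_sub cfg_1_v cfg_1_L1[of u] cfg_1_L2(2)[of u] cfg_0[of v] by auto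

lemma senders_1:
  assumes u: "u \<in> V"
  shows "senders E (cfg (Suc 0)) v u = (if u = v then sorted_list_of_set L1 else [])"
proof -
  have "senders E (cfg (Suc 0)) v u = filter (\<lambda>w. u = v) (sorted_list_of_set (N u))"
    unfolding senders_def
  proof (intro filter_cong refl)
    fix w assume "w \<in> set (sorted_list_of_set (N u))"
    then have w: "w \<in> N u" "w \<in> V" using finN N_sub[of u] by auto
    show "(active (cfg (Suc 0)) w \<and> leader (cfg (Suc 0) w) = v \<and> parent (cfg (Suc 0) w) = Some u \<and> items (cfg (Suc 0) w) \<noteq> []) = (u = v)"
    proof (cases "w \<in> L1")
      case True
      then show ?thesis using active_1[OF w(2)] cfg_1_L1[OF True] own_ne[OF w(2)] by auto
    next
      case False
      then have "u \<noteq> v" using w(1) unfolding L1_def by auto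
      then show ?thesis using leader_1_eq[OF w(2)] False cfg_1_v cfg_0 by auto
    qed
  qed
  then show ?thesis by (auto simp: L1_def)
qed

lemma pre_1_v: "pre (cfg (Suc 0)) v = (cfg 0 v)\<lparr>items := map (\<lambda>x. hd (own x)) (sorted_list_of_set L1),
    route := map_of (map (\<lambda>w. (fst (hd (own w)), w)) (sorted_list_of_set L1))\<rparr>"
proof -
  have upd: "update_tree (vw v) (inbox_of E (cfg (Suc 0)) v) (cfg (Suc 0) v) = cfg 0 v"
    using update_tree_stay[OF finN, of v "cfg (Suc 0) v" "cfg (Suc 0)" "vw v"] v_le_leader_1 N_sub[of v]
    by (auto simp: cfg_1_v cfg_0)
  have s: "items (cfg (Suc 0) w) = own w" if "w \<in> set (sorted_list_of_set L1)" for w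
    using that cfg_1_L1 finL1 by auto
  show ?thesis unfolding pre_def upd
    using senders_1[OF vV] by (simp add: gather_def obtain_answer_def cfg_0 s cong: map_cong)
qed

lemma pre_1_L1:
  assumes x: "x \<in> L1"
  shows "pre (cfg (Suc 0)) x = (cfg (Suc 0) x)\<lparr>items := tl (own x)\<rparr>"
proof -
  have xV: "x \<in> V" "x \<noteq> v" using x L1_sub by auto
  have "leader (cfg (Suc 0) x) \<le> leader (cfg (Suc 0) w)" if "w \<in> N x" for w
    using that v_le_leader_1[of w] N_sub[of x] cfg_1_L1[OF x] by auto
  then have upd: "update_tree (vw x) (inbox_of E (cfg (Suc 0)) x) (cfg (Suc 0) x) = (cfg (Suc 0) x)\<lparr>items := tl (own x)\<rparr>"
    using update_tree_stay[OF finN, of x "cfg (Suc 0) x" "cfg (Suc 0)" "vw x"] by (simp add: cfg_1_L1[OF x])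
  show ?thesis unfolding pre_def upd
    using senders_1[OF xV(1)] xV(2) by (simp add: gather_def obtain_answer_def cfg_1_L1[OF x] cfg_1_v cfg_0)
qed

text \<open>Nodes at distance two still have leaders above \<open>v\<close>, so exactly the
  neighbours in \<open>L1\<close> announce \<open>v\<close> now. The node joins the final tree and
  starts over with a full queue, whatever it did in a temporary one.\<close>

lemma pre_1_L2:
  assumes w: "w \<in> L2"
  shows "pre (cfg (Suc 0)) w = (cfg (Suc 0) w)\<lparr>leader := v, parent := Some (par w), items := own w,
    route := Map.empty, down := (\<lambda>_. [])\<rparr>"
proof -
  have wV: "w \<in> V" "w \<noteq> v" "w \<notin> L1" using w L2_sub by auto
  have pw: "par w \<in> N w" "par w \<in> L1" using par_L2[OF w] .
  have "v \<notin> N w" using wV(3) N_sym unfolding L1_def by blast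
  then have L: "{x \<in> N w. leader (cfg (Suc 0) x) = v} = N w \<inter> L1"
    using leader_1_eq N_sub[of w] by blast
  have "update_tree (vw w) (inbox_of E (cfg (Suc 0)) w) (cfg (Suc 0) w) =
      (cfg (Suc 0) w)\<lparr>leader := v, parent := Some (Min {x \<in> N w. leader (cfg (Suc 0) x) = v}),
        items := map (\<lambda>x. (self (vw w), x)) (samples (cfg (Suc 0) w)), route := Map.empty, down := (\<lambda>_. [])\<rparr>"
  proof (rule update_tree_join[OF finN])
    show "v < leader (cfg (Suc 0) w)" using cfg_1_L2[OF w] by simp
    show "\<exists>x\<in>N w. leader (cfg (Suc 0) x) = v" using L pw by blast
    show "v \<le> leader (cfg (Suc 0) x)" "active (cfg (Suc 0)) x" if "x \<in> N w" for x
      using that N_sub[of w] v_le_leader_1[of x] active_1[of x] by auto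
  qed
  also have "\<dots> = (cfg (Suc 0) w)\<lparr>leader := v, parent := Some (par w), items := own w,
      route := Map.empty, down := (\<lambda>_. [])\<rparr>"
    unfolding L using wV(3) cfg_1_L2(1)[OF w] by (simp add: par_def own_def)
  finally have upd: "update_tree (vw w) (inbox_of E (cfg (Suc 0)) w) (cfg (Suc 0) w) = \<dots>" .
  show ?thesis unfolding pre_def upd
    using senders_1[OF wV(1)] wV(2) cfg_1_L1[OF pw(2)] by (simp add: gather_def obtain_answer_def)
qed

lemma upcasting_cong:
  assumes "upcasting c" "\<And>u. u \<in> V \<Longrightarrow> c' u = c u"
  shows "upcasting c'"
proof -
  have V: "\<And>u. u \<in> L1 \<Longrightarrow> u \<in> V" "\<And>u. u \<in> L2 \<Longrightarrow> u \<in> V" "\<And>u x. u \<in> children x \<Longrightarrow> u \<in> V" "v \<in> V"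
    using L1_sub L2_sub vV by (auto simp: children_def)
  have *: "(if o' \<in> children x \<and> length (items (c' o')) < k then Some o' else None) =
      (if o' \<in> children x \<and> length (items (c o')) < k then Some o' else None)" for x o'
    using assms(2) V(3) by auto
  show ?thesis using assms(1) unfolding upcasting_def * by (simp add: assms(2) V cong: sum.cong)
qed

lemma upcasting_start: "upcasting (pre (cfg (Suc 0)))"
proof -
  let ?c = "pre (cfg (Suc 0))"
  have L1V: "x \<in> V" if "x \<in> L1" for x using that L1_sub by auto
  have L2V: "x \<in> V" if "x \<in> L2" for x using that L2_sub by auto
  have hdown: "fst (hd (own x)) = x" if "x \<in> V" for x using own_ne[OF that] by (cases "\<omega> x") (auto simp: own_def)
  have iv: "fst ` set (items (?c v)) = L1"
    using hdown[OF L1V] finL1 by (simp add: pre_1_v image_image)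
  have rv: "route (?c v) = (\<lambda>o'. if o' \<in> fst ` set (items (?c v)) then Some (via o') else None)"
  proof -
    have "map_of (map (\<lambda>w. (fst (hd (own w)), w)) (sorted_list_of_set L1)) =
        (\<lambda>o'. if o' \<in> (\<lambda>w. fst (hd (own w))) ` set (sorted_list_of_set L1) then Some (via o') else None)"
      using finL1 hdown L1V by (intro map_of_inverse) (auto simp: via_def)
    moreover have "(\<lambda>w. fst (hd (own w))) ` set (sorted_list_of_set L1) = L1"
      using finL1 hdown[OF L1V] by simp
    ultimately show ?thesis unfolding iv by (simp add: pre_1_v)
  qed
  have sum: "(\<Sum>u\<in>V. mset (items (?c u))) = (\<Sum>u\<in>V - {v}. mset (own u))"
  proof -
    have "mset (items (?c v)) = (\<Sum>x\<in>L1. {#hd (own x)#})"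
      using mset_map_distinct[of "sorted_list_of_set L1" "\<lambda>x. hd (own x)"] finL1 by (simp add: pre_1_v)
    moreover have "(\<Sum>u\<in>L1. mset (items (?c u))) = (\<Sum>u\<in>L1. mset (tl (own u)))"
      by (intro sum.cong) (auto simp: pre_1_L1)
    ultimately have "mset (items (?c v)) + (\<Sum>u\<in>L1. mset (items (?c u))) =
        (\<Sum>x\<in>L1. {#hd (own x)#} + mset (tl (own x)))"
      by (simp only: sum.distrib)
    also have "\<dots> = (\<Sum>x\<in>L1. mset (own x))"
    proof (intro sum.cong refl)
      fix x assume "x \<in> L1"
      then have "own x \<noteq> []" using own_ne L1V by blast
      then show "{#hd (own x)#} + mset (tl (own x)) = mset (own x)" by (cases "own x") auto
    qed
    finally show ?thesis unfolding sum_V sum_V' by (simp add: pre_1_L2 cong: sum.cong)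
  qed
  have ch: "children x \<subseteq> L2" for x by (auto simp: children_def)
  have all: "leader (?c u) = v \<and> known (?c u) = None \<and> down (?c u) = (\<lambda>_. [])" if "u \<in> V" for u
    using V_cases[of u] that by (auto simp: pre_1_v pre_1_L1 pre_1_L2 cfg_1_L1 cfg_1_L2 cfg_0)
  have p: "parent (?c u) = Some (par u)" if "u \<in> V - {v}" for u
    using V_cases[of u] that by (auto simp: pre_1_v pre_1_L1 pre_1_L2 cfg_1_L1 cfg_0 par_L1)
  have l2: "route (?c w) = Map.empty \<and> fst ` set (items (?c w)) \<subseteq> {w} \<and> length (items (?c w)) \<le> k" if "w \<in> L2" for w
    using that fst_own[of w] length_own[OF L2V[OF that]] by (simp add: pre_1_L2)
  have l1: "fst ` set (items (?c x)) \<subseteq> insert x (children x) \<and>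
      route (?c x) = (\<lambda>o'. if o' \<in> children x \<and> length (items (?c o')) < k then Some o' else None)"
    if x: "x \<in> L1" for x
  proof -
    have "fst ` set (tl (own x)) \<subseteq> {x}" using fst_own[of x] set_tl_subset[of "own x"] by blast
    \<comment> \<open>The children have only just joined and hold all \<open>k\<close> items, so the
      empty table is what the invariant prescribes.\<close>
    moreover have "\<not> (o' \<in> children x \<and> length (items (?c o')) < k)" for o'
      using ch[of x] length_own[OF L2V] by (auto simp: pre_1_L2)
    then have "(\<lambda>o'. if o' \<in> children x \<and> length (items (?c o')) < k then Some o' else None) = Map.empty" by auto
    ultimately show ?thesis using x by (auto simp: pre_1_L1 cfg_1_L1)
  qed
  have pv: "parent (?c v) = None" by (simp add: pre_1_v cfg_0)
  show ?thesis unfolding upcasting_def using all pv p l2 l1 iv rv sum L1_sub by auto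
qed

section \<open>One round of the upcast phase\<close>

lemma senders_up:
  assumes up: "upcasting c" and u: "u \<in> V"
  shows "set (senders E c v u) = {w \<in> V - {v}. items (c w) \<noteq> [] \<and> par w = u}" "distinct (senders E c v u)"
proof -
  have act: "active c w" if "w \<in> V" for w
    using up that unfolding upcasting_def by (intro active_if_unknown) auto
  have ld: "leader (c w) = v" if "w \<in> V" for w using up that unfolding upcasting_def by auto
  have parN: "w \<in> N (par w)" if "w \<in> V - {v}" for w
  proof (cases "w \<in> L1")
    case True
    then show ?thesis using par_L1 by (simp add: L1_def)
  next
    case False
    then show ?thesis using that V_cases[of w] par_L2(1)[of w] N_sym by blast
  qed
  have pp: "parent (c w) = (if w = v then None else Some (par w))" if "w \<in> V" for w
    using up that unfolding upcasting_def by auto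
  show "set (senders E c v u) = {w \<in> V - {v}. items (c w) \<noteq> [] \<and> par w = u}"
  proof (intro set_eqI iffI)
    fix w assume "w \<in> set (senders E c v u)"
    then show "w \<in> {w \<in> V - {v}. items (c w) \<noteq> [] \<and> par w = u}"
      unfolding senders_def using finN[of u] N_sub[of u] pp[of w] by (auto split: if_splits)
  next
    fix w assume w: "w \<in> {w \<in> V - {v}. items (c w) \<noteq> [] \<and> par w = u}"
    then show "w \<in> set (senders E c v u)"
      unfolding senders_def using finN[of u] parN[of w] act[of w] ld[of w] pp[of w] by auto
  qed
  show "distinct (senders E c v u)" unfolding senders_def by simp
qed

lemma pre_up:
  assumes up: "upcasting c" and u: "u \<in> V"
  shows "pre c u = (c u)\<lparr>items := (if u = v then items (c u) else tl (items (c u))) @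
      map (\<lambda>w. hd (items (c w))) (senders E c v u),
    route := route (c u) ++ map_of (map (\<lambda>w. (fst (hd (items (c w))), w)) (senders E c v u))\<rparr>"
proof -
  have ld: "leader (c w) = v \<and> down (c w) = (\<lambda>_. [])" if "w \<in> V" for w
    using up that unfolding upcasting_def by auto
  have pp: "parent (c u) = (if u = v then None else Some (par u))"
    using up u unfolding upcasting_def by auto
  have pV: "par u \<in> V" if "u \<noteq> v"
    using V_cases[OF u] that par_L1[of u] par_L2(2)[of u] L1_sub vV by auto
  have upd: "update_tree (vw u) (inbox_of E c u) (c u) =
      (c u)\<lparr>items := (if u = v then items (c u) else tl (items (c u)))\<rparr>"
    using update_tree_stay[OF finN, of u "c u" c "vw u"] ld N_sub[of u] ld[OF u] pp
    by (auto simp: subset_iff)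
  show ?thesis unfolding pre_def upd
    using ld[OF u] pp pV ld[OF pV] by (simp add: gather_def obtain_answer_def)
qed

lemma upcasting_pre:
  assumes up: "upcasting c"
  shows "upcasting (pre c)"
proof -
  let ?c = "pre c"
  note S = senders_up[OF up]
  have L1V: "x \<in> V" "x \<noteq> v" if "x \<in> L1" for x using that L1_sub by auto
  have L2V: "x \<in> V" "x \<noteq> v" if "x \<in> L2" for x using that L2_sub by auto
  have V': "V - {v} = L1 \<union> L2" using V_cases L1_sub L2_sub by blast
  have parL1: "par w = v \<longleftrightarrow> w \<in> L1" if "w \<in> V - {v}" for w
    using that V' par_L1 par_L2 L1_sub(2) by (metis UnE)
  have SL2: "senders E c v w = []" if w: "w \<in> L2" for w
  proof -
    have "par z \<noteq> w" if "z \<in> V - {v}" for z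
      using that V' par_L1 par_L2[of z] L2V[OF w] L2_sub(3) w by (cases "z \<in> L1") auto
    then have "set (senders E c v w) = {}" using S(1)[OF L2V(1)[OF w]] by auto
    then show ?thesis by simp
  qed
  have SL1: "set (senders E c v x) = {w \<in> children x. items (c w) \<noteq> []}" if x: "x \<in> L1" for x
    using S(1)[OF L1V(1)[OF x]] par_L1 L1V(2)[OF x] V' by (auto simp: children_def)
  have Sv: "set (senders E c v v) = {w \<in> L1. items (c w) \<noteq> []}"
    using S(1)[OF vV] parL1 V' by auto
  have i2: "items (?c w) = tl (items (c w))" "route (?c w) = route (c w)" if "w \<in> L2" for w
    using pre_up[OF up L2V(1)[OF that]] L2V(2)[OF that] SL2[OF that] by auto
  have u2: "route (c w) = Map.empty" "fst ` set (items (c w)) \<subseteq> {w}" "length (items (c w)) \<le> k" if "w \<in> L2" for w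
    using up that unfolding upcasting_def by auto
  have hd2: "fst (hd (items (c w))) = w" if "w \<in> L2" "items (c w) \<noteq> []" for w
    using u2(2)[OF that(1)] hd_in_set[OF that(2)] by auto
  have u1: "fst ` set (items (c x)) \<subseteq> insert x (children x)"
    "route (c x) = (\<lambda>o'. if o' \<in> children x \<and> length (items (c o')) < k then Some o' else None)" if "x \<in> L1" for x
    using up that unfolding upcasting_def by auto
  \<comment> \<open>The queue of \<open>x\<close> holds only its own items and those of its
    children, and \<open>via\<close> maps all these origins to \<open>x\<close>. So a new entry at
    the root agrees with any earlier one for the same origin.\<close>
  have hd1: "via (fst (hd (items (c x)))) = x" "fst (hd (items (c x))) \<in> V - {v}" if x: "x \<in> L1" "items (c x) \<noteq> []" for x
  proof -
    have "fst (hd (items (c x))) \<in> insert x (children x)" using u1(1)[OF x(1)] hd_in_set[OF x(2)] by auto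
    then show "via (fst (hd (items (c x)))) = x" "fst (hd (items (c x))) \<in> V - {v}"
      using x(1) L2_sub L1V[OF x(1)] by (auto simp: via_def children_def)
  qed
  have all: "leader (?c u) = v \<and> known (?c u) = None \<and> down (?c u) = (\<lambda>_. [])" if "u \<in> V" for u
    using up that unfolding upcasting_def pre_up[OF up that] by simp
  have p: "parent (?c u) = parent (c u)" if "u \<in> V" for u
    unfolding pre_up[OF up that] by simp
  have l2: "route (?c w) = Map.empty \<and> fst ` set (items (?c w)) \<subseteq> {w} \<and> length (items (?c w)) \<le> k" if "w \<in> L2" for w
    using i2[OF that] u2[OF that] set_tl_subset[of "items (c w)"] by auto
  have l1: "fst ` set (items (?c x)) \<subseteq> insert x (children x) \<and>
      route (?c x) = (\<lambda>o'. if o' \<in> children x \<and> length (items (?c o')) < k then Some o' else None)"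
    if x: "x \<in> L1" for x
  proof -
    let ?S = "senders E c v x"
    have "fst ` set (tl (items (c x))) \<subseteq> insert x (children x)"
      using u1(1)[OF x] set_tl_subset[of "items (c x)"] by blast
    moreover have "(\<lambda>w. fst (hd (items (c w)))) ` set ?S = set ?S"
      using SL1[OF x] hd2 by (force simp: children_def)
    moreover have "map_of (map (\<lambda>w. (fst (hd (items (c w))), w)) ?S) =
        (\<lambda>o'. if o' \<in> (\<lambda>w. fst (hd (items (c w)))) ` set ?S then Some o' else None)"
      using SL1[OF x] hd2 by (intro map_of_inverse) (auto simp: children_def)
    \<comment> \<open>After this round every child has fewer than \<open>k\<close> items, so all
      children must be in the table. Those that send enter now if they are not there yet; a child
      that sends nothing has an empty queue, and since \<open>0 < k\<close> it is there
      already.\<close>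
    moreover have "length (items (?c w)) < k" if "w \<in> children x" for w
      using that i2[of w] u2(3)[of w] k(2) by (auto simp: children_def)
    moreover have "length (items (c w)) < k" if "w \<in> children x" "w \<notin> set ?S" for w
      using that SL1[OF x] k(2) by auto
    ultimately show ?thesis
      unfolding pre_up[OF up L1V(1)[OF x]] using L1V(2)[OF x] u1(2)[OF x] SL1[OF x]
      by (auto simp: fun_eq_iff map_add_def image_Un image_image)
  qed
  have uv: "fst ` set (items (c v)) \<subseteq> V - {v}"
    "route (c v) = (\<lambda>o'. if o' \<in> fst ` set (items (c v)) then Some (via o') else None)"
    using up unfolding upcasting_def by auto
  have iv: "fst ` set (items (?c v)) \<subseteq> V - {v} \<and>
      route (?c v) = (\<lambda>o'. if o' \<in> fst ` set (items (?c v)) then Some (via o') else None)"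
  proof -
    let ?S = "senders E c v v"
    have m: "map_of (map (\<lambda>w. (fst (hd (items (c w))), w)) ?S) =
        (\<lambda>o'. if o' \<in> (\<lambda>w. fst (hd (items (c w)))) ` set ?S then Some (via o') else None)"
      using Sv hd1 by (intro map_of_inverse) auto
    have "(\<lambda>w. fst (hd (items (c w)))) ` set ?S \<subseteq> V - {v}" using Sv hd1(2) by auto
    then show ?thesis
      unfolding pre_up[OF up vV] using uv m
      by (auto simp: fun_eq_iff map_add_def image_Un image_image)
  qed
  have sum: "(\<Sum>u\<in>V. mset (items (?c u))) = (\<Sum>u\<in>V - {v}. mset (own u))"
  proof -
    define W where "W = {w \<in> V - {v}. items (c w) \<noteq> []}"
    have "par ` W \<subseteq> V" unfolding W_def using V' par_L1 par_L2(2) vV L1_sub by auto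
    have eq: "mset (items (?c u)) = mset (if u = v then items (c u) else tl (items (c u))) +
        (\<Sum>w\<in>{w \<in> W. par w = u}. {#hd (items (c w))#})" if "u \<in> V" for u
    proof -
      have "set (senders E c v u) = {w \<in> W. par w = u}" using S(1)[OF that] unfolding W_def by auto
      then show ?thesis
        unfolding pre_up[OF up that] using mset_map_distinct[OF S(2)[OF that]] by simp
    qed
    have "(\<Sum>u\<in>V. mset (items (?c u))) = (\<Sum>u\<in>V. mset (if u = v then items (c u) else tl (items (c u)))) +
        (\<Sum>u\<in>V. \<Sum>w\<in>{w \<in> W. par w = u}. {#hd (items (c w))#})"
      by (simp only: sum.distrib[symmetric] eq cong: sum.cong)
    \<comment> \<open>Arriving items are regrouped from receivers to senders, so that each meets the
      queue it was removed from. This yields conservation.\<close>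
    also have "(\<Sum>u\<in>V. \<Sum>w\<in>{w \<in> W. par w = u}. {#hd (items (c w))#}) = (\<Sum>w\<in>W. {#hd (items (c w))#})"
      using finV \<open>par ` W \<subseteq> V\<close> by (intro sum.group) (auto simp: W_def)
    also have "\<dots> = (\<Sum>w\<in>V - {v}. if items (c w) \<noteq> [] then {#hd (items (c w))#} else {#})"
      unfolding W_def using finV by (intro sum.inter_filter) auto
    also have "(\<Sum>u\<in>V. mset (if u = v then items (c u) else tl (items (c u)))) =
        mset (items (c v)) + (\<Sum>u\<in>V - {v}. mset (tl (items (c u))))"
      using finV vV by (simp add: sum.remove[of V v])
    also have "mset (items (c v)) + (\<Sum>u\<in>V - {v}. mset (tl (items (c u)))) +
        (\<Sum>w\<in>V - {v}. if items (c w) \<noteq> [] then {#hd (items (c w))#} else {#}) =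
        mset (items (c v)) + (\<Sum>u\<in>V - {v}. mset (items (c u)))"
    proof -
      have "mset (tl (items (c u))) + (if items (c u) \<noteq> [] then {#hd (items (c u))#} else {#}) = mset (items (c u))" for u
        by (cases "items (c u)") auto
      then show ?thesis by (simp add: add.assoc sum.distrib[symmetric])
    qed
    also have "\<dots> = (\<Sum>u\<in>V. mset (items (c u)))" using finV vV by (simp add: sum.remove[of V v])
    also have "\<dots> = (\<Sum>u\<in>V - {v}. mset (own u))" using up unfolding upcasting_def by blast
    finally show ?thesis .
  qed
  have pa: "parent (c v) = None" "\<forall>u\<in>V - {v}. parent (c u) = Some (par u)" using up unfolding upcasting_def by auto
  show ?thesis unfolding upcasting_def using all p pa l2 l1 iv sum vV by auto
qed

text \<open>By conservation all queues together hold \<open>k\<close> items for each node other than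
  \<open>v\<close>. If the root counts \<open>k\<close> from every origin, it holds that total, and
  nothing remains elsewhere. Conversely, empty queues elsewhere put all samples at the root.\<close>

lemma collected_iff:
  assumes up: "upcasting c"
  shows "all_collected cc (vw v) (c v) \<longleftrightarrow> (\<forall>u\<in>V - {v}. items (c u) = [])"
    and "(\<forall>u\<in>V - {v}. items (c u) = []) \<Longrightarrow> fst ` set (items (c v)) = V - {v}"
    and "(\<forall>u\<in>V - {v}. items (c u) = []) \<Longrightarrow> (\<lambda>(u, x). {u, x}) ` set (items (c v)) = sampled_edges V \<omega>"
proof -
  let ?O = "fst ` set (items (c v))"
  have O: "?O \<subseteq> V - {v}" and tot: "(\<Sum>u\<in>V. mset (items (c u))) = (\<Sum>u\<in>V - {v}. mset (own u))"
    using up unfolding upcasting_def by auto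
  have split: "(\<Sum>u\<in>V. mset (items (c u))) = mset (items (c v)) + (\<Sum>u\<in>V - {v}. mset (items (c u)))"
    using finV vV by (simp add: sum.remove[of V v])
  have fwd: "\<forall>u\<in>V - {v}. items (c u) = []" if "all_collected cc (vw v) (c v)"
  proof -
    have len: "\<And>u. u \<in> ?O \<Longrightarrow> length (filter (\<lambda>i. fst i = u) (items (c v))) = k"
      and "card (insert v ?O) = card V" using that k unfolding all_collected_def by auto
    moreover have "insert v ?O \<subseteq> V" using O vV by auto
    ultimately have "insert v ?O = V" using card_subset_eq[OF finV] by blast
    then have OV: "?O = V - {v}" using O by auto
    have "length (items (c v)) = (\<Sum>u\<in>V - {v}. length (filter (\<lambda>i. fst i = u) (items (c v))))"
      using finV OV by (intro length_eq_sum_filter) auto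
    also have "\<dots> = (\<Sum>u\<in>V - {v}. k)" using len OV by (intro sum.cong) auto
    also have "\<dots> = (\<Sum>u\<in>V - {v}. length (own u))" using length_own by (intro sum.cong) auto
    also have "\<dots> = size (\<Sum>u\<in>V - {v}. mset (own u))" by simp
    also have "\<dots> = length (items (c v)) + (\<Sum>u\<in>V - {v}. length (items (c u)))"
      unfolding tot[symmetric] split by simp
    finally have "(\<Sum>u\<in>V - {v}. length (items (c u))) = 0" by simp
    then show ?thesis using finV by simp
  qed
  {
    assume emp: "\<forall>u\<in>V - {v}. items (c u) = []"
    have "(\<Sum>u\<in>V - {v}. mset (items (c u))) = (\<Sum>u\<in>V - {v}. {#})"
      using emp by (intro sum.cong) auto
    then have m: "mset (items (c v)) = (\<Sum>u\<in>V - {v}. mset (own u))"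
      using split tot by simp
    then have "set (items (c v)) = (\<Union>u\<in>V - {v}. set (own u))"
      using set_mset_sum[of "V - {v}" "\<lambda>u. mset (own u)"] finV by (metis (no_types, lifting)
          SUP_cong finite_Diff set_mset_mset)
    then show "?O = V - {v}" "(\<lambda>(u, x). {u, x}) ` set (items (c v)) = sampled_edges V \<omega>"
    proof -
      assume s: "set (items (c v)) = (\<Union>u\<in>V - {v}. set (own u))"
      have "fst ` set (own u) = {u}" if "u \<in> V" for u
        using own_ne[OF that] fst_own[of u] by (cases "own u") auto
      then show "?O = V - {v}" unfolding s image_UN by auto
      show "(\<lambda>(u, x). {u, x}) ` set (items (c v)) = sampled_edges V \<omega>"
        unfolding s sampled_edges_def own_def by (auto simp: image_iff)
    qed
    have "length (filter (\<lambda>i. fst i = w) (items (c v))) = k" if w: "w \<in> V - {v}" for w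
    proof -
      have fo: "filter_mset (\<lambda>i. fst i = w) (mset (own u)) = (if u = w then mset (own u) else {#})" for u
        by (auto simp: own_def filter_mset_eq_conv)
      have "length (filter (\<lambda>i. fst i = w) (items (c v))) = size (filter_mset (\<lambda>i. fst i = w) (mset (items (c v))))"
        by (metis mset_filter size_mset)
      also have "filter_mset (\<lambda>i. fst i = w) (mset (items (c v))) =
          (\<Sum>u\<in>V - {v}. filter_mset (\<lambda>i. fst i = w) (mset (own u)))"
        unfolding m using finite_Diff[OF finV]
        by (induction rule: finite_induct) auto
      also have "\<dots> = mset (own w)" unfolding fo using finV w by (simp add: sum.delta)
      finally show ?thesis using length_own[of w] w by simp
    qed
    then have "all_collected cc (vw v) (c v)"
      unfolding all_collected_def using \<open>?O = V - {v}\<close> vV finV k by (auto simp: insert_absorb)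
  }
  then show "all_collected cc (vw v) (c v) \<longleftrightarrow> (\<forall>u\<in>V - {v}. items (c u) = [])" using fwd by blast
qed

text \<open>The local computation never fires at a node with a parent, and at the root it does not
  fire before all other queues are empty. Until then a round is just \<open>pre\<close>.\<close>

lemma step_upcasting:
  assumes act: "\<And>u. u \<in> V \<Longrightarrow> active c u" and up: "upcasting (pre c)"
  shows "u \<in> V - {v} \<Longrightarrow> step c u = pre c u"
    and "\<not> (\<forall>u\<in>V - {v}. items (pre c u) = []) \<Longrightarrow> u \<in> V \<Longrightarrow> step c u = pre c u"
proof -
  have par: "parent (pre c u) \<noteq> None" if "u \<in> V - {v}" for u
    using up that unfolding upcasting_def by auto
  then show *: "step c u = pre c u" if "u \<in> V - {v}" for u
    using that step_active[OF act, of u] leader_computes_child by auto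
  assume "\<not> (\<forall>u\<in>V - {v}. items (pre c u) = [])" "u \<in> V"
  then show "step c u = pre c u"
    using * step_active[OF act[OF vV]] collected_iff(1)[OF up] by (cases "u = v") (auto simp: leader_computes_def)
qed

lemma active_upcasting: "upcasting c \<Longrightarrow> u \<in> V \<Longrightarrow> active c u"
  unfolding upcasting_def by (intro active_if_unknown) auto

text \<open>A node at depth two sends one item per round and is empty after \<open>k\<close> rounds.
  Meanwhile a node at depth one gains at most \<open>D\<close> items per round, so it never holds
  more than \<open>k + k * D\<close>; afterwards nothing arrives and its queue shrinks by one per
  round. The hypothesis says that the leader has not computed yet.\<close>

lemma upcast_phase:
  assumes "\<And>i. i < j \<Longrightarrow> \<not> (\<forall>u\<in>V - {v}. items (pre (cfg (Suc i)) u) = [])"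
  shows "upcasting (pre (cfg (Suc j))) \<and> (\<forall>u\<in>V. active (cfg (Suc j)) u) \<and>
    (\<forall>w\<in>L2. length (items (pre (cfg (Suc j)) w)) = k - j) \<and>
    (\<forall>x\<in>L1. length (items (pre (cfg (Suc j)) x)) \<le> (if j \<le> k then k + j * D else k + k * D - (j - k)))"
  using assms
proof (induction j)
  case 0
  have "length (items (pre (cfg (Suc 0)) w)) = k" if "w \<in> L2" for w
    using that L2_sub length_own[of w] by (auto simp: pre_1_L2)
  moreover have "length (items (pre (cfg (Suc 0)) x)) \<le> k" if "x \<in> L1" for x
    using that L1_sub length_own[of x] by (auto simp: pre_1_L1)
  ultimately show ?case using upcasting_start active_1 by auto
next
  case (Suc j)
  let ?P = "pre (cfg (Suc j))" and ?c = "cfg (Suc (Suc j))"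
  have IH: "upcasting ?P" "\<And>u. u \<in> V \<Longrightarrow> active (cfg (Suc j)) u" "\<And>w. w \<in> L2 \<Longrightarrow> length (items (?P w)) = k - j"
    "\<And>x. x \<in> L1 \<Longrightarrow> length (items (?P x)) \<le> (if j \<le> k then k + j * D else k + k * D - (j - k))"
    using Suc.IH Suc.prems by auto
  have eq: "?c u = ?P u" if "u \<in> V" for u
    unfolding cfg_Suc[of "Suc j"] using step_upcasting(2)[OF IH(2,1) Suc.prems[of j]] that by auto
  have up: "upcasting ?c" using upcasting_cong[OF IH(1)] eq by blast
  have L2': "length (items (pre ?c w)) = k - Suc j" if w: "w \<in> L2" for w
  proof -
    have wV: "w \<in> V" "w \<noteq> v" using w L2_sub by auto
    have "par z \<noteq> w" if "z \<in> V - {v}" for z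
      using that V_cases[of z] par_L1[of z] par_L2(2)[of z] wV(2) L2_sub(3) w by auto
    then have "set (senders E ?c v w) = {}" using senders_up(1)[OF up wV(1)] by auto
    then show ?thesis using pre_up[OF up wV(1)] wV(2) IH(3)[OF w] eq[OF wV(1)] by simp
  qed
  have L1': "length (items (pre ?c x)) \<le> (if Suc j \<le> k then k + Suc j * D else k + k * D - (Suc j - k))"
    if x: "x \<in> L1" for x
  proof -
    have xV: "x \<in> V" "x \<noteq> v" using x L1_sub by auto
    let ?S = "senders E ?c v x"
    have S: "set ?S \<subseteq> children x"
      using senders_up(1)[OF up xV(1)] V_cases par_L1 xV(2) by (auto simp: children_def)
    have lenS: "length ?S \<le> D"
      using distinct_card[OF senders_up(2)[OF up xV(1)]] card_mono[OF fin_children S] card_children[OF xV(1)] by simp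
    have it: "length (items (pre ?c x)) = length (items (?P x)) - 1 + length ?S"
      using pre_up[OF up xV(1)] xV(2) eq[OF xV(1)] by simp
    show ?thesis
    proof (cases "Suc j \<le> k")
      case True
      then show ?thesis using it lenS IH(4)[OF x] by simp
    next
      case False
      then have jk: "k \<le> j" by simp
      have "items (?c w) = []" if "w \<in> children x" for w
        using that IH(3)[of w] jk eq[of w] L2_sub by (auto simp: children_def)
      moreover have "items (?c w) \<noteq> []" "w \<in> children x" if "w \<in> set ?S" for w
        using that S senders_up(1)[OF up xV(1)] by auto
      ultimately have "set ?S = {}" by (meson equals0I)
      then have "length ?S = 0" by simp
      moreover have "length (items (?P x)) \<le> k + k * D - (j - k)"
        using IH(4)[OF x] jk by (auto split: if_splits)
      ultimately show ?thesis using it jk by simp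
    qed
  qed
  show ?case using upcasting_pre[OF up] L2' L1' active_upcasting[OF up] by blast
qed

lemma all_items_arrive:
  obtains j where "j \<le> 2 * k + k * D" "upcasting (pre (cfg (Suc j)))" "\<And>u. u \<in> V \<Longrightarrow> active (cfg (Suc j)) u"
    "\<forall>u\<in>V - {v}. items (pre (cfg (Suc j)) u) = []"
proof -
  define Q where "Q j \<longleftrightarrow> (\<forall>u\<in>V - {v}. items (pre (cfg (Suc j)) u) = [])" for j
  \<comment> \<open>\<open>k\<close> rounds to empty depth two, then \<open>k + k * D\<close> rounds
    to empty the longest possible queue at depth one.\<close>
  define J where "J = 2 * k + k * D"
  have "\<exists>j\<le>J. Q j"
  proof (rule ccontr)
    assume "\<not> (\<exists>j\<le>J. Q j)"
    then have nQ: "\<not> Q j" if "j \<le> J" for j using that by blast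
    then have ph: "(\<forall>w\<in>L2. length (items (pre (cfg (Suc J)) w)) = k - J) \<and>
        (\<forall>x\<in>L1. length (items (pre (cfg (Suc J)) x)) \<le> (if J \<le> k then k + J * D else k + k * D - (J - k)))"
      using upcast_phase[of J] unfolding Q_def by auto
    have "\<not> J \<le> k" "k + k * D - (J - k) = 0" "k - J = 0" unfolding J_def using k(2) by auto
    then have "items (pre (cfg (Suc J)) u) = []" if "u \<in> V - {v}" for u
      using ph that V_cases[of u] by auto
    then have "Q J" unfolding Q_def by blast
    then show False using nQ by blast
  qed
  \<comment> \<open>The first such round is taken because the description of the phase is valid only
    while no earlier round has triggered the computation.\<close>
  then have "Q (LEAST j. Q j)" "(LEAST j. Q j) \<le> J" by (auto intro: LeastI order_trans[OF Least_le])
  moreover have "\<not> Q i" if "i < (LEAST j. Q j)" for i using not_less_Least[OF that] .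
  ultimately show ?thesis
    using that[of "LEAST j. Q j"] upcast_phase[of "LEAST j. Q j"] unfolding Q_def J_def by blast
qed

section \<open>The start of the downcast\<close>

lemma fold_take_answer:
  assumes "distinct (map fst As)" "\<And>u. u \<in> fst ` set As \<Longrightarrow> u \<noteq> v \<Longrightarrow> route s u = Some (via u)"
    and "\<And>u x y. (u, x, y) \<in> set As \<Longrightarrow> {{u, x}, {u, y}} = ed u"
  defines "s' \<equiv> fold (take_answer (vw v)) As s"
  shows "leader s' = leader s" "parent s' = parent s" "items s' = items s"
    "known s' = (if v \<in> fst ` set As then Some (ed v) else known s)"
    "route s' = (\<lambda>u. if u \<in> fst ` set As \<and> u \<noteq> v then None else route s u)"
    "down s' = (\<lambda>w. down s w @ filter (\<lambda>a. fst a \<noteq> v \<and> via (fst a) = w) As)"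
proof -
  have "leader s' = leader s \<and> parent s' = parent s \<and> items s' = items s \<and>
    known s' = (if v \<in> fst ` set As then Some (ed v) else known s) \<and>
    route s' = (\<lambda>u. if u \<in> fst ` set As \<and> u \<noteq> v then None else route s u) \<and>
    down s' = (\<lambda>w. down s w @ filter (\<lambda>a. fst a \<noteq> v \<and> via (fst a) = w) As)"
    using assms(1-3) unfolding s'_def
  proof (induction As arbitrary: s)
    case (Cons a As)
    obtain u x y where a: "a = (u, x, y)" by (cases a) auto
    have ed: "{{u, x}, {u, y}} = ed u" using Cons.prems(3) a by simp
    let ?t = "take_answer (vw v) a s"
    have t: "known ?t = (if u = v then Some (ed v) else known s)"
      "route ?t = (if u = v then route s else (route s)(u := None))"
      "down ?t = (if u = v then down s else (down s)(via u := down s (via u) @ [a]))"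
      using Cons.prems(2)[of u] a ed by (auto simp: take_answer_def)
    \<comment> \<open>Taking an answer deletes the route to its addressee. As addressees are
      distinct, the routes for the later answers are intact.\<close>
    have u: "u \<notin> fst ` set As" using Cons.prems(1) a by simp
    have rt: "route ?t w = Some (via w)" if "w \<in> fst ` set As" "w \<noteq> v" for w
      using that u Cons.prems(2)[of w] t(2) by auto
    have IH: "leader (fold (take_answer (vw v)) As ?t) = leader ?t \<and>
      parent (fold (take_answer (vw v)) As ?t) = parent ?t \<and> items (fold (take_answer (vw v)) As ?t) = items ?t \<and>
      known (fold (take_answer (vw v)) As ?t) = (if v \<in> fst ` set As then Some (ed v) else known ?t) \<and>
      route (fold (take_answer (vw v)) As ?t) = (\<lambda>u. if u \<in> fst ` set As \<and> u \<noteq> v then None else route ?t u) \<and>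
      down (fold (take_answer (vw v)) As ?t) =
        (\<lambda>w. down ?t w @ filter (\<lambda>a. fst a \<noteq> v \<and> via (fst a) = w) As)"
      using Cons.prems(1,3) rt by (intro Cons.IH) auto
    show ?case using IH t u a by (auto simp: fun_eq_iff)
  qed auto
  then show "leader s' = leader s" "parent s' = parent s" "items s' = items s"
    "known s' = (if v \<in> fst ` set As then Some (ed v) else known s)"
    "route s' = (\<lambda>u. if u \<in> fst ` set As \<and> u \<noteq> v then None else route s u)"
    "down s' = (\<lambda>w. down s w @ filter (\<lambda>a. fst a \<noteq> v \<and> via (fst a) = w) As)" by auto
qed

definition pending :: "(nat \<Rightarrow> upcast_state) \<Rightarrow> nat set" where
  "pending c = {u \<in> V - {v}. u \<in> fst ` set (down (c v) (via u))}"

text \<open>The answer for a node at depth two is in one of three places: a queue of the root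
  (\<open>pending\<close>), the queue of its parent, or delivered. Queues at depth one have length
  at most one, since a node receives at most one answer per round and passes it on in the next.
  Routes exist exactly for the children still pending, so halting does not come too early.\<close>

definition downcasting ::
  "(nat \<times> nat \<times> nat) list \<Rightarrow> (nat \<Rightarrow> nat set set) \<Rightarrow> (nat \<Rightarrow> upcast_state) \<Rightarrow> bool" where
  "downcasting As ed c \<longleftrightarrow>
     (\<forall>u\<in>V. leader (c u) = v) \<and> parent (c v) = None \<and>
     (\<forall>u\<in>V - {v}. parent (c u) = Some (par u) \<and> items (c u) = []) \<and>
     known (c v) = Some (ed v) \<and> route (c v) = Map.empty \<and>
     (\<forall>x. distinct (map fst (down (c v) x)) \<and>
        set (down (c v) x) \<subseteq> {a \<in> set As. fst a \<in> V - {v} \<and> via (fst a) = x}) \<and>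
     (\<forall>x\<in>L1. known (c x) = (if x \<in> pending c then None else Some (ed x)) \<and>
        route (c x) = (\<lambda>u. if u \<in> children x \<and> u \<in> pending c then Some u else None) \<and>
        (\<forall>u. down (c x) u = [] \<or>
          (\<exists>a\<in>set As. down (c x) u = [a] \<and> fst a = u \<and> u \<in> children x \<and> u \<notin> pending c))) \<and>
     (\<forall>w\<in>L2. route (c w) = Map.empty \<and> down (c w) = (\<lambda>_. []) \<and>
        known (c w) = (if w \<in> pending c \<or> down (c (par w)) w \<noteq> [] then None else Some (ed w)))"

text \<open>All queues below the root are empty, hence shorter than \<open>k\<close>, so every child
  is in its parent's table and the root knows a route to every other node. All answers but the
  root's own become pending.\<close>

lemma downcast_start:
  assumes up: "upcasting (pre c)" and act: "\<And>u. u \<in> V \<Longrightarrow> active c u"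
    and emp: "\<forall>u\<in>V - {v}. items (pre c u) = []"
  obtains xs where "ham_cycle V (sampled_edges V \<omega>) xs"
    "downcasting (cycle_answers xs) (\<lambda>u. {e \<in> cycle_edges xs. u \<in> e}) (step c)"
proof -
  note col = collected_iff[OF up]
  have O: "fst ` set (items (pre c v)) = V - {v}"
    and ed: "(\<lambda>(u, x). {u, x}) ` set (items (pre c v)) = sampled_edges V \<omega>"
    using col(2,3) emp by auto
  have OV: "insert v (fst ` set (items (pre c v))) = V" using O vV by auto
  obtain xs where xs: "solve V (sampled_edges V \<omega>) = Some xs" "ham_cycle V (sampled_edges V \<omega>) xs"
    using solve ham unfolding ham_solver_def by (metis (mono_tags, lifting) option.case_eq_if option.collapse)
  define As where "As = cycle_answers xs"
  define e where "e u = {e \<in> cycle_edges xs. u \<in> e}" for u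
  have ux: "parent (pre c v) = None" "known (pre c v) = None"
    "route (pre c v) = (\<lambda>u. if u \<in> V - {v} then Some (via u) else None)" "down (pre c v) = (\<lambda>_. [])" "leader (pre c v) = v"
    using up O vV unfolding upcasting_def by auto
  have sv: "step c v = fold (take_answer (vw v)) As (pre c v)"
    using step_active[OF act[OF vV]] col(1) emp ux xs(1) OV ed by (simp add: leader_computes_def As_def)
  have As: "distinct (map fst As)" "fst ` set As = V"
    using xs(2) map_fst_cycle_answers[of xs] unfolding As_def ham_cycle_def
    by (auto simp flip: set_map)
  have "route (pre c v) u = Some (via u)" if "u \<in> fst ` set As" "u \<noteq> v" for u
    using that ux(3) As(2) by auto
  moreover have "{{u, x}, {u, y}} = e u" if "(u, x, y) \<in> set As" for u x y
    using that cycle_answer_edges[of xs u x y] xs(2) unfolding As_def e_def ham_cycle_def by auto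
  ultimately have f: "leader (step c v) = v" "parent (step c v) = None" "known (step c v) = Some (e v)"
    "route (step c v) = Map.empty"
    "down (step c v) = (\<lambda>w. filter (\<lambda>a. fst a \<noteq> v \<and> via (fst a) = w) As)"
    using fold_take_answer[OF As(1), of "pre c v" e] ux As(2) vV unfolding sv by (auto simp: fun_eq_iff)
  have st: "step c u = pre c u" if "u \<in> V - {v}" for u using step_upcasting(1)[OF act up that] .
  have pend: "pending (step c) = V - {v}"
    unfolding pending_def f(5) using As(2) by (fastforce simp: image_iff)
  have L: "x \<in> V - {v}" if "x \<in> L1 \<or> x \<in> L2" for x using that L1_sub L2_sub by auto
  have L1': "known (step c x) = (if x \<in> pending (step c) then None else Some (e x)) \<and>
        route (step c x) = (\<lambda>u. if u \<in> children x \<and> u \<in> pending (step c) then Some u else None) \<and>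
        (\<forall>u. down (step c x) u = [])" if x: "x \<in> L1" for x
  proof -
    have "route (pre c x) = (\<lambda>u. if u \<in> children x \<and> length (items (pre c u)) < k then Some u else None)"
      using up x unfolding upcasting_def by auto
    moreover have "items (pre c u) = []" "u \<in> V - {v}" if "u \<in> children x" for u
      using that emp L by (auto simp: children_def)
    ultimately have "route (pre c x) = (\<lambda>u. if u \<in> children x \<and> u \<in> V - {v} then Some u else None)"
      using k(2) by (auto simp: fun_eq_iff)
    then show ?thesis using up x L[of x] unfolding st[OF L[OF disjI1[OF x]]] pend upcasting_def by auto
  qed
  have L2': "route (step c w) = Map.empty \<and> down (step c w) = (\<lambda>_. []) \<and> known (step c w) = None" if w: "w \<in> L2" for w
    using up w L[of w] unfolding st[OF L[OF disjI2[OF w]]] upcasting_def by auto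
  have "downcasting As e (step c)"
    unfolding downcasting_def
  proof (intro conjI)
    show "\<forall>u\<in>V. leader (step c u) = v" using f(1) st up unfolding upcasting_def by (metis DiffI singletonD)
    show "\<forall>u\<in>V - {v}. parent (step c u) = Some (par u) \<and> items (step c u) = []"
      using st up emp unfolding upcasting_def by simp
    show "\<forall>x. distinct (map fst (down (step c v) x)) \<and>
        set (down (step c v) x) \<subseteq> {a \<in> set As. fst a \<in> V - {v} \<and> via (fst a) = x}"
      unfolding f(5) using As by (auto simp: distinct_map_filter)
    show "\<forall>w\<in>L2. route (step c w) = Map.empty \<and> down (step c w) = (\<lambda>_. []) \<and>
        known (step c w) = (if w \<in> pending (step c) \<or> down (step c (par w)) w \<noteq> [] then None else Some (e w))"
      using L2' L unfolding pend by auto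
  qed (use f L1' in auto)
  then show ?thesis using that xs(2) unfolding As_def e_def by blast
qed

text \<open>A halted node neither sends nor receives, so the invariant must survive its silence: it
  has nothing left to send, and below it is shown that nothing is on its way to it.\<close>

lemma down_Nil_if_halted: "\<not> active c u \<Longrightarrow> down (c u) w = [] \<and> route (c u) = Map.empty \<and> known (c u) \<noteq> None"
  unfolding active_def upcast_result_def by (auto split: if_splits)

context
  fixes As ed c
  assumes dc: "downcasting As ed c"
    and ed: "\<And>u x y. (u, x, y) \<in> set As \<Longrightarrow> {{u, x}, {u, y}} = ed u"
begin

lemma dc_v: "leader (c v) = v" "parent (c v) = None" "known (c v) = Some (ed v)" "route (c v) = Map.empty"
    "distinct (map fst (down (c v) x))" "set (down (c v) x) \<subseteq> {a \<in> set As. fst a \<in> V - {v} \<and> via (fst a) = x}"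
  using dc vV unfolding downcasting_def by auto

lemma dc_L1: assumes "x \<in> L1"
  shows "leader (c x) = v" "parent (c x) = Some v" "items (c x) = []"
    "known (c x) = (if x \<in> pending c then None else Some (ed x))"
    "route (c x) = (\<lambda>u. if u \<in> children x \<and> u \<in> pending c then Some u else None)"
    "down (c x) u = [] \<or> (\<exists>a\<in>set As. down (c x) u = [a] \<and> fst a = u \<and> u \<in> children x \<and> u \<notin> pending c)"
proof -
  have xV: "x \<in> V - {v}" using assms L1_sub by blast
  have "parent (c x) = Some (par x) \<and> items (c x) = []" using dc xV unfolding downcasting_def by blast
  then show "parent (c x) = Some v" "items (c x) = []" using par_L1[OF assms] by auto
qed (use dc assms L1_sub in \<open>auto simp: downcasting_def\<close>)

lemma dc_L2: assumes "w \<in> L2"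
  shows "leader (c w) = v" "parent (c w) = Some (par w)" "items (c w) = []" "route (c w) = Map.empty"
    "down (c w) = (\<lambda>_. [])"
    "known (c w) = (if w \<in> pending c \<or> down (c (par w)) w \<noteq> [] then None else Some (ed w))"
  using dc assms L2_sub unfolding downcasting_def by auto

lemma dc_no_senders: "u \<in> V \<Longrightarrow> senders E c v u = []"
proof -
  assume "u \<in> V"
  have "\<not> (parent (c w) = Some u \<and> items (c w) \<noteq> [])" if "w \<in> V" for w
    using dc that unfolding downcasting_def by (cases "w = v") auto
  then show ?thesis using N_sub[of u] finN[of u] unfolding senders_def by (auto simp: filter_empty_conv)
qed

text \<open>With all items delivered and all leaders equal, a round only pops the queues and takes
  at most one answer; the root does not compute again because its own answer is known.\<close>

lemma dc_step:
  assumes u: "u \<in> V" and act: "active c u"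
  shows "step c u = obtain_answer E V c u ((c u)\<lparr>items := items (c u), down := (\<lambda>w. tl (down (c u) w))\<rparr>)"
proof -
  have ld: "leader (c w) = v" if "w \<in> V" for w using dc that unfolding downcasting_def by auto
  have "(if parent (c u) = None then items (c u) else tl (items (c u))) = items (c u)"
    using dc u unfolding downcasting_def by (cases "u = v") auto
  then have upd: "update_tree (vw u) (inbox_of E c u) (c u) =
      (c u)\<lparr>items := items (c u), down := (\<lambda>w. tl (down (c u) w))\<rparr>"
    using update_tree_stay[OF finN, of u "c u" c "vw u"] ld N_sub[of u] ld[OF u] by (auto simp: subset_iff)
  have pre: "pre c u = obtain_answer E V c u ((c u)\<lparr>items := items (c u), down := (\<lambda>w. tl (down (c u) w))\<rparr>)"
    unfolding pre_def upd using dc_no_senders[OF u] ld[OF u] by (simp add: gather_no_senders)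
  show ?thesis
  proof (cases "u = v")
    case True
    have "pre c u = (c u)\<lparr>items := items (c u), down := (\<lambda>w. tl (down (c u) w))\<rparr>"
      unfolding pre using True dc_v(2) by (simp add: obtain_answer_def)
    then have "known (pre c u) \<noteq> None" using True dc_v(3) by simp
    then show ?thesis using step_active[OF act] leader_computes_known pre by simp
  next
    case False
    then have "parent (pre c u) \<noteq> None" unfolding pre using dc u unfolding downcasting_def by auto
    then show ?thesis using step_active[OF act] leader_computes_child pre by simp
  qed
qed

lemma dc_step_v:
  "leader (step c v) = v" "parent (step c v) = None" "known (step c v) = Some (ed v)" "route (step c v) = Map.empty"
  "down (step c v) = (\<lambda>x. tl (down (c v) x))"
proof -
  have "leader (step c v) = v \<and> parent (step c v) = None \<and> known (step c v) = Some (ed v) \<and>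
    route (step c v) = Map.empty \<and> down (step c v) = (\<lambda>x. tl (down (c v) x))"
  proof (cases "active c v")
    case True
    then show ?thesis using dc_step[OF vV True] dc_v by (simp add: obtain_answer_def)
  next
    case False
    then have "step c v = c v" by (simp add: step_def)
    then show ?thesis using down_Nil_if_halted[OF False] dc_v by (auto simp: fun_eq_iff)
  qed
  then show "leader (step c v) = v" "parent (step c v) = None" "known (step c v) = Some (ed v)"
    "route (step c v) = Map.empty" "down (step c v) = (\<lambda>x. tl (down (c v) x))" by auto
qed

lemma via_cases: "u \<in> V - {v} \<Longrightarrow> via u = x \<Longrightarrow> x \<in> L1 \<and> (u = x \<or> u \<in> children x)"
  using V_cases[of u] par_L2(2)[of u] by (auto simp: via_def children_def)

lemma via_L1: "x \<in> L1 \<Longrightarrow> via x = x"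
  and via_children: "u \<in> children x \<Longrightarrow> via u = x"
  using L2_sub(3) by (auto simp: via_def children_def)

lemma dc_step_L1:
  assumes x: "x \<in> L1"
  shows "leader (step c x) = v" "parent (step c x) = Some v" "items (step c x) = []"
    "known (step c x) = (if down (c v) x \<noteq> [] \<and> fst (hd (down (c v) x)) = x then Some (ed x) else known (c x))"
    "route (step c x) = (\<lambda>u. if down (c v) x \<noteq> [] \<and> fst (hd (down (c v) x)) = u then None else route (c x) u)"
    "down (step c x) = (\<lambda>u. if down (c v) x \<noteq> [] \<and> fst (hd (down (c v) x)) = u \<and> u \<noteq> x
       then [hd (down (c v) x)] else [])"
proof -
  have xV: "x \<in> V" "x \<noteq> v" using x L1_sub by auto
  have vx: "{v, x} \<in> E" using x by (simp add: L1_def neighbours_def)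
  let ?q = "down (c v) x"
  have xch: "x \<notin> children x" using x L2_sub(3) by (auto simp: children_def)
  have tl: "tl (down (c x) u) = []" for u using dc_L1(6)[OF x, of u] by auto
  have pend_q: "fst a \<in> pending c" "via (fst a) = x" "a \<in> set As" "fst a = x \<or> fst a \<in> children x" if "a \<in> set ?q" for a
  proof -
    have a: "a \<in> set As" "fst a \<in> V - {v}" "via (fst a) = x" using that dc_v(6)[of x] by auto
    then show "fst a \<in> pending c" "via (fst a) = x" "a \<in> set As" "fst a = x \<or> fst a \<in> children x"
      using that via_cases[of "fst a" x] by (auto simp: pending_def)
  qed
  have "leader (step c x) = v \<and> parent (step c x) = Some v \<and> items (step c x) = [] \<and>
    known (step c x) = (if ?q \<noteq> [] \<and> fst (hd ?q) = x then Some (ed x) else known (c x)) \<and>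
    route (step c x) = (\<lambda>u. if ?q \<noteq> [] \<and> fst (hd ?q) = u then None else route (c x) u) \<and>
    down (step c x) = (\<lambda>u. if ?q \<noteq> [] \<and> fst (hd ?q) = u \<and> u \<noteq> x then [hd ?q] else [])"
  proof (cases "active c x")
    case False
    note h = down_Nil_if_halted[OF False]
    \<comment> \<open>An answer queued at the root for the subtree of \<open>x\<close> would be for
      \<open>x\<close>, whose answer would then be unknown, or for a child, which would then have a
      route. Neither is possible at a halted node.\<close>
    have "?q = []"
    proof (rule ccontr)
      assume "?q \<noteq> []"
      then have a: "hd ?q \<in> set ?q" by simp
      from pend_q(4)[OF a] show False
      proof
        assume "fst (hd ?q) = x"
        then show False using pend_q(1)[OF a] dc_L1(4)[OF x] h by auto
      next
        assume "fst (hd ?q) \<in> children x"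
        then have "route (c x) (fst (hd ?q)) \<noteq> None" using pend_q(1)[OF a] dc_L1(5)[OF x] by simp
        then show False using h by simp
      qed
    qed
    moreover have "step c x = c x" using False by (simp add: step_def)
    ultimately show ?thesis using h dc_L1[OF x] by auto
  next
    case True
    let ?s = "(c x)\<lparr>items := items (c x), down := (\<lambda>w. tl (down (c x) w))\<rparr>"
    have st: "step c x = obtain_answer E V c x ?s" using dc_step[OF xV(1) True] .
    show ?thesis
    proof (cases "?q = []")
      case True
      then have "step c x = ?s" unfolding st using dc_L1(2)[OF x] by (simp add: obtain_answer_def)
      then show ?thesis using True tl dc_L1[OF x] by simp
    next
      case False
      have actv: "active c v" using False down_Nil_if_halted[of c v] by blast
      have a: "hd ?q \<in> set ?q" using False by simp
      obtain u y z where h: "hd ?q = (u, y, z)" by (cases "hd ?q") auto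
      have st': "step c x = take_answer (vw x) (u, y, z) ?s"
        unfolding st using False actv vx dc_L1(2)[OF x] h by (simp add: obtain_answer_def)
      have e: "{{u, y}, {u, z}} = ed u" using ed pend_q(3)[OF a] h by simp
      show ?thesis
      proof (cases "u = x")
        case True
        then have "step c x = ?s\<lparr>known := Some (ed x)\<rparr>" unfolding st' using e by (simp add: take_answer_def)
        moreover have "route (c x) x = None" using dc_L1(5)[OF x] xch by simp
        ultimately show ?thesis using False h True tl dc_L1[OF x] by (auto simp: fun_eq_iff)
      next
        case ux: False
        then have uch: "u \<in> children x" using pend_q(4)[OF a] h by simp
        then have r: "route (c x) u = Some u" using dc_L1(5)[OF x] pend_q(1)[OF a] h by simp
        have "step c x = ?s\<lparr>down := (\<lambda>w. tl (down (c x) w))(u := [(u, y, z)]), route := (route (c x))(u := None)\<rparr>"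
          unfolding st' using ux r tl by (simp add: take_answer_def)
        then show ?thesis using False h ux tl dc_L1[OF x] by (auto simp: fun_eq_iff)
      qed
    qed
  qed
  then show "leader (step c x) = v" "parent (step c x) = Some v" "items (step c x) = []"
    "known (step c x) = (if ?q \<noteq> [] \<and> fst (hd ?q) = x then Some (ed x) else known (c x))"
    "route (step c x) = (\<lambda>u. if ?q \<noteq> [] \<and> fst (hd ?q) = u then None else route (c x) u)"
    "down (step c x) = (\<lambda>u. if ?q \<noteq> [] \<and> fst (hd ?q) = u \<and> u \<noteq> x then [hd ?q] else [])"
    by auto
qed

lemma dc_step_L2:
  assumes w: "w \<in> L2"
  shows "leader (step c w) = v" "parent (step c w) = Some (par w)" "items (step c w) = []"
    "route (step c w) = Map.empty" "down (step c w) = (\<lambda>_. [])"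
    "known (step c w) = (if down (c (par w)) w \<noteq> [] then Some (ed w) else known (c w))"
proof -
  let ?x = "par w"
  have wV: "w \<in> V" using w L2_sub by auto
  have x: "?x \<in> L1" "{?x, w} \<in> E" using par_L2[OF w] by (auto simp: neighbours_def insert_commute)
  have "leader (step c w) = v \<and> parent (step c w) = Some (par w) \<and> items (step c w) = [] \<and>
    route (step c w) = Map.empty \<and> down (step c w) = (\<lambda>_. []) \<and>
    known (step c w) = (if down (c ?x) w \<noteq> [] then Some (ed w) else known (c w))"
  proof (cases "active c w")
    case False
    then have "step c w = c w" by (simp add: step_def)
    \<comment> \<open>An answer waiting at the parent would mean that \<open>w\<close> does not know
      its edges yet, so \<open>w\<close> would not have halted.\<close>
    moreover have "down (c ?x) w = []" using down_Nil_if_halted[OF False, of w] dc_L2(6)[OF w]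
      by (auto split: if_splits)
    ultimately show ?thesis using dc_L2[OF w] by simp
  next
    case True
    let ?s = "(c w)\<lparr>items := items (c w), down := (\<lambda>z. tl (down (c w) z))\<rparr>"
    have st: "step c w = obtain_answer E V c w ?s" using dc_step[OF wV True] .
    show ?thesis
    proof (cases "down (c ?x) w = []")
      case True
      then have "step c w = ?s" unfolding st using dc_L2(2)[OF w] by (simp add: obtain_answer_def)
      then show ?thesis using True dc_L2[OF w] by simp
    next
      case False
      have actx: "active c ?x" using False down_Nil_if_halted[of c ?x] by blast
      obtain a where a: "a \<in> set As" "down (c ?x) w = [a]" "fst a = w" using dc_L1(6)[OF x(1), of w] False by auto
      obtain y z where h: "a = (w, y, z)" using a(3) by (cases a) auto
      have "step c w = ?s\<lparr>known := Some (ed w)\<rparr>"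
        unfolding st using False actx x(2) dc_L2(2)[OF w] a h ed[of w y z]
        by (simp add: obtain_answer_def take_answer_def)
      then show ?thesis using False dc_L2[OF w] by simp
    qed
  qed
  then show "leader (step c w) = v" "parent (step c w) = Some (par w)" "items (step c w) = []"
    "route (step c w) = Map.empty" "down (step c w) = (\<lambda>_. [])"
    "known (step c w) = (if down (c (par w)) w \<noteq> [] then Some (ed w) else known (c w))" by auto
qed

text \<open>Addressees in a root queue are distinct, so a node whose answer has left at the head
  does not occur in the tail.\<close>

lemma pending_step:
  assumes "u \<in> V - {v}"
  shows "u \<in> pending (step c) \<longleftrightarrow> u \<in> pending c \<and> fst (hd (down (c v) (via u))) \<noteq> u"
proof -
  have "distinct (map fst (down (c v) (via u)))" using dc_v(5) .
  then show ?thesis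
    unfolding pending_def dc_step_v(5) using assms by (cases "down (c v) (via u)") auto
qed

text \<open>The head of each root queue ceases to be pending. If it is for the child itself it
  becomes known at once; otherwise it moves to that child's queue, and the answer found there before
  is delivered in the same round.\<close>

lemma downcasting_step: "downcasting As ed (step c)"
proof -
  have hdpend: "fst (hd (down (c v) x)) \<in> pending c" "via (fst (hd (down (c v) x))) = x" "hd (down (c v) x) \<in> set As"
    "x \<in> L1 \<and> (fst (hd (down (c v) x)) = x \<or> fst (hd (down (c v) x)) \<in> children x)"
    if "down (c v) x \<noteq> []" for x
  proof -
    have "hd (down (c v) x) \<in> {a \<in> set As. fst a \<in> V - {v} \<and> via (fst a) = x}"
      using dc_v(6)[of x] hd_in_set[OF that] by blast
    then show "fst (hd (down (c v) x)) \<in> pending c" "via (fst (hd (down (c v) x))) = x" "hd (down (c v) x) \<in> set As"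
      "x \<in> L1 \<and> (fst (hd (down (c v) x)) = x \<or> fst (hd (down (c v) x)) \<in> children x)"
      using hd_in_set[OF that] via_cases[of "fst (hd (down (c v) x))" x] by (auto simp: pending_def)
  qed
  have pend_ne: "down (c v) (via u) \<noteq> []" if "u \<in> pending c" for u
    using that by (auto simp: pending_def)
  have L1V: "x \<in> V - {v}" if "x \<in> L1" for x using that L1_sub by auto
  have L2V: "x \<in> V - {v}" if "x \<in> L2" for x using that L2_sub by auto
  have chV: "u \<in> V - {v}" if "u \<in> children x" for u x using that L2V by (auto simp: children_def)
  have L1': "known (step c x) = (if x \<in> pending (step c) then None else Some (ed x)) \<and>
        route (step c x) = (\<lambda>u. if u \<in> children x \<and> u \<in> pending (step c) then Some u else None) \<and>
        (\<forall>u. down (step c x) u = [] \<or>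
          (\<exists>a\<in>set As. down (step c x) u = [a] \<and> fst a = u \<and> u \<in> children x \<and> u \<notin> pending (step c)))"
    if x: "x \<in> L1" for x
  proof (intro conjI allI)
    show "known (step c x) = (if x \<in> pending (step c) then None else Some (ed x))"
      unfolding dc_step_L1(4)[OF x] dc_L1(4)[OF x]
      using pending_step[OF L1V[OF x]] via_L1[OF x] pend_ne[of x] by auto
    have "route (step c x) u = (if u \<in> children x \<and> u \<in> pending (step c) then Some u else None)" for u
    proof (cases "u \<in> children x")
      case True
      then show ?thesis
        unfolding dc_step_L1(5)[OF x] dc_L1(5)[OF x]
        using pending_step[OF chV[OF True]] via_children[OF True] pend_ne[of u] by auto
    qed (simp add: dc_step_L1(5)[OF x] dc_L1(5)[OF x])
    then show "route (step c x) = (\<lambda>u. if u \<in> children x \<and> u \<in> pending (step c) then Some u else None)" by auto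
    fix u
    show "down (step c x) u = [] \<or>
          (\<exists>a\<in>set As. down (step c x) u = [a] \<and> fst a = u \<and> u \<in> children x \<and> u \<notin> pending (step c))"
    proof (cases "down (c v) x \<noteq> [] \<and> fst (hd (down (c v) x)) = u \<and> u \<noteq> x")
      case True
      then have uch: "u \<in> children x" using hdpend(4)[of x] by auto
      then have "u \<notin> pending (step c)" using pending_step[OF chV[OF uch]] via_children[OF uch] True by auto
      then show ?thesis using True uch hdpend(3)[of x] unfolding dc_step_L1(6)[OF x] by auto
    qed (simp add: dc_step_L1(6)[OF x])
  qed
  have L2': "known (step c w) = (if w \<in> pending (step c) \<or> down (step c (par w)) w \<noteq> [] then None else Some (ed w))"
    if w: "w \<in> L2" for w
  proof -
    have x: "par w \<in> L1" using par_L2[OF w] by simp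
    have wch: "w \<in> children (par w)" using w by (simp add: children_def)
    have vw': "via w = par w" using via_children[OF wch] .
    have ne: "w \<noteq> par w" using x w L2_sub(3) by auto
    have np: "w \<notin> pending c" if "down (c (par w)) w \<noteq> []" using dc_L1(6)[OF x, of w] that by auto
    show ?thesis
      unfolding dc_step_L2(6)[OF w] dc_L2(6)[OF w] dc_step_L1(6)[OF x]
      using pending_step[OF L2V[OF w]] vw' ne np pend_ne[of w] hdpend(1)[of "par w"] by auto
  qed
  have cs: "u \<in> V \<Longrightarrow> leader (step c u) = v" for u
    using V_cases[of u] dc_step_v(1) dc_step_L1(1) dc_step_L2(1) by blast
  have ps: "parent (step c u) = Some (par u) \<and> items (step c u) = []" if "u \<in> V - {v}" for u
    using that V_cases[of u] dc_step_L1(2,3)[of u] dc_step_L2(2,3)[of u] par_L1[of u] by auto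
  have dv: "distinct (map fst (down (step c v) x)) \<and>
        set (down (step c v) x) \<subseteq> {a \<in> set As. fst a \<in> V - {v} \<and> via (fst a) = x}" for x
    unfolding dc_step_v(5) using dc_v(5,6)[of x] set_tl_subset[of "down (c v) x"]
    by (auto simp: map_tl distinct_tl)
  show ?thesis unfolding downcasting_def
    using cs ps dv L1' L2' dc_step_v dc_step_L2(4,5) by auto
qed

lemma downcast_done:
  assumes "\<And>x. down (c v) x = []" "\<And>x u. x \<in> L1 \<Longrightarrow> down (c x) u = []" "u \<in> V"
  shows "upcast_result (c u) = Some (ed u)"
proof -
  have p: "pending c = {}" using assms(1) by (auto simp: pending_def)
  consider "u = v" | "u \<in> L1" | "u \<in> L2" using V_cases[OF assms(3)] by blast
  then show ?thesis
  proof cases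
    case 1
    then show ?thesis using dc_v assms(1) by (simp add: upcast_result_def)
  next
    case 2
    then show ?thesis using dc_L1[OF 2] assms(2)[OF 2] p by (simp add: upcast_result_def)
  next
    case 3
    then show ?thesis using dc_L2[OF 3] assms(2)[OF par_L2(2)[OF 3]] p by (simp add: upcast_result_def)
  qed
qed

text \<open>The queue for \<open>x\<close> holds at most one answer for \<open>x\<close> itself and
  one for each of its children.\<close>

lemma length_down_le: "length (down (c v) x) \<le> Suc D"
proof (cases "down (c v) x = []")
  case False
  have sub: "fst ` set (down (c v) x) \<subseteq> insert x (children x)"
    using dc_v(6)[of x] via_cases[of _ x] by blast
  have "hd (down (c v) x) \<in> {a \<in> set As. fst a \<in> V - {v} \<and> via (fst a) = x}"
    using dc_v(6)[of x] hd_in_set[OF False] by blast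
  then have "x \<in> L1" using via_cases[of "fst (hd (down (c v) x))" x] by blast
  then have xV: "x \<in> V" using L1_sub by auto
  have "length (down (c v) x) = card (fst ` set (down (c v) x))"
    using distinct_card[OF dc_v(5)[of x]] by simp
  also have "\<dots> \<le> card (insert x (children x))" using sub fin_children by (intro card_mono) auto
  also have "\<dots> \<le> Suc D" using card_children[OF xV] fin_children by (simp add: card_insert_if)
  finally show ?thesis .
qed simp

end

section \<open>The total number of rounds\<close>

lemma good_run_solves:
  "\<exists>t \<le> 2 * k + k * D + D + 4. solves_ham (upcast solve cc) V E \<omega> t"
proof -
  obtain j where j: "j \<le> 2 * k + k * D" "upcasting (pre (cfg (Suc j)))" "\<And>u. u \<in> V \<Longrightarrow> active (cfg (Suc j)) u"
    "\<forall>u\<in>V - {v}. items (pre (cfg (Suc j)) u) = []" using all_items_arrive by blast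
  obtain xs where xs: "ham_cycle V (sampled_edges V \<omega>) xs"
    "downcasting (cycle_answers xs) (\<lambda>u. {e \<in> cycle_edges xs. u \<in> e}) (step (cfg (Suc j)))"
    using downcast_start[OF j(2,3,4)] by blast
  define As where "As = cycle_answers xs"
  define ed where "ed u = {e \<in> cycle_edges xs. u \<in> e}" for u
  have ed: "{{u, x}, {u, y}} = ed u" if "(u, x, y) \<in> set As" for u x y
    using that cycle_answer_edges[of xs u x y] xs(1) unfolding As_def ed_def ham_cycle_def by auto
  have dc: "downcasting As ed (cfg (Suc (Suc j) + i))" for i
  proof (induction i)
    case 0
    then show ?case using xs(2) unfolding As_def ed_def by (simp add: cfg_Suc)
  next
    case (Suc i)
    then show ?case using downcasting_step[OF _ ed] by (simp add: cfg_Suc)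
  qed
  have ln: "length (down (cfg (Suc (Suc j) + i) v) x) \<le> Suc D - i" for i x
  proof (induction i)
    case 0
    then show ?case using length_down_le[OF dc[of 0] ed] by simp
  next
    case (Suc i)
    have "down (cfg (Suc (Suc j) + Suc i) v) x = tl (down (cfg (Suc (Suc j) + i) v) x)"
      using dc_step_v(5)[OF dc[of i] ed] by (simp add: cfg_Suc)
    then show ?case using Suc by simp
  qed
  let ?i = "Suc D"
  have e: "down (cfg (Suc (Suc j) + ?i) v) x = []" for x using ln[of ?i x] by simp
  \<comment> \<open>The leader has computed by round \<open>j + 2\<close>; its queues drain in
    \<open>D + 1\<close> rounds, and one more round brings the last answers from depth one to depth
    two.\<close>
  define T where "T = Suc (Suc j) + Suc ?i"
  have T: "cfg T = step (cfg (Suc (Suc j) + ?i))" unfolding T_def by (simp add: cfg_Suc)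
  have "down (cfg T v) x = []" for x
    unfolding T using dc_step_v(5)[OF dc[of ?i] ed] e by simp
  moreover have "down (cfg T x) u = []" if "x \<in> L1" for x u
    unfolding T using dc_step_L1(6)[OF dc[of ?i] ed that] e by simp
  moreover have "downcasting As ed (cfg T)" unfolding T_def by (rule dc)
  ultimately have res: "upcast_result (cfg T u) = Some (ed u)" if "u \<in> V" for u
    using downcast_done[of As ed "cfg T" u] ed that by blast
  have "sampled_edges V \<omega> \<subseteq> E"
    using nbr_samples unfolding sampled_edges_def neighbours_def by auto
  then have "ham_cycle V E xs" using xs(1) ham_cycle_mono by blast
  then have "solves_ham (upcast solve cc) V E \<omega> T"
    unfolding solves_ham_def using res unfolding ed_def by (auto simp: upcast_def)
  moreover have "T \<le> 2 * k + k * D + D + 4" unfolding T_def using j(1) by simp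
  ultimately show ?thesis by blast
qed

end

section \<open>Bandwidth\<close>

text \<open>The code is prefix-free. The version with remainders \<open>r\<close> and
  \<open>s\<close> carries the induction and lets the fields of a message be split off one after
  another.\<close>

lemma encode_nat_append_inject: "encode_nat x @ r = encode_nat y @ s \<Longrightarrow> x = y \<and> r = s"
proof (induction x arbitrary: y rule: less_induct)
  case (less x)
  show ?case
  proof (cases "x = 0 \<or> y = 0")
    case True
    then show ?thesis using less.prems
      by (auto simp: encode_nat.simps[of x] encode_nat.simps[of y] split: if_splits)
  next
    case False
    then have eq: "odd x = odd y" "encode_nat (x div 2) @ r = encode_nat (y div 2) @ s"
      using less.prems by (auto simp: encode_nat.simps[of x] encode_nat.simps[of y])
    have "x div 2 < x" using False by simp
    then have "x div 2 = y div 2 \<and> r = s" using less.IH eq(2) by blast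
    moreover have "x = 2 * (x div 2) + (if odd x then 1 else 0)" "y = 2 * (y div 2) + (if odd y then 1 else 0)"
      by auto
    ultimately show ?thesis using eq(1) by metis
  qed
qed

lemma encode_nat_inject [simp]: "encode_nat x = encode_nat y \<longleftrightarrow> x = y"
  using encode_nat_append_inject[of x "[]" y "[]"] by auto

lemma inj_encode_msg: "inj encode_msg"
proof (rule injI)
  fix m m' assume eq: "encode_msg m = encode_msg m'"
  obtain l i a where m: "m = Msg l i a" by (cases m)
  obtain l' i' a' where m': "m' = Msg l' i' a'" by (cases m')
  have l: "l = l'" and 1: "(case i of None \<Rightarrow> [False] | Some (u, x) \<Rightarrow> True # encode_nat u @ encode_nat x) @
     (case a of None \<Rightarrow> [False] | Some (u, x, y) \<Rightarrow> True # encode_nat u @ encode_nat x @ encode_nat y) =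
     (case i' of None \<Rightarrow> [False] | Some (u, x) \<Rightarrow> True # encode_nat u @ encode_nat x) @
     (case a' of None \<Rightarrow> [False] | Some (u, x, y) \<Rightarrow> True # encode_nat u @ encode_nat x @ encode_nat y)"
    using eq encode_nat_append_inject unfolding m m' encode_msg.simps by blast+
  have "i = i' \<and> (case a of None \<Rightarrow> [False] | Some (u, x, y) \<Rightarrow> True # encode_nat u @ encode_nat x @ encode_nat y) =
     (case a' of None \<Rightarrow> [False] | Some (u, x, y) \<Rightarrow> True # encode_nat u @ encode_nat x @ encode_nat y)"
    using 1 by (auto split: option.splits dest!: encode_nat_append_inject)
  moreover from this have "a = a'"
    by (auto split: option.splits dest!: encode_nat_append_inject)
  ultimately show "m = m'" using l m m' by simp
qed

lemma length_encode_nat: "x < 2 ^ d \<Longrightarrow> length (encode_nat x) \<le> 2 * d + 1"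
proof (induction d arbitrary: x)
  case 0
  then show ?case by (simp add: encode_nat.simps)
next
  case (Suc d)
  then have "length (encode_nat (x div 2)) \<le> 2 * d + 1" by (intro Suc.IH) auto
  then show ?case by (simp add: encode_nat.simps[of x])
qed

text \<open>Everything a message may contain is a vertex, hence a short identifier. As the bandwidth
  bound is required on every graph, this is shown without any goodness of the run.\<close>

definition ids_in :: "nat set \<Rightarrow> upcast_state \<Rightarrow> bool" where
  "ids_in V s \<longleftrightarrow> leader s \<in> V \<and> set (samples s) \<subseteq> V \<and> set (items s) \<subseteq> V \<times> V \<and>
     (\<forall>w. set (down s w) \<subseteq> V \<times> V \<times> V)"

lemma ids_in_take_answer: "ids_in V s \<Longrightarrow> a \<in> V \<times> V \<times> V \<Longrightarrow> ids_in V (take_answer vw a s)"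
  unfolding ids_in_def by (auto simp: take_answer_def split: option.splits prod.splits)

lemma ids_in_fold_take_answer:
  "ids_in V s \<Longrightarrow> set As \<subseteq> V \<times> V \<times> V \<Longrightarrow> ids_in V (fold (take_answer vw) As s)"
  by (induction As arbitrary: s) (auto intro: ids_in_take_answer)

lemma cycle_answers_subset: "set (cycle_answers xs) \<subseteq> set xs \<times> set xs \<times> set xs"
proof
  fix a assume "a \<in> set (cycle_answers xs)"
  then obtain i where i: "i < length xs" "a = (xs ! (Suc i mod length xs), xs ! i, xs ! (Suc (Suc i) mod length xs))"
    unfolding cycle_answers_def by auto
  then have "0 < length xs" by linarith
  then have "Suc i mod length xs < length xs" "Suc (Suc i) mod length xs < length xs" by auto
  then show "a \<in> set xs \<times> set xs \<times> set xs" using i by auto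
qed

text \<open>Whenever the solver answers, the answer is a Hamiltonian cycle of exactly the vertex set
  it was given, so no foreign identifier can enter, even if a wrong node were to compute.\<close>

lemma ids_in_leader_computes:
  assumes "ham_solver solve" "ids_in V s" "u \<in> V"
  shows "ids_in V (leader_computes solve cc (view_of V E u) s)"
proof -
  let ?W = "insert u (fst ` set (items s))"
  have W: "?W \<subseteq> V" using assms(2,3) unfolding ids_in_def by auto
  have "set (cycle_answers xs) \<subseteq> V \<times> V \<times> V" if "solve ?W F = Some xs" for xs F
  proof -
    have "ham_cycle ?W F xs" using assms(1) that unfolding ham_solver_def by (metis option.simps(5))
    then have "set xs \<subseteq> V" using W unfolding ham_cycle_def by simp
    then show ?thesis using cycle_answers_subset[of xs] by blast
  qed
  then show ?thesis using assms(2) ids_in_fold_take_answer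
    unfolding leader_computes_def by (auto split: option.splits)
qed

lemma ids_in_config:
  assumes solve: "ham_solver solve" and V: "finite V" and E: "E \<subseteq> all_edges V"
    and \<omega>: "\<And>u. u \<in> V \<Longrightarrow> set (\<omega> u) \<subseteq> V"
  shows "u \<in> V \<Longrightarrow> ids_in V (config (upcast solve cc) V E \<omega> t u)"
proof (induction t arbitrary: u)
  case 0
  then show ?case using \<omega>[of u] by (simp add: config.simps upcast_def upcast_start_def ids_in_def)
next
  case (Suc t)
  let ?c = "config (upcast solve cc) V E \<omega> t"
  have nb: "finite (neighbours E u)" "neighbours E u \<subseteq> V" using finite_neighbours[OF E V, of u] by auto
  have nbc: "ids_in V (?c w)" if "w \<in> neighbours E u" for w using Suc.IH nb that by blast
  define s1 where "s1 = update_tree (view_of V E u) (inbox_of E ?c u) (?c u)"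
  define s2 where "s2 = gather E ?c u s1"
  define s3 where "s3 = obtain_answer E V ?c u s2"
  have cu: "ids_in V (?c u)" using Suc by simp
  have "Min (insert (leader (?c u)) ((\<lambda>(w, m). msg_leader m) ` set (inbox_of E ?c u))) \<in> V"
  proof -
    let ?S = "insert (leader (?c u)) ((\<lambda>w. leader (?c w)) ` {w \<in> neighbours E u. active ?c w})"
    have "Min ?S \<in> ?S" using nb(1) by (intro Min_in) auto
    moreover have "?S \<subseteq> V" using cu nbc unfolding ids_in_def by auto
    ultimately show ?thesis unfolding msg_leaders_inbox_of[OF nb(1)] by blast
  qed
  moreover have "set (tl (items (?c u))) \<subseteq> V \<times> V" "set (tl (down (?c u) w)) \<subseteq> V \<times> V \<times> V" for w
    using cu set_tl_subset[of "items (?c u)"] set_tl_subset[of "down (?c u) w"] unfolding ids_in_def by blast+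
  ultimately have 1: "ids_in V s1"
    using cu Suc.prems unfolding s1_def update_tree_def Let_def ids_in_def by auto
  have hd: "hd (items (?c w)) \<in> V \<times> V" if "w \<in> set (senders E ?c l u)" for w l
  proof -
    have "w \<in> neighbours E u" "items (?c w) \<noteq> []" using that nb(1) unfolding senders_def by auto
    then show ?thesis using nbc[of w] hd_in_set[of "items (?c w)"] unfolding ids_in_def by blast
  qed
  have "set (map (\<lambda>w. hd (items (?c w))) (senders E ?c (leader s1) u)) \<subseteq> V \<times> V"
    unfolding set_map by (rule image_subsetI) (rule hd)
  then have 2: "ids_in V s2" using 1 unfolding s2_def gather_def ids_in_def by simp
  have 3: "ids_in V s3"
  proof (cases "parent s2")
    case None
    then show ?thesis using 2 by (simp add: s3_def obtain_answer_def)
  next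
    case (Some x)
    show ?thesis
    proof (cases "{x, u} \<in> E \<and> active ?c x \<and> down (?c x) u \<noteq> []")
      case True
      then have "x \<in> neighbours E u" by (simp add: neighbours_def insert_commute)
      then have "hd (down (?c x) u) \<in> V \<times> V \<times> V"
        using nbc[of x] True hd_in_set[of "down (?c x) u"] unfolding ids_in_def by blast
      then show ?thesis using ids_in_take_answer[OF 2] True Some by (simp add: s3_def obtain_answer_def)
    qed (use 2 Some in \<open>auto simp: s3_def obtain_answer_def\<close>)
  qed
  have 4: "ids_in V (leader_computes solve cc (view_of V E u) s3)"
    using ids_in_leader_computes[OF solve 3 Suc.prems] .
  have "config (upcast solve cc) V E \<omega> (Suc t) u =
      (if active ?c u then leader_computes solve cc (view_of V E u) s3 else ?c u)"
    unfolding config.simps Let_def s3_def s2_def s1_def upcast_receive_eq[OF nb(1), symmetric, of solve cc V]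
    by (simp add: upcast_def active_def)
  then show ?case using 4 cu by simp
qed

text \<open>A message has at most six identifiers (one leader, two in an item, three in an answer)
  of \<open>2 * d + 1\<close> bits each, and two tag bits.\<close>

lemma length_encode_message:
  assumes ids: "ids_in V (c u)" and V: "V \<subseteq> {..<2 ^ d}"
  shows "length (encode_msg (message c u w)) \<le> 12 * d + 8"
proof -
  have b: "length (encode_nat x) \<le> 2 * d + 1" if "x \<in> V" for x using length_encode_nat V that by auto
  have l: "leader (c u) \<in> V" using ids unfolding ids_in_def by simp
  have i: "length (case (if parent (c u) = Some w then head (items (c u)) else None) of None \<Rightarrow> [False]
      | Some (u, x) \<Rightarrow> True # encode_nat u @ encode_nat x) \<le> 4 * d + 3"
  proof (cases "parent (c u) = Some w \<and> items (c u) \<noteq> []")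
    case True
    then obtain y z rest where "items (c u) = (y, z) # rest" by (metis list.exhaust surj_pair)
    then show ?thesis using True ids b[of y] b[of z] unfolding ids_in_def by auto
  qed auto
  have a: "length (case head (down (c u) w) of None \<Rightarrow> [False]
      | Some (u, x, y) \<Rightarrow> True # encode_nat u @ encode_nat x @ encode_nat y) \<le> 6 * d + 4"
  proof (cases "down (c u) w")
    case (Cons q qs)
    obtain x y z where q: "q = (x, y, z)" by (cases q) auto
    have "set (down (c u) w) \<subseteq> V \<times> V \<times> V" using ids unfolding ids_in_def by blast
    then have "x \<in> V" "y \<in> V" "z \<in> V" using Cons q by auto
    then show ?thesis using Cons q b[of x] b[of y] b[of z] by simp
  qed simp
  show ?thesis using b[OF l] i a unfolding message_def by simp
qed

text \<open>With \<open>d\<close> the binary logarithm of \<open>n\<close> rounded up, identifiers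
  lie below \<open>2 ^ (d * a)\<close>. For \<open>n\<close> at least 2 the logarithm is at least
  one, which absorbs the rounding as \<open>d \<le> 2 * log 2 n\<close> and the additive 8 as
  \<open>8 * log 2 n\<close>.\<close>

lemma congest_upcast:
  assumes solve: "ham_solver solve"
  shows "congest a ((24 * real a + 8) / ln 2) (upcast solve cc)"
  unfolding congest_def
proof (intro conjI allI impI)
  show "inj (encode (upcast solve cc))" using inj_encode_msg by (simp add: upcast_def)
  fix n V E \<omega> t u w m
  assume n: "2 \<le> (n :: nat)" and id: "id_assignment a n V" and E: "E \<subseteq> all_edges V"
    and \<omega>: "\<omega> \<in> set_pmf (coin_space (upcast solve cc) V E)"
    and tr: "transmitted (upcast solve cc) V E (config (upcast solve cc) V E \<omega> t) u w = Some m"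
  let ?c = "config (upcast solve cc) V E \<omega> t"
  have V: "finite V" using id n unfolding id_assignment_def by (metis card.infinite not_numeral_le_zero)
  have m: "m = message ?c u w" and uw: "{u, w} \<in> E"
    using tr unfolding transmitted_upcast by (auto split: if_splits)
  have uV: "u \<in> V" using uw E pair_in_all_edges[of u w V] by auto
  have "set (\<omega> z) \<subseteq> V" if z: "z \<in> V" for z
  proof -
    have "\<omega> z \<in> set_pmf (uniform_samples (sample_count cc (card V)) (neighbours E z))"
      using \<omega> z unfolding coin_space_upcast set_Pi_pmf[OF V] by (auto simp: PiE_dflt_def)
    then have "set (\<omega> z) \<subseteq> neighbours E z"
      using finite_neighbours(1)[OF E V, of z] by (auto simp: uniform_samples_def set_replicate_pmf split: if_splits)
    then show ?thesis using finite_neighbours(2)[OF E V, of z] by blast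
  qed
  then have ids: "ids_in V (?c u)" using ids_in_config[OF solve V E _ uV] by blast
  define d where "d = nat \<lceil>log 2 (real n)\<rceil>"
  have lg: "1 \<le> log 2 (real n)" using n by (simp add: le_log_iff)
  have "real n \<le> 2 powr real d"
  proof -
    have "log 2 (real n) \<le> real d" unfolding d_def by linarith
    then show ?thesis using n by (simp add: log_le_iff)
  qed
  then have "real n \<le> real (2 ^ d)" by (simp add: powr_realpow)
  then have "n \<le> 2 ^ d" by (simp only: of_nat_le_iff)
  then have "n ^ a \<le> 2 ^ (d * a)" by (simp add: power_mono power_mult)
  then have "V \<subseteq> {..<2 ^ (d * a)}" using id unfolding id_assignment_def by auto
  then have "length (encode_msg m) \<le> 12 * (d * a) + 8" unfolding m by (rule length_encode_message[of V ?c u, OF ids])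
  then have "real (length (encode_msg m)) \<le> real (12 * (d * a) + 8)" by (rule of_nat_mono)
  also have "\<dots> = 12 * (real d * real a) + 8" by simp
  also have "real d \<le> 2 * log 2 (real n)" unfolding d_def using lg by linarith
  then have "12 * (real d * real a) + 8 \<le> 12 * ((2 * log 2 (real n)) * real a) + 8 * log 2 (real n)"
    using lg by (intro add_mono mult_left_mono mult_right_mono) auto
  also have "\<dots> = (24 * real a + 8) / ln 2 * ln (real n)" by (simp add: log_def field_simps)
  finally show "real (length (encode (upcast solve cc) m)) \<le> (24 * real a + 8) / ln 2 * ln (real n)"
    by (simp add: upcast_def)
qed

section \<open>Assembling the bounds\<close>

lemma one_minus_exp_ge:
  fixes x :: real
  assumes "0 < x" "x \<le> 1"
  shows "x / 2 \<le> 1 - exp (- x)"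
proof -
  have "1 + x \<le> exp x" by (rule exp_ge_add_one_self)
  then have "exp (- x) \<le> 1 / (1 + x)" using assms by (simp add: exp_minus field_simps)
  moreover have "1 / (1 + x) \<le> 1 - x / 2" using assms by (simp add: field_simps power2_eq_square mult_left_le)
  ultimately show ?thesis by linarith
qed

lemma good_run_solves_ham:
  assumes V: "finite V" and n: "n = card V" "12 \<le> n" and good: "good_run k V d E \<omega>"
    and k: "k = sample_count c n" "0 < k" and solve: "ham_solver solve" and d: "0 \<le> d"
  shows "\<exists>t. real t \<le> 2 * real k + real k * d + d + 4 \<and> solves_ham (upcast solve c) V E \<omega> t"
proof -
  define D where "D = nat \<lfloor>d\<rfloor>"
  have D: "real D \<le> d" unfolding D_def using d by simp
  interpret good_upcast_run V E \<omega> D k solve c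
  proof
    fix u assume "u \<in> V"
    then have "real (card (neighbours E u)) \<le> d" using good unfolding good_run_def by blast
    then show "card (neighbours E u) \<le> D" unfolding D_def by linarith
  qed (use V n good k solve in \<open>auto simp: good_run_def\<close>)
  obtain t where t: "t \<le> 2 * k + k * D + D + 4" "solves_ham (upcast solve c) V E \<omega> t"
    using good_run_solves by blast
  have "real t \<le> real (2 * k + k * D + D + 4)" using t(1) by (rule of_nat_mono)
  also have "\<dots> = 2 * real k + real k * real D + real D + 4" by simp
  also have "\<dots> \<le> 2 * real k + real k * d + d + 4"
    using D by (intro add_mono mult_left_mono) auto
  finally show ?thesis using t(2) by blast
qed

theorem theorem4:
  fixes p :: "nat \<Rightarrow> real" and a :: nat
    and solve :: "nat set \<Rightarrow> nat set set \<Rightarrow> nat list option"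
  assumes "\<And>n. 0 \<le> p n \<and> p n \<le> 1"
    and "p \<in> \<Theta>(\<lambda>n. ln (real n) / sqrt (real n))"
    and "ham_solver solve"
  shows "\<exists>c0>0. \<forall>c\<ge>c0.
           (\<exists>B. congest a B (upcast solve c)) \<and>
           (\<exists>C>0. \<exists>\<gamma>>0. \<forall>\<^sub>F n in sequentially. \<forall>V. id_assignment a n V \<longrightarrow>
              measure_pmf.prob (run_space (upcast solve c) V (p n))
                {(E, \<omega>). \<exists>t. real t \<le> C * sqrt (real n) * (ln (real n))\<^sup>2 \<and>
                             solves_ham (upcast solve c) V E \<omega> t}
              \<ge> 1 - 1 / real n powr \<gamma>)"
proof -
  obtain c1 where c1: "0 < c1" "\<forall>\<^sub>F n in sequentially. c1 * norm (ln (real n) / sqrt (real n)) \<le> norm (p n)"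
    using landau_omega.bigE[OF bigthetaD2[OF assms(2)]] by blast
  obtain c2 where c2: "0 < c2" "\<forall>\<^sub>F n in sequentially. norm (p n) \<le> c2 * norm (ln (real n) / sqrt (real n))"
    using landau_o.bigE[OF bigthetaD1[OF assms(2)]] by blast
  have main: "\<forall>\<^sub>F n in sequentially. \<forall>V. id_assignment a n V \<longrightarrow>
      measure_pmf.prob (run_space (upcast solve c) V (p n))
        {(E, \<omega>). \<exists>t. real t \<le> (4 * c + 8 * c * c2 + 4 * c2 + 4) * sqrt (real n) * (ln (real n))\<^sup>2 \<and>
                     solves_ham (upcast solve c) V E \<omega> t}
      \<ge> 1 - 1 / real n powr 1" if c: "7680 \<le> c" for c
  proof -
    have "\<forall>\<^sub>F n in sequentially. x \<le> sqrt (real n)" "\<forall>\<^sub>F n in sequentially. x \<le> ln (real n)" for x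
      using filterlim_compose[OF sqrt_at_top filterlim_real_sequentially]
        filterlim_compose[OF ln_at_top filterlim_real_sequentially]
      unfolding filterlim_at_top by auto
    \<comment> \<open>The first threshold makes \<open>n * p\<close> at least
      \<open>4 * ln n\<close>, the second keeps the thinning rate at most 1, and the third makes
      \<open>p^2 * (n - 2)\<close> at least \<open>4 * ln n\<close>.\<close>
    then have "\<forall>\<^sub>F n in sequentially. 4 / c1 \<le> sqrt (real n)"
      "\<forall>\<^sub>F n in sequentially. c / (16 * c1) \<le> sqrt (real n)"
      "\<forall>\<^sub>F n in sequentially. 8 / c1\<^sup>2 \<le> ln (real n)" by blast+
    with c1(2) c2(2) eventually_ge_at_top[of 12] show ?thesis
    proof eventually_elim
      case (elim n)
      show ?case
      proof (intro allI impI)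
        fix V assume id: "id_assignment a n V"
        have nV: "n = card V" and n: "12 \<le> n" using id elim unfolding id_assignment_def by auto
        have V: "finite V" using nV n by (metis card.infinite not_numeral_le_zero)
        define l where "l = ln (real n)"
        define r where "r = sqrt (real n)"
        define k where "k = sample_count c n"
        have rr: "r * r = real n" unfolding r_def by simp
        have r1: "1 \<le> r" unfolding r_def using n by simp
        have "exp 1 \<le> real n" using e_less_272 n by linarith
        then have l1: "1 \<le> l" unfolding l_def using n by (simp add: ln_ge_iff)
        have p01: "0 \<le> p n" "p n \<le> 1" using assms(1)[of n] by auto
        have lo: "c1 * (l / r) \<le> p n" and hi: "p n \<le> c2 * (l / r)"
          using elim p01 l1 r1 unfolding l_def r_def by auto
        have np_lo: "c1 * (r * l) \<le> real n * p n"
        proof -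
          have "real n * (c1 * (l / r)) \<le> real n * p n" using lo by (intro mult_left_mono) auto
          then show ?thesis using r1 unfolding rr[symmetric] by (simp add: field_simps)
        qed
        have np_hi: "real n * p n \<le> c2 * (r * l)"
        proof -
          have "real n * p n \<le> real n * (c2 * (l / r))" using hi by (intro mult_left_mono) auto
          then show ?thesis using r1 unfolding rr[symmetric] by (simp add: field_simps)
        qed
        have np0: "0 < real n * p n" using np_lo c1(1) r1 l1 by (auto intro: less_le_trans[rotated])
        have np4: "4 * l \<le> real n * p n"
        proof -
          have "4 \<le> c1 * r" using elim(4) c1(1) unfolding r_def[symmetric] by (simp add: field_simps)
          then have "4 * l \<le> c1 * r * l" using l1 by (intro mult_right_mono) auto
          then show ?thesis using np_lo by (simp add: mult.assoc)
        qed
        have cl: "1 \<le> c * l" using mult_mono[of 1 c 1 l] c l1 by auto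
        have k_lo: "c * l \<le> real k" and k_hi: "real k \<le> 2 * (c * l)"
          using cl unfolding k_def sample_count_def l_def[symmetric] by linarith+
        have k0: "0 < k" using k_lo cl by (cases k) auto
        \<comment> \<open>Chosen so that a node of the maximal degree \<open>4 * n * p\<close> has
          Poisson mean exactly \<open>k / 8\<close>.\<close>
        define \<theta> where "\<theta> = real k / (32 * (real n * p n))"
        have \<theta>0: "0 < \<theta>" unfolding \<theta>_def using k0 np0 by simp
        have "\<theta> \<le> 1"
        proof -
          have "c \<le> 16 * c1 * r" using elim(5) c1(1) unfolding r_def[symmetric] by (simp add: field_simps)
          then have "c * l \<le> 16 * c1 * r * l" using l1 by (intro mult_right_mono) auto
          then have "real k \<le> 32 * (c1 * (r * l))" using k_hi by (simp add: algebra_simps)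
          also have "\<dots> \<le> 32 * (real n * p n)" using np_lo by simp
          finally show ?thesis unfolding \<theta>_def using np0 by (simp add: field_simps)
        qed
        have deg: "\<theta> * (4 * real n * p n) \<le> real (sample_count c n) / 8"
          unfolding \<theta>_def k_def[symmetric] using np0 by (simp add: field_simps)
        have dense: "120 * ln (real n) / real n \<le> p n * (1 - exp (- \<theta>))"
        proof -
          have "7680 * l \<le> c * l" using c l1 by (intro mult_right_mono) auto
          then have "7680 * l \<le> real k" using k_lo by linarith
          then have "120 * l / real n \<le> real k / 64 / real n" by (intro divide_right_mono) auto
          also have "\<dots> = p n * (\<theta> / 2)"
            unfolding \<theta>_def using np0 by (cases "p n = 0") (auto simp: field_simps)
          also have "\<dots> \<le> p n * (1 - exp (- \<theta>))"
            using one_minus_exp_ge[OF \<theta>0 \<open>\<theta> \<le> 1\<close>] p01 by (intro mult_left_mono) auto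
          finally show ?thesis unfolding l_def .
        qed
        let ?R = "run_space (upcast solve c) V (p n)"
        define bad where "bad = {(E, \<omega>). \<not> good_run (sample_count c n) V (4 * real n * p n) E \<omega>}"
        \<comment> \<open>All three exponents are at least \<open>4 * ln n\<close>, so even after a
          union bound over \<open>n\<close> nodes only \<open>1 / n^3\<close> remains.\<close>
        have small: "real n * exp (- x) \<le> 1 / real n ^ 3" if "4 * l \<le> x" for x
        proof -
          have "exp (- x) \<le> exp (- (real 4 * ln (real n)))" using that unfolding l_def by simp
          also have "\<dots> = 1 / real n ^ 4" unfolding exp_minus exp_of_nat_mult using n by (simp add: inverse_eq_divide)
          finally have "real n * exp (- x) \<le> real n * (1 / real n ^ 4)" by (intro mult_left_mono) auto
          also have "\<dots> = 1 / real n ^ 3" using n by (simp add: field_simps power_numeral_reduce)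
          finally show ?thesis .
        qed
        have p2: "4 * l \<le> (p n)\<^sup>2 * (real n - 2)"
        proof -
          have "8 \<le> c1\<^sup>2 * l" using elim(6) c1(1) unfolding l_def[symmetric] by (simp add: field_simps)
          then have "8 * l \<le> c1\<^sup>2 * l * l" using l1 by (intro mult_right_mono) auto
          also have "\<dots> = (c1 * (l / r))\<^sup>2 * real n"
            using r1 unfolding rr[symmetric] by (simp add: power2_eq_square field_simps)
          also have "\<dots> \<le> (p n)\<^sup>2 * real n" using lo c1(1) l1 r1 by (intro mult_right_mono power_mono) auto
          finally have "8 * l \<le> (p n)\<^sup>2 * real n" .
          moreover have "(p n)\<^sup>2 * (real n / 2) \<le> (p n)\<^sup>2 * (real n - 2)"
            using n by (intro mult_left_mono) auto
          ultimately show ?thesis by simp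
        qed
        have k4: "4 * l \<le> real (sample_count c n)"
        proof -
          have "4 * l \<le> c * l" using c l1 by (intro mult_right_mono) auto
          then show ?thesis using k_lo unfolding k_def by linarith
        qed
        have "measure_pmf.prob ?R bad \<le> real n * exp (- (real n * p n)) +
            real n * exp (- ((p n)\<^sup>2 * (real n - 2))) + 2 / real n ^ 2 + real n * exp (- real (sample_count c n))"
          unfolding bad_def by (rule prob_good_run[OF V nV n p01 \<theta>0 deg dense])
        also have "\<dots> \<le> 1 / real n ^ 3 + 1 / real n ^ 3 + 2 / real n ^ 2 + 1 / real n ^ 3"
          using small[OF np4] small[OF p2] small[OF k4] by linarith
        also have "\<dots> \<le> 1 / real n"
        proof -
          have "12 * real n \<le> real n * real n" using n by (intro mult_right_mono) auto
          then have "3 + 2 * real n \<le> real n * real n" using n by linarith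
          then have "real n * (3 + 2 * real n) \<le> real n * (real n * real n)" by (rule mult_left_mono) simp
          then show ?thesis using n by (simp add: field_simps power2_eq_square power3_eq_cube)
        qed
        finally have bad: "measure_pmf.prob ?R bad \<le> 1 / real n" .
        \<comment> \<open>The four summands of the constant match the four terms on the left, via
          \<open>k \<le> 2 * c * l\<close> and \<open>n * p \<le> c2 * r * l\<close>. The product
          \<open>k * (4 * n * p)\<close>, the draining of the queues at depth one, has the order of
          the claimed running time; the others are smaller.\<close>
        have time: "2 * real k + real k * (4 * real n * p n) + 4 * real n * p n + 4 \<le>
            (4 * c + 8 * c * c2 + 4 * c2 + 4) * r * l\<^sup>2"
        proof -
          have l2: "l \<le> l\<^sup>2" using l1 by (simp add: power2_eq_square)
          have rl: "1 \<le> r * l\<^sup>2" using mult_mono[of 1 r 1 "l\<^sup>2"] r1 l1 by auto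
          have lrl: "l \<le> r * l\<^sup>2" using l2 mult_right_mono[OF r1, of "l\<^sup>2"] by simp
          have "c * l \<le> c * (r * l\<^sup>2)" using lrl c by (intro mult_left_mono) auto
          then have "2 * real k \<le> 4 * c * (r * l\<^sup>2)" using k_hi by linarith
          moreover have "real k * (4 * (real n * p n)) \<le> (2 * (c * l)) * (4 * (c2 * (r * l)))"
            by (rule mult_mono[OF k_hi]) (use np_hi np0 c l1 in auto)
          then have "real k * (4 * real n * p n) \<le> 8 * c * c2 * (r * l\<^sup>2)"
            by (simp add: power2_eq_square mult_ac)
          moreover have "4 * real n * p n \<le> 4 * c2 * (r * l\<^sup>2)"
          proof -
            have "c2 * r * l \<le> c2 * r * l\<^sup>2" using l2 c2(1) r1 by (intro mult_left_mono) auto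
            then show ?thesis using np_hi by (simp add: mult.assoc)
          qed
          moreover have "4 \<le> 4 * (r * l\<^sup>2)" using rl by simp
          ultimately show ?thesis by (simp add: algebra_simps)
        qed
        have "1 - 1 / real n powr 1 \<le> 1 - measure_pmf.prob ?R bad" using bad n by simp
        also have "\<dots> = measure_pmf.prob ?R (- bad)" by (simp add: measure_pmf.prob_compl[symmetric] Compl_eq_Diff_UNIV)
        also have "\<dots> \<le> measure_pmf.prob ?R {(E, \<omega>). \<exists>t. real t \<le> (4 * c + 8 * c * c2 + 4 * c2 + 4) *
            sqrt (real n) * (ln (real n))\<^sup>2 \<and> solves_ham (upcast solve c) V E \<omega> t}"
        proof (intro measure_pmf.finite_measure_mono subsetI)
          fix z assume "z \<in> - bad"
          then obtain E \<omega> where z: "z = (E, \<omega>)" "good_run k V (4 * real n * p n) E \<omega>"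
            unfolding bad_def k_def by (cases z) auto
          obtain t where "real t \<le> 2 * real k + real k * (4 * real n * p n) + 4 * real n * p n + 4"
              "solves_ham (upcast solve c) V E \<omega> t"
            using good_run_solves_ham[OF V nV n z(2) k_def k0 assms(3)] np0 by auto
          then show "z \<in> {(E, \<omega>). \<exists>t. real t \<le> (4 * c + 8 * c * c2 + 4 * c2 + 4) *
              sqrt (real n) * (ln (real n))\<^sup>2 \<and> solves_ham (upcast solve c) V E \<omega> t}"
            using time z(1) unfolding r_def l_def by force
        qed simp
        finally show "1 - 1 / real n powr 1 \<le> measure_pmf.prob ?R {(E, \<omega>). \<exists>t. real t \<le>
            (4 * c + 8 * c * c2 + 4 * c2 + 4) * sqrt (real n) * (ln (real n))\<^sup>2 \<and>
            solves_ham (upcast solve c) V E \<omega> t}" .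
      qed
    qed
  qed
  have "(\<exists>B. congest a B (upcast solve c)) \<and>
      (\<exists>C>0. \<exists>\<gamma>>0. \<forall>\<^sub>F n in sequentially. \<forall>V. id_assignment a n V \<longrightarrow>
         measure_pmf.prob (run_space (upcast solve c) V (p n))
           {(E, \<omega>). \<exists>t. real t \<le> C * sqrt (real n) * (ln (real n))\<^sup>2 \<and>
                        solves_ham (upcast solve c) V E \<omega> t}
         \<ge> 1 - 1 / real n powr \<gamma>)" if "7680 \<le> c" for c
  proof
    show "\<exists>B. congest a B (upcast solve c)" using congest_upcast[OF assms(3)] by blast
    have "0 < 4 * c + 8 * c * c2 + 4 * c2 + 4" using that c2(1) by (simp add: add_pos_nonneg)
    then show "\<exists>C>0. \<exists>\<gamma>>0. \<forall>\<^sub>F n in sequentially. \<forall>V. id_assignment a n V \<longrightarrow>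
         measure_pmf.prob (run_space (upcast solve c) V (p n))
           {(E, \<omega>). \<exists>t. real t \<le> C * sqrt (real n) * (ln (real n))\<^sup>2 \<and>
                        solves_ham (upcast solve c) V E \<omega> t}
         \<ge> 1 - 1 / real n powr \<gamma>"
      using main[OF that] zero_less_one by blast
  qed
  \<comment> \<open>\<open>7680 = 64 * 120\<close>: thinning with \<open>\<theta> = k / (32 n p)\<close> leaves an edge density of at least
    \<open>p \<theta> / 2 = k / (64 n)\<close>, and density \<open>120 ln n / n\<close> gives a Hamiltonian cycle.\<close>
  then show ?thesis by (intro exI[of _ 7680]) auto
qed

end
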